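(* Let $1\le r\le n$, let $(\pi,\mathcal V_\pi)$ be an irreducible smooth generic representation of $G_n(F)=\mathrm{SO}_{2n+1}(F)$, and let $v\in\mathcal V_\pi^{K_{n,m}}$ be a nonzero element for some $m\ge0$. Let $(\tau,\mathcal V_\tau)$ be a smooth representation of $\mathrm{GL}_r(F)$ of finite length with $\dim_{\mathbb C}\mathrm{Hom}_{Z_r(F)}(\tau,\bar\psi_{Z_r})=1$. If $\tau$ is ramified (i.e. $\mathcal V_\tau^{\mathrm{GL}_r(\mathfrak o)}=0$), then $\Psi_{n,r}(v\otimes\xi_s)=0$ for all $s\in\mathbb C$ and all $\xi_s\in I_r(\tau,s)$.
   Context: **Field.** $F$ is a finite extension of $\mathbb Q_p$ with ring of integers $\mathfrak o$, maximal ideal $\mathfrak p$, uniformizer $\varpi$, residue field $\mathfrak f$ of cardinality $q$. $\psi$ is an additive character of $F$ with $\ker\psi=\mathfrak o$. $\nu_r(a)=|\det a|$ on $\mathrm{GL}_r(F)$. $\jmath_r$ is the $r\times r$ antidiagonal matrix with antidiagonal entries $1$. Representations are smooth and complex. **$G_n$.** $G_n(F)=\{g\in\mathrm{SL}_{2n+1}(F):{}^tgSg=S\}$, $S=\begin{pmatrix}&&\jmath_n\\&2&\\ \jmath_n&&\end{pmatrix}$, acting on the space with ordered basis $e_1,\dots,e_n,v_0,f_n,\dots,f_1$. $U_n$: upper triangular maximal unipotent subgroup; $\psi_{U_n}(u)=\psi(u_{12}+\cdots+u_{n-1,n}+2^{-1}u_{n,n+1})$; $\Lambda_{\pi,\psi}\in\mathrm{Hom}_{U_n(F)}(\pi,\psi_{U_n})$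 is a fixed nonzero functional; $W_v(g)=\Lambda_{\pi,\psi}(\pi(g)v)$. **Paramodular subgroups.** $J_{n,m}\subset G_n(F)$ is the stabilizer of $\mathfrak oe_1\oplus\cdots\oplus\mathfrak oe_n\oplus\mathfrak p^mv_0\oplus\mathfrak p^mf_n\oplus\cdots\oplus\mathfrak p^mf_1$; $K_{n,0}=J_{n,0}$. For $m\ge1$, with $t_m=\mathrm{diag}(\varpi^mI_n,1,I_n)$, $t_mJ_{n,m}t_m^{-1}=\tilde J_{n,m}$ is the group of $g\in\mathrm{SL}_{2n+1}(\mathfrak o)$ with ${}^tgS_mg=S_m$, $S_m=\begin{pmatrix}&&\jmath_n\\&2\varpi^m&\\ \jmath_n&&\end{pmatrix}$, $g_{j,n+1}\in\mathfrak p^m$ for $j\ne n+1$; reduction mod $\mathfrak p$ gives $\tilde J_{n,m}\to\mathrm S(\mathrm O_{2n}(\mathfrak f)\times\mathrm O_1(\mathfrak f))\to\mathrm O_{2n}(\mathfrak f)$ (delete row and column $n+1$), and $K_{n,m}$ is the index $2$ normal subgroup of $J_{n,m}$ such that $t_mK_{n,m}t_m^{-1}$ is the kernel of $\tilde J_{n,m}\to\mathrm O_{2n}(\mathfrak f)\xrightarrow{\det}\{\pm1\}$. **$H_r$.** $H_r(F)=\{h\in\mathrm{SL}_{2r}(F):{}^th\jmath_{2r}h=\jmath_{2r}\}$, embedded in $G_n(F)$ by $\begin{pmatrix}a&b\\c&d\end{pmatrix}\mapsto\begin{pmatrix}a&&b\\&I_{2(n-r)+1}&\\c&&d\end{pmatrix}$.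 $V_r$ is the upper triangular maximal unipotent subgroup of $H_r$. The Siegel parabolic $Q_r=M_rN_r$ has $M_r(F)=\{m_r(a)=\mathrm{diag}(a,\jmath_r{}^ta^{-1}\jmath_r):a\in\mathrm{GL}_r(F)\}$, $N_r(F)=\{\begin{pmatrix}I_r&b\\&I_r\end{pmatrix}:b=-\jmath_r{}^tb\jmath_r\}$, $\delta_{Q_r}(m_r(a))=\nu_r(a)^{r-1}$. **Integrals.** $Z_r\subset\mathrm{GL}_r$ is the upper triangular unipotent subgroup, $\bar\psi_{Z_r}(z)=\overline{\psi(z_{12}+\cdots+z_{r-1,r})}$, and $\Lambda_{\tau,\bar\psi}$ is a fixed nonzero element of $\mathrm{Hom}_{Z_r(F)}(\tau,\bar\psi_{Z_r})$. $I_r(\tau,s)$ is the space of smooth $\xi_s:H_r(F)\to\mathcal V_\tau$ with $\xi_s(m_r(a)nh)=\delta_{Q_r}^{1/2}(m_r(a))\nu_r(a)^{s-1/2}\tau(a)\xi_s(h)$ for $n\in N_r(F)$. Put $$\Psi_{n,r}(v\otimes\xi_s)=\int_{V_r(F)\backslash H_r(F)}\int_{\bar X_{n,r}(F)}W_v(\bar xh)\Lambda_{\tau,\bar\psi}(\xi_s(h))\,d\bar x\,dh,$$ where $\bar X_{n,r}(F)$ is the group of matrices $\begin{pmatrix}I_r&&&&\\ x&I_{n-r}&&&\\&&1&&\\&&&I_{n-r}&\\&&&x'&I_r\end{pmatrix}$, $x\in\mathrm{Mat}_{(n-r)\times r}(F)$, $x'=-\jmath_r{}^tx\jmath_{n-r}$,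 with any Haar measures. The integral converges absolutely for $\mathrm{Re}(s)\gg0$; for general $s_0$ and $\xi_{s_0}\in I_r(\tau,s_0)$ it is defined by extending $\xi_{s_0}$ to a standard section $\xi'_s$ (restriction to a suitable maximal compact subgroup independent of $s$) and taking the meromorphic continuation of $\Psi_{n,r}(v\otimes\xi'_s)$ (a rational function of $q^{-s}$) at $s=s_0$. *)

theory Defs
  imports
    "HOL-Complex_Analysis.Complex_Analysis"
    "HOL-Algebra.Coset"
    "HOL-Library.Function_Algebras"
    "Jordan_Normal_Form.Determinant"
begin

hide_const (open) Determinants.det

text \<open>
  Matrices are those of \<open>Jordan_Normal_Form\<close>, so all indices are 0-based: the basis
  $e_1,\dots,e_n,v_0,f_n,\dots,f_1$ has the indices $0,\dots,2n$, with $e_i$ at $i-1$, $v_0$ at $n$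
  and $f_i$ at $2n+1-i$.
\<close>


section \<open>The field\<close>

definition padic_abs :: "nat \<Rightarrow> int \<Rightarrow> real" where
  "padic_abs p k = (if k = 0 then 0 else (1 / real p) ^ multiplicity (int p) k)"

text \<open>
  Finite extensions of some $\mathbb Q_p$, with the metric of the normalised absolute value. As the
  field is complete and its absolute value restricts on $\mathbb Z$, hence by multiplicativity on
  $\mathbb Q$, to a power of the $p$-adic one, the closure of $\mathbb Q$ in it is the completion
  $\mathbb Q_p$. A class declaration cannot mention \<open>closure\<close> or \<open>of_rat\<close>, so \<open>finite_over_Qp\<close>
  spells out that \<open>c b\<close> is in this closure (see \<open>finite_over_closure\<close>). The last axiom says that a
  uniformizer has absolute value $q^{-1}$, where $q$ is the number of residue classes
  (so $q$ is finite, because \<open>1 / card _\<close> would be 0 otherwise).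
\<close>

class padic_field = field_char_0 + complete_space +
  assumes dist_translate: "dist (x + z) (y + z) = dist x y"
    and dist_mult_0: "dist (x * y) 0 = dist x 0 * dist y 0"
    and dist_ultrametric: "dist (x + y) 0 \<le> max (dist x 0) (dist y 0)"
    and dist_of_int: "\<exists>p c. prime p \<and> c > 0 \<and> (\<forall>k. dist (of_int k) 0 = padic_abs p k powr c)"
    and finite_over_Qp: "\<exists>B. finite B \<and> (\<forall>x. \<exists>c.
          (\<forall>b\<in>B. \<forall>e>0. \<exists>i j. j \<noteq> 0 \<and> dist (of_int i / of_int j) (c b) < e) \<and>
          x = (\<Sum>b\<in>B. c b * b))"
    and normalised: "\<exists>w. dist w 0 < 1 \<and> (\<forall>x. dist x 0 < 1 \<longrightarrow> (\<exists>y. dist y 0 \<le> 1 \<and> x = w * y)) \<and>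
          dist w 0 = 1 / real (card ((\<lambda>x. {y. dist y x < 1}) ` {x. dist x 0 \<le> 1}))"

lemma closure_Rats_iff:
  fixes x :: "'f::padic_field"
  shows "x \<in> closure (range of_rat) \<longleftrightarrow>
    (\<forall>e>0. \<exists>i j. j \<noteq> 0 \<and> dist (of_int i / of_int j) x < e)"
proof -
  have "(\<exists>y\<in>range of_rat. dist y x < e) \<longleftrightarrow> (\<exists>i j. j \<noteq> 0 \<and> dist (of_int i / of_int j) x < e)" for e
  proof
    assume "\<exists>y\<in>range of_rat. dist y x < e"
    then obtain t where t: "dist (of_rat t) x < e"
      by blast
    obtain i j where "j > 0" "t = Rat.Fract i j"
      by (cases t) auto
    with t show "\<exists>i j. j \<noteq> 0 \<and> dist (of_int i / of_int j) x < e"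
      by (intro exI[of _ i] exI[of _ j]) (simp add: of_rat_rat)
  next
    assume "\<exists>i j. j \<noteq> 0 \<and> dist (of_int i / of_int j) x < e"
    then obtain i j where "j \<noteq> 0" "dist (of_int i / of_int j) x < e"
      by blast
    then show "\<exists>y\<in>range of_rat. dist y x < e"
      by (metis of_rat_rat rangeI)
  qed
  then show ?thesis
    by (simp add: closure_approachable)
qed

lemma finite_over_closure:
  "\<exists>B. finite B \<and> (\<forall>x::'f::padic_field. \<exists>c.
     (\<forall>b\<in>B. c b \<in> closure (range of_rat)) \<and> x = (\<Sum>b\<in>B. c b * b))"
  unfolding closure_Rats_iff by (rule finite_over_Qp)

definition absF :: "'f::padic_field \<Rightarrow> real" where
  "absF x = dist x 0"

definition integers :: "'f::padic_field set" where
  "integers = {x. absF x \<le> 1}"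

definition max_ideal :: "'f::padic_field set" where
  "max_ideal = {x. absF x < 1}"

definition uniformizer :: "'f::padic_field \<Rightarrow> bool" where
  "uniformizer w \<longleftrightarrow> max_ideal = (*) w ` integers"

definition additive_character :: "('f::padic_field \<Rightarrow> complex) \<Rightarrow> bool" where
  "additive_character \<psi> \<longleftrightarrow>
     continuous_on UNIV \<psi> \<and> (\<forall>x. cmod (\<psi> x) = 1) \<and> (\<forall>x y. \<psi> (x + y) = \<psi> x * \<psi> y)"


section \<open>Matrix groups and their topology\<close>

definition mat_group :: "nat \<Rightarrow> 'f::padic_field mat set \<Rightarrow> 'f mat monoid" where
  "mat_group d X = \<lparr>carrier = X, mult = (*), one = 1\<^sub>m d\<rparr>"

definition mat_topology :: "nat \<Rightarrow> 'f::padic_field mat topology" where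
  "mat_topology d = pullback_topology (carrier_mat d d)
     (\<lambda>A. \<lambda>ij\<in>{..<d} \<times> {..<d}. A $$ ij)
     (product_topology (\<lambda>_. euclidean) ({..<d} \<times> {..<d}))"

definition group_topology :: "'f::padic_field mat monoid \<Rightarrow> 'f mat topology" where
  "group_topology G = subtopology (mat_topology (dim_row \<one>\<^bsub>G\<^esub>)) (carrier G)"

text \<open>The quotient topology on the space $V\backslash G$ of cosets $Vg$.\<close>

definition coset_topology ::
    "'f::padic_field mat monoid \<Rightarrow> 'f mat set \<Rightarrow> 'f mat set topology" where
  "coset_topology G V = topology (\<lambda>U. U \<subseteq> rcosets\<^bsub>G\<^esub> V \<and>
     openin (group_topology G) {g \<in> carrier G. V #>\<^bsub>G\<^esub> g \<in> U})"

lemma openin_coset_topology: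
  "openin (coset_topology G V) U \<longleftrightarrow> U \<subseteq> rcosets\<^bsub>G\<^esub> V \<and>
     openin (group_topology G) {g \<in> carrier G. V #>\<^bsub>G\<^esub> g \<in> U}"
proof -
  let ?P = "\<lambda>U. {g \<in> carrier G. V #>\<^bsub>G\<^esub> g \<in> U}"
  have int: "?P (S \<inter> T) = ?P S \<inter> ?P T" for S T
    by auto
  have un: "?P (\<Union>K) = \<Union>(?P ` K)" for K
    by auto
  have "istopology (\<lambda>U. U \<subseteq> rcosets\<^bsub>G\<^esub> V \<and> openin (group_topology G) (?P U))"
    unfolding istopology_def int un by auto
  then show ?thesis
    unfolding coset_topology_def by (simp add: topology_inverse')
qed

definition borel_of :: "'a topology \<Rightarrow> 'a measure" where
  "borel_of X = sigma (topspace X) {U. openin X U}"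

text \<open>
  The groups here are second countable and locally compact, so a Borel measure that is finite on
  compact sets is automatically regular.
\<close>

definition haar_measure :: "'f::padic_field mat monoid \<Rightarrow> 'f mat measure \<Rightarrow> bool" where
  "haar_measure G \<mu> \<longleftrightarrow>
     sets \<mu> = sets (borel_of (group_topology G)) \<and>
     emeasure \<mu> (space \<mu>) \<noteq> 0 \<and>
     (\<forall>C. compactin (group_topology G) C \<longrightarrow> emeasure \<mu> C < \<infinity>) \<and>
     (\<forall>g\<in>carrier G. \<forall>A\<in>sets \<mu>. emeasure \<mu> (g <#\<^bsub>G\<^esub> A) = emeasure \<mu> A)"

text \<open>Invariant measures on $V\backslash G$ for the action of $G$ by right translation.\<close>

definition invariant_coset_measure ::
    "'f::padic_field mat monoid \<Rightarrow> 'f mat set \<Rightarrow> 'f mat set measure \<Rightarrow> bool" where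
  "invariant_coset_measure G V \<mu> \<longleftrightarrow>
     sets \<mu> = sets (borel_of (coset_topology G V)) \<and>
     emeasure \<mu> (space \<mu>) \<noteq> 0 \<and>
     (\<forall>C. compactin (coset_topology G V) C \<longrightarrow> emeasure \<mu> C < \<infinity>) \<and>
     (\<forall>g\<in>carrier G. \<forall>A\<in>sets \<mu>. emeasure \<mu> ((\<lambda>c. c #>\<^bsub>G\<^esub> g) ` A) = emeasure \<mu> A)"


section \<open>Smooth complex representations\<close>

text \<open>The representation space is the whole type \<open>'v\<close>, with scalar multiplication \<open>sc\<close>.\<close>

locale smooth_representation = vector_space sc
  for sc :: "complex \<Rightarrow> 'v::ab_group_add \<Rightarrow> 'v" +
  fixes G :: "'f::padic_field mat monoid" and \<rho> :: "'f mat \<Rightarrow> 'v \<Rightarrow> 'v"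
  assumes rep_linear: "g \<in> carrier G \<Longrightarrow> Vector_Spaces.linear sc sc (\<rho> g)"
    and rep_one: "\<rho> \<one>\<^bsub>G\<^esub> v = v"
    and rep_mult: "g \<in> carrier G \<Longrightarrow> h \<in> carrier G \<Longrightarrow> \<rho> (g \<otimes>\<^bsub>G\<^esub> h) v = \<rho> g (\<rho> h v)"
    and rep_smooth: "openin (group_topology G) {g \<in> carrier G. \<rho> g v = v}"

definition subrepresentation ::
    "(complex \<Rightarrow> 'v::ab_group_add \<Rightarrow> 'v) \<Rightarrow> 'f::padic_field mat monoid \<Rightarrow> ('f mat \<Rightarrow> 'v \<Rightarrow> 'v) \<Rightarrow>
     'v set \<Rightarrow> bool" where
  "subrepresentation sc G \<rho> W \<longleftrightarrow> module.subspace sc W \<and> (\<forall>g\<in>carrier G. \<rho> g ` W \<subseteq> W)"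

definition irreducible_rep ::
    "(complex \<Rightarrow> 'v::ab_group_add \<Rightarrow> 'v) \<Rightarrow> 'f::padic_field mat monoid \<Rightarrow> ('f mat \<Rightarrow> 'v \<Rightarrow> 'v) \<Rightarrow>
     bool" where
  "irreducible_rep sc G \<rho> \<longleftrightarrow> (UNIV :: 'v set) \<noteq> {0} \<and>
     (\<forall>W. subrepresentation sc G \<rho> W \<longrightarrow> W = {0} \<or> W = UNIV)"

text \<open>
  A composition series: the quotient \<open>W (Suc i) / W i\<close> is irreducible iff \<open>W i\<close> is properly
  contained in \<open>W (Suc i)\<close> with no subrepresentation strictly in between.
\<close>

definition finite_length_rep ::
    "(complex \<Rightarrow> 'v::ab_group_add \<Rightarrow> 'v) \<Rightarrow> 'f::padic_field mat monoid \<Rightarrow> ('f mat \<Rightarrow> 'v \<Rightarrow> 'v) \<Rightarrow>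
     bool" where
  "finite_length_rep sc G \<rho> \<longleftrightarrow> (\<exists>(W :: nat \<Rightarrow> 'v set) l.
     W 0 = {0} \<and> W l = UNIV \<and> (\<forall>i\<le>l. subrepresentation sc G \<rho> (W i)) \<and>
     (\<forall>i<l. W i \<subset> W (Suc i) \<and>
        (\<forall>U. subrepresentation sc G \<rho> U \<and> W i \<subseteq> U \<and> U \<subseteq> W (Suc i) \<longrightarrow> U = W i \<or> U = W (Suc i))))"

definition fixed_vectors :: "('f::padic_field mat \<Rightarrow> 'v \<Rightarrow> 'v) \<Rightarrow> 'f mat set \<Rightarrow> 'v set" where
  "fixed_vectors \<rho> K = {v. \<forall>k\<in>K. \<rho> k v = v}"

text \<open>$\mathrm{Hom}_U(\rho,\theta)$ for a character $\theta$ of a subgroup $U$.\<close>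

definition Hom_char ::
    "(complex \<Rightarrow> 'v::ab_group_add \<Rightarrow> 'v) \<Rightarrow> ('f::padic_field mat \<Rightarrow> 'v \<Rightarrow> 'v) \<Rightarrow> 'f mat set \<Rightarrow>
     ('f mat \<Rightarrow> complex) \<Rightarrow> ('v \<Rightarrow> complex) set" where
  "Hom_char sc \<rho> U \<theta> =
     {\<Lambda>. Vector_Spaces.linear sc (*) \<Lambda> \<and> (\<forall>u\<in>U. \<forall>v. \<Lambda> (\<rho> u v) = \<theta> u * \<Lambda> v)}"

definition functional_dim :: "('v \<Rightarrow> complex) set \<Rightarrow> nat" where
  "functional_dim = vector_space.dim (\<lambda>c \<Lambda> v. c * \<Lambda> v)"

definition unipotent_upper :: "'f::padic_field mat \<Rightarrow> bool" where
  "unipotent_upper A \<longleftrightarrow> upper_triangular A \<and> (\<forall>i<dim_row A. A $$ (i, i) = 1)"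


section \<open>General linear groups\<close>

definition GL :: "nat \<Rightarrow> 'f::padic_field mat monoid" where
  "GL d = mat_group d {a \<in> carrier_mat d d. det a \<noteq> 0}"

definition GL_int :: "nat \<Rightarrow> 'f::padic_field mat set" where
  "GL_int d = {a \<in> carrier_mat d d. elements_mat a \<subseteq> integers \<and> absF (det a) = 1}"

definition nu :: "'f::padic_field mat \<Rightarrow> real" where
  "nu a = absF (det a)"

definition Z_unip :: "nat \<Rightarrow> 'f::padic_field mat set" where
  "Z_unip r = {z \<in> carrier (GL r). unipotent_upper z}"

definition psi_bar_Z :: "('f::padic_field \<Rightarrow> complex) \<Rightarrow> nat \<Rightarrow> 'f mat \<Rightarrow> complex" where
  "psi_bar_Z \<psi> r z = cnj (\<psi> (\<Sum>i<r - 1. z $$ (i, Suc i)))"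

definition antidiag :: "nat \<Rightarrow> 'f::padic_field mat" where
  "antidiag d = mat d d (\<lambda>(i, j). if i + j + 1 = d then 1 else 0)"


section \<open>The odd special orthogonal group and its paramodular subgroups\<close>

definition S_form :: "nat \<Rightarrow> 'f::padic_field mat" where
  "S_form n = mat (2 * n + 1) (2 * n + 1)
     (\<lambda>(i, j). if i + j = 2 * n then (if i = n then 2 else 1) else 0)"

definition SO_odd :: "nat \<Rightarrow> 'f::padic_field mat monoid" where
  "SO_odd n = mat_group (2 * n + 1)
     {g \<in> carrier_mat (2 * n + 1) (2 * n + 1). det g = 1 \<and> transpose_mat g * S_form n * g = S_form n}"

definition U_unip :: "nat \<Rightarrow> 'f::padic_field mat set" where
  "U_unip n = {u \<in> carrier (SO_odd n). unipotent_upper u}"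

definition psi_U :: "('f::padic_field \<Rightarrow> complex) \<Rightarrow> nat \<Rightarrow> 'f mat \<Rightarrow> complex" where
  "psi_U \<psi> n u = \<psi> ((\<Sum>i<n - 1. u $$ (i, Suc i)) + inverse 2 * u $$ (n - 1, n))"

definition generic_rep ::
    "(complex \<Rightarrow> 'v::ab_group_add \<Rightarrow> 'v) \<Rightarrow> ('f::padic_field \<Rightarrow> complex) \<Rightarrow> nat \<Rightarrow>
     ('f mat \<Rightarrow> 'v \<Rightarrow> 'v) \<Rightarrow> bool" where
  "generic_rep sc \<psi> n \<pi> \<longleftrightarrow> (\<exists>\<Lambda>\<in>Hom_char sc \<pi> (U_unip n) (psi_U \<psi> n). \<Lambda> \<noteq> (\<lambda>_. 0))"

definition paramodular_lattice :: "'f::padic_field \<Rightarrow> nat \<Rightarrow> nat \<Rightarrow> 'f vec set" where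
  "paramodular_lattice w n m = {x \<in> carrier_vec (2 * n + 1).
     (\<forall>i<n. vec_index x i \<in> integers) \<and>
     (\<forall>i\<in>{n..2 * n}. vec_index x i \<in> (*) (w ^ m) ` integers)}"

definition J_paramodular :: "'f::padic_field \<Rightarrow> nat \<Rightarrow> nat \<Rightarrow> 'f mat set" where
  "J_paramodular w n m = {g \<in> carrier (SO_odd n).
     (\<lambda>x. g *\<^sub>v x) ` paramodular_lattice w n m = paramodular_lattice w n m}"

definition t_mat :: "'f::padic_field \<Rightarrow> nat \<Rightarrow> nat \<Rightarrow> 'f mat" where
  "t_mat w n m = mat_diag (2 * n + 1) (\<lambda>i. if i < n then w ^ m else 1)"

text \<open>
  Dickson's formula: for $A$ orthogonal over a field of characteristic 2, preserving the quadratic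
  form $\sum x_iy_i$ in the basis $e_1,\dots,e_n,f_n,\dots,f_1$, it gives 0 or 1 and is the
  homomorphism from the orthogonal group onto $\mathbb Z/2$ that replaces the determinant.
\<close>

definition dickson :: "nat \<Rightarrow> 'f::padic_field mat \<Rightarrow> 'f" where
  "dickson n A = (\<Sum>i<n. \<Sum>j<n. A $$ (j, 2 * n - 1 - i) * A $$ (2 * n - 1 - j, i))"

text \<open>
  \<open>det A - 1 \<in> max_ideal\<close> says that the reduction of \<open>A\<close> has determinant 1. In residue
  characteristic 2 this is no condition at all, since $-1 = 1$ in the residue field; there the
  nontrivial map onto $\{\pm1\}$, whose kernel has index 2, is given by the Dickson invariant. The
  group is then smaller than the literal kernel of the determinant of the reduction (which is all
  of $J_{n,m}$), so its fixed vectors include those of the latter.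
\<close>

definition K_paramodular :: "'f::padic_field \<Rightarrow> nat \<Rightarrow> nat \<Rightarrow> 'f mat set" where
  "K_paramodular w n m = (if m = 0 then J_paramodular w n 0 else
     {g \<in> J_paramodular w n m.
        let t = t_mat w n m; A = mat_delete (t * g * inv\<^bsub>GL (2 * n + 1)\<^esub> t) n n
        in det A - 1 \<in> max_ideal \<and> ((2 :: 'f) \<in> max_ideal \<longrightarrow> dickson n A \<in> max_ideal)})"


section \<open>The even special orthogonal group and induced representations\<close>

definition SO_even :: "nat \<Rightarrow> 'f::padic_field mat monoid" where
  "SO_even r = mat_group (2 * r)
     {h \<in> carrier_mat (2 * r) (2 * r).
        det h = 1 \<and> transpose_mat h * antidiag (2 * r) * h = antidiag (2 * r)}"

text \<open>The outer \<open>2 * r\<close> rows and columns carry \<open>h\<close>, the inner ones the identity.\<close>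

definition embed_SO :: "nat \<Rightarrow> nat \<Rightarrow> 'f::padic_field mat \<Rightarrow> 'f mat" where
  "embed_SO n r h = (let N = 2 * n + 1; d = N - 2 * r;
      outer = (\<lambda>i. i < r \<or> N - r \<le> i); idx = (\<lambda>i. if i < r then i else i - d)
    in mat N N (\<lambda>(i, j). if outer i \<and> outer j then h $$ (idx i, idx j)
                          else if i = j then 1 else 0))"

definition V_unip :: "nat \<Rightarrow> 'f::padic_field mat set" where
  "V_unip r = {h \<in> carrier (SO_even r). unipotent_upper h}"

definition m_Siegel :: "nat \<Rightarrow> 'f::padic_field mat \<Rightarrow> 'f mat" where
  "m_Siegel r a = four_block_mat a (0\<^sub>m r r) (0\<^sub>m r r)
     (antidiag r * transpose_mat (inv\<^bsub>GL r\<^esub> a) * antidiag r)"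

definition N_Siegel :: "nat \<Rightarrow> 'f::padic_field mat set" where
  "N_Siegel r = {four_block_mat (1\<^sub>m r) b (0\<^sub>m r r) (1\<^sub>m r) | b.
     b \<in> carrier_mat r r \<and> b = - (antidiag r * transpose_mat b * antidiag r)}"

text \<open>The modulus character of the Siegel parabolic at \<open>m_Siegel r a\<close>.\<close>

definition delta_Siegel :: "nat \<Rightarrow> 'f::padic_field mat \<Rightarrow> real" where
  "delta_Siegel r a = nu a ^ (r - 1)"

text \<open>
  $I_r(\tau,s)$. Smoothness is invariance under right translation by an open subgroup (it suffices
  that the set of elements acting trivially is open).
\<close>

definition induced_space ::
    "nat \<Rightarrow> (complex \<Rightarrow> 'w::ab_group_add \<Rightarrow> 'w) \<Rightarrow> ('f::padic_field mat \<Rightarrow> 'w \<Rightarrow> 'w) \<Rightarrow> complex \<Rightarrow>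
     ('f mat \<Rightarrow> 'w) set" where
  "induced_space r sc \<tau> s = {\<xi> \<in> extensional (carrier (SO_even r)).
     openin (group_topology (SO_even r))
       {k \<in> carrier (SO_even r). \<forall>h\<in>carrier (SO_even r). \<xi> (h * k) = \<xi> h} \<and>
     (\<forall>a\<in>carrier (GL r). \<forall>u\<in>N_Siegel r. \<forall>h\<in>carrier (SO_even r).
        \<xi> (m_Siegel r a * u * h) =
          sc (complex_of_real (sqrt (delta_Siegel r a)) * complex_of_real (nu a) powr (s - 1 / 2))
             (\<tau> a (\<xi> h)))}"

text \<open>
  The maximal compact subgroup $\mathrm{SO}_{2r}(\mathfrak o)$, for which the Iwasawa decomposition
  with respect to the Siegel parabolic holds.
\<close>

definition SO_even_int :: "nat \<Rightarrow> 'f::padic_field mat set" where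
  "SO_even_int r = {h \<in> carrier (SO_even r). elements_mat h \<subseteq> integers}"

text \<open>
  The value at \<open>s\<close> of the standard section that extends \<open>\<xi>\<close>; by the Iwasawa decomposition it is
  determined by its restriction to $\mathrm{SO}_{2r}(\mathfrak o)$.
\<close>

definition standard_section ::
    "nat \<Rightarrow> (complex \<Rightarrow> 'w::ab_group_add \<Rightarrow> 'w) \<Rightarrow> ('f::padic_field mat \<Rightarrow> 'w \<Rightarrow> 'w) \<Rightarrow>
     ('f mat \<Rightarrow> 'w) \<Rightarrow> complex \<Rightarrow> 'f mat \<Rightarrow> 'w" where
  "standard_section r sc \<tau> \<xi> s =
     (THE \<eta>. \<eta> \<in> induced_space r sc \<tau> s \<and> (\<forall>k\<in>SO_even_int r. \<eta> k = \<xi> k))"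


section \<open>The integrals\<close>

definition X_bar_mat :: "nat \<Rightarrow> nat \<Rightarrow> 'f::padic_field mat \<Rightarrow> 'f mat" where
  "X_bar_mat n r x = (let N = 2 * n + 1;
      x' = - (antidiag r * transpose_mat x * antidiag (n - r))
    in mat N N (\<lambda>(i, j).
         if r \<le> i \<and> i < n \<and> j < r then x $$ (i - r, j)
         else if N - r \<le> i \<and> n + 1 \<le> j \<and> j < N - r then x' $$ (i - (N - r), j - (n + 1))
         else if i = j then 1 else 0))"

definition X_bar :: "nat \<Rightarrow> nat \<Rightarrow> 'f::padic_field mat monoid" where
  "X_bar n r = mat_group (2 * n + 1) (X_bar_mat n r ` carrier_mat (n - r) r)"

definition Whittaker ::
    "('v \<Rightarrow> complex) \<Rightarrow> ('f::padic_field mat \<Rightarrow> 'v \<Rightarrow> 'v) \<Rightarrow> 'v \<Rightarrow> 'f mat \<Rightarrow> complex" where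
  "Whittaker \<Lambda> \<pi> v g = \<Lambda> (\<pi> g v)"

text \<open>
  The integral itself. As a function of \<open>h\<close> the inner integral is left invariant under
  \<open>V_unip r\<close>, so the choice of a representative \<open>h\<close> of the coset \<open>c\<close> does not matter.
\<close>

definition Psi_integral ::
    "nat \<Rightarrow> nat \<Rightarrow> 'f::padic_field mat measure \<Rightarrow> 'f mat set measure \<Rightarrow>
     ('v \<Rightarrow> complex) \<Rightarrow> ('f mat \<Rightarrow> 'v \<Rightarrow> 'v) \<Rightarrow> ('w \<Rightarrow> complex) \<Rightarrow> 'v \<Rightarrow> ('f mat \<Rightarrow> 'w) \<Rightarrow> complex" where
  "Psi_integral n r \<mu>\<^sub>X \<mu> \<Lambda>\<^sub>\<pi> \<pi> \<Lambda>\<^sub>\<tau> v \<xi> =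
     (LINT c|\<mu>. (let h = (SOME h. h \<in> c) in
        (LINT x|\<mu>\<^sub>X. Whittaker \<Lambda>\<^sub>\<pi> \<pi> v (x * embed_SO n r h) * \<Lambda>\<^sub>\<tau> (\<xi> h))))"

text \<open>
  $\Psi_{n,r}(v\otimes\xi)$ for $\xi\in I_r(\tau,s_0)$: the value at $s_0$ of the meromorphic
  continuation of the integral of the standard section through \<open>\<xi>\<close>.
  The requirement \<open>nicely_meromorphic_on\<close> makes the continuation unique as a function. It has the
  value 0 at a pole, but this cannot hide anything in a statement about all \<open>s\<^sub>0\<close> and \<open>\<xi>\<close>: near a
  pole it would be nonzero, and those values are values of \<open>Psi\<close> at the other members of the same
  standard section.
\<close>

definition Psi ::
    "nat \<Rightarrow> nat \<Rightarrow> 'f::padic_field mat measure \<Rightarrow> 'f mat set measure \<Rightarrow>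
     ('v \<Rightarrow> complex) \<Rightarrow> ('f mat \<Rightarrow> 'v \<Rightarrow> 'v) \<Rightarrow>
     (complex \<Rightarrow> 'w::ab_group_add \<Rightarrow> 'w) \<Rightarrow> ('w \<Rightarrow> complex) \<Rightarrow> ('f mat \<Rightarrow> 'w \<Rightarrow> 'w) \<Rightarrow>
     'v \<Rightarrow> complex \<Rightarrow> ('f mat \<Rightarrow> 'w) \<Rightarrow> complex" where
  "Psi n r \<mu>\<^sub>X \<mu> \<Lambda>\<^sub>\<pi> \<pi> sc \<Lambda>\<^sub>\<tau> \<tau> v s\<^sub>0 \<xi> =
     (THE f. f nicely_meromorphic_on UNIV \<and>
        (\<exists>\<sigma>. \<forall>s. Re s > \<sigma> \<longrightarrow>
           f s = Psi_integral n r \<mu>\<^sub>X \<mu> \<Lambda>\<^sub>\<pi> \<pi> \<Lambda>\<^sub>\<tau> v (standard_section r sc \<tau> \<xi> s))) s\<^sub>0"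

end

theory Submission
  imports Defs
begin

text \<open>
  Let $K\subset H_r(F)$ be a compact group that fixes $v$, contains $m_r(\mathrm{GL}_r(\mathfrak o))$
  and satisfies $H_r(F)=Q_r(F)K$. Since $W_v(\bar xhk)=W_v(\bar xh)$ for $k\in K$ and the measure on
  $V_r(F)\backslash H_r(F)$ is invariant, replacing $\xi_s$ by a right translate by an element of $K$
  does not change the integral. There are only finitely many translates, and their sum is
  $K$-invariant; its value at 1 is fixed by $\tau(\mathrm{GL}_r(\mathfrak o))$, hence 0, and then
  $H_r(F)=Q_r(F)K$ makes the sum vanish identically. So the integral is 0 for every $s$, and with it
  the meromorphic continuation.

  Such a $K$ exists inside a conjugate of $\mathrm{SO}_{2r}(\mathfrak o)$: every element of $H_r(F)$ is
  the product of an element of $Q_r(F)$, an integral unipotent element of the opposite parabolic,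
  and a permutation matrix that exchanges $e_i$ and $f_i$ for an even number of indices $i$.
\<close>


section \<open>The anti-transpose\<close>

text \<open>Ramification kills only vectors fixed by GL_r(o), so the group used for averaging must
  contain the image of GL_r(o) and still fix \<open>v\<close>. The vector is fixed by (a subgroup of
  index at most 2 of) the stabilizer of a lattice whose coordinates are scaled differently, and this
  stabilizer meets H_r(F) not in SO_2r(o) but in its conjugate by diag(w^m I_r, I_r). That matrix
  commutes with the Levi subgroup and normalizes N_r, so the conjugation changes nothing on the side
  of \<tau>. The subgroup of index 2 is why the Iwasawa decomposition is proved with explicit
  factors: membership can be checked for each of them separately.

  No convergence enters. A function that is not integrable has integral 0 by convention, and
  otherwise only translation invariance and finite additivity are used. The delicate point is that
  the inner integral must be a function on cosets of V_r: for this the Haar measure in the variable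
  x has to be preserved by x \<mapsto> x z for unipotent z, which is derived from the abstract Haar
  property.\<close>

definition atr :: "'a mat \<Rightarrow> 'a mat" where
  "atr A = mat (dim_col A) (dim_row A) (\<lambda>(i, j). A $$ (dim_row A - 1 - j, dim_col A - 1 - i))"

lemma atr_carrier [simp, intro]: "A \<in> carrier_mat p q \<Longrightarrow> atr A \<in> carrier_mat q p"
  by (simp add: atr_def)

lemma dim_atr [simp]: "dim_row (atr A) = dim_col A" "dim_col (atr A) = dim_row A"
  by (simp_all add: atr_def)

lemma index_atr:
  "A \<in> carrier_mat p q \<Longrightarrow> i < q \<Longrightarrow> j < p \<Longrightarrow> atr A $$ (i, j) = A $$ (p - 1 - j, q - 1 - i)"
  by (simp add: atr_def)

lemma atr_atr [simp]: "atr (atr A) = A"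
  by (rule eq_matI) (auto simp: atr_def)

lemma atr_one [simp]: "atr (1\<^sub>m n) = 1\<^sub>m n"
  by (rule eq_matI) (auto simp: atr_def)

lemma atr_zero [simp]: "atr (0\<^sub>m p q) = 0\<^sub>m q p"
  by (rule eq_matI) (auto simp: atr_def)

lemma atr_uminus: "atr (- A) = - atr (A :: 'a::group_add mat)"
  by (rule eq_matI) (auto simp: atr_def)

lemma index_mult_sum:
  "A \<in> carrier_mat p q \<Longrightarrow> B \<in> carrier_mat q r \<Longrightarrow> i < p \<Longrightarrow> j < r \<Longrightarrow>
    (A * B) $$ (i, j) = (\<Sum>k<q. A $$ (i, k) * B $$ (k, j))"
  by (simp add: scalar_prod_def atLeast0LessThan)

lemma atr_mult:
  fixes A B :: "'a::comm_semiring_0 mat"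
  assumes A: "A \<in> carrier_mat p q" and B: "B \<in> carrier_mat q r"
  shows "atr (A * B) = atr B * atr A"
proof (rule eq_matI)
  fix i j assume "i < dim_row (atr B * atr A)" "j < dim_col (atr B * atr A)"
  then have i: "i < r" and j: "j < p"
    using A B by auto
  have AB: "A * B \<in> carrier_mat p r"
    using A B by auto
  have "atr (A * B) $$ (i, j) = (\<Sum>k<q. A $$ (p - 1 - j, k) * B $$ (k, r - 1 - i))"
    using i j by (simp only: index_atr[OF AB i j], subst index_mult_sum[OF A B]) auto
  also have "\<dots> = (\<Sum>k<q. B $$ (q - 1 - k, r - 1 - i) * A $$ (p - 1 - j, q - 1 - k))"
    by (subst sum.nat_diff_reindex[symmetric]) (auto simp: mult.commute intro!: sum.cong)
  also have "\<dots> = (atr B * atr A) $$ (i, j)"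
    by (subst index_mult_sum[OF atr_carrier[OF B] atr_carrier[OF A] i j])
       (auto intro!: sum.cong simp: index_atr[OF A _ j] index_atr[OF B i])
  finally show "atr (A * B) $$ (i, j) = (atr B * atr A) $$ (i, j)" .
qed (use A B in auto)

lemma antidiag_carrier [simp]: "antidiag n \<in> carrier_mat n n"
  by (simp add: antidiag_def)

lemma dim_antidiag [simp]: "dim_row (antidiag n) = n" "dim_col (antidiag n) = n"
  by (simp_all add: antidiag_def)

text \<open>The definitions of \<open>m_Siegel\<close>, \<open>N_Siegel\<close> and
  \<open>X_bar_mat\<close> reflect blocks by a product with two antidiagonal matrices. The entrywise
  form \<open>atr\<close> replaces this product throughout, for rectangular blocks as well.\<close>

lemma antidiag_conj:
  fixes A :: "'f::padic_field mat"
  assumes A: "A \<in> carrier_mat p q"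
  shows "antidiag q * transpose_mat A * antidiag p = atr A"
proof (rule eq_matI)
  fix i j assume "i < dim_row (atr A)" "j < dim_col (atr A)"
  then have i: "i < q" and j: "j < p"
    using A by auto
  have t: "transpose_mat A \<in> carrier_mat q p"
    using A by simp
  have 1: "(antidiag q * transpose_mat A) $$ (i, k) = A $$ (k, q - 1 - i)" if k: "k < p" for k
  proof -
    have "(antidiag q * transpose_mat A) $$ (i, k) =
        (\<Sum>l<q. (if l = q - 1 - i then A $$ (k, l) else 0))"
      unfolding index_mult_sum[OF antidiag_carrier t i k]
      by (rule sum.cong) (use A i k in \<open>auto simp: antidiag_def\<close>)
    also have "\<dots> = A $$ (k, q - 1 - i)"
      using i by (subst sum.delta) auto
    finally show ?thesis .
  qed
  have "(antidiag q * transpose_mat A * antidiag p) $$ (i, j) =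
      (\<Sum>k<p. (if k = p - 1 - j then A $$ (k, q - 1 - i) else 0))"
    unfolding index_mult_sum[OF mult_carrier_mat[OF antidiag_carrier t] antidiag_carrier i j]
    by (rule sum.cong) (use j in \<open>auto simp: 1 antidiag_def[of p] simp del: index_mult_mat\<close>)
  also have "\<dots> = atr A $$ (i, j)"
    using j by (subst sum.delta) (auto simp: index_atr[OF A i j])
  finally show "(antidiag q * transpose_mat A * antidiag p) $$ (i, j) = atr A $$ (i, j)" .
qed (use A in auto)

lemma antidiag_sq: "antidiag n * antidiag n = (1\<^sub>m n :: 'f::padic_field mat)"
proof -
  have "antidiag n * transpose_mat (1\<^sub>m n) * antidiag n = (1\<^sub>m n :: 'f mat)"
    by (subst antidiag_conj[of _ n n]) auto
  then show ?thesis
    by (simp add: right_mult_one_mat[OF antidiag_carrier])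
qed

text \<open>The antidiagonal matrix squares to 1, so its determinant enters twice and cancels; its
  sign never has to be computed.\<close>

lemma det_atr:
  fixes A :: "'f::padic_field mat"
  assumes A: "A \<in> carrier_mat n n"
  shows "det (atr A) = det A"
proof -
  have "det (antidiag n :: 'f mat) * det (antidiag n :: 'f mat) = 1"
    by (subst det_mult[of _ n, symmetric]) (auto simp: antidiag_sq)
  then have "det (antidiag n * transpose_mat A * antidiag n :: 'f mat) = det A"
    using A
    by (simp add: det_mult[OF mult_carrier_mat[OF antidiag_carrier] antidiag_carrier]
      det_mult[OF antidiag_carrier] det_transpose)
  then show ?thesis
    by (simp add: antidiag_conj[OF A])
qed

text \<open>Multiplication by the antidiagonal matrix, which is its own inverse, turns invariance of
  the form into the statement that \<open>atr h\<close> is the inverse of \<open>h\<close>. From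
  here on inverses in the orthogonal group are written as \<open>atr\<close>.\<close>

lemma orthogonal_iff:
  fixes h :: "'f::padic_field mat"
  assumes h: "h \<in> carrier_mat n n"
  shows "transpose_mat h * antidiag n * h = antidiag n \<longleftrightarrow> atr h * h = 1\<^sub>m n"
proof -
  let ?J = "antidiag n :: 'f mat"
  have eq: "atr h * h = ?J * (transpose_mat h * ?J * h)"
    using h by (simp add: antidiag_conj[OF h, symmetric] assoc_mult_mat[of _ n n _ n _ n])
  show ?thesis
  proof
    assume "transpose_mat h * ?J * h = ?J"
    then show "atr h * h = 1\<^sub>m n"
      unfolding eq by (simp only: antidiag_sq)
  next
    assume 1: "atr h * h = 1\<^sub>m n"
    have c: "transpose_mat h * ?J * h \<in> carrier_mat n n"
      using h by auto
    have "transpose_mat h * ?J * h = (?J * ?J) * (transpose_mat h * ?J * h)"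
      using left_mult_one_mat[OF c] by (simp only: antidiag_sq)
    also have "\<dots> = ?J * (atr h * h)"
      unfolding eq by (rule assoc_mult_mat[OF antidiag_carrier antidiag_carrier c])
    also have "\<dots> = ?J"
      unfolding 1 by (rule right_mult_one_mat[OF antidiag_carrier])
    finally show "transpose_mat h * ?J * h = ?J" .
  qed
qed

section \<open>Inverses of matrices and general linear groups\<close>

lemma det_nonzero_inverse:
  fixes A :: "'a::field mat"
  assumes A: "A \<in> carrier_mat n n" and "det A \<noteq> 0"
  obtains B where "B \<in> carrier_mat n n" "A * B = 1\<^sub>m n" "B * A = 1\<^sub>m n"
  using det_non_zero_imp_unit[OF A assms(2), of undefined]
  by (auto simp: Units_def ring_mat_def)

lemma mult_one_imp_det_nonzero:
  fixes A B :: "'a::field mat"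
  assumes "A \<in> carrier_mat n n" "B \<in> carrier_mat n n" "A * B = 1\<^sub>m n"
  shows "det A \<noteq> 0" "det B \<noteq> 0"
  using assms by (metis det_mult det_one mult_eq_0_iff one_neq_zero)+

lemma mat_group_simps [simp]:
  "carrier (mat_group d X) = X" "mult (mat_group d X) = (*)" "\<one>\<^bsub>mat_group d X\<^esub> = 1\<^sub>m d"
  by (simp_all add: mat_group_def)

lemma carrier_GL: "a \<in> carrier (GL d) \<longleftrightarrow> a \<in> carrier_mat d d \<and> det a \<noteq> 0"
  by (auto simp: GL_def)

lemma mult_GL [simp]: "mult (GL d) = (*)" and one_GL [simp]: "\<one>\<^bsub>GL d\<^esub> = 1\<^sub>m d"
  by (simp_all add: GL_def)

lemma group_GL: "group (GL d :: 'f::padic_field mat monoid)"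
proof (rule groupI)
  fix x :: "'f mat" assume x: "x \<in> carrier (GL d)"
  then show "\<exists>y\<in>carrier (GL d). y \<otimes>\<^bsub>GL d\<^esub> x = \<one>\<^bsub>GL d\<^esub>"
    by (metis carrier_GL det_nonzero_inverse mult_GL mult_one_imp_det_nonzero(2) one_GL)
qed (auto simp: carrier_GL det_mult assoc_mult_mat[of _ d d _ d _ d])

lemma inv_GL:
  assumes "a \<in> carrier (GL d)"
  shows "inv\<^bsub>GL d\<^esub> a \<in> carrier (GL d)" "inv\<^bsub>GL d\<^esub> a * a = 1\<^sub>m d" "a * inv\<^bsub>GL d\<^esub> a = 1\<^sub>m d"
  using assms group.inv_closed[OF group_GL] group.l_inv[OF group_GL] group.r_inv[OF group_GL]
  by auto

lemma inv_GL_eqI: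
  fixes a b :: "'f::padic_field mat"
  assumes a: "a \<in> carrier_mat d d" and b: "b \<in> carrier_mat d d" and ab: "a * b = 1\<^sub>m d"
  shows "inv\<^bsub>GL d\<^esub> a = b"
proof -
  interpret group "GL d :: 'f mat monoid"
    by (rule group_GL)
  have "b * a = 1\<^sub>m d"
    using mat_mult_left_right_inverse[OF a b ab] .
  then show ?thesis
    using mult_one_imp_det_nonzero[OF a b ab] a b inv_equality[of b a] by (auto simp: carrier_GL)
qed


section \<open>The groups of even orthogonal type\<close>

lemma carrier_SO_even:
  fixes h :: "'f::padic_field mat"
  shows "h \<in> carrier (SO_even r) \<longleftrightarrow>
    h \<in> carrier_mat (2 * r) (2 * r) \<and> det h = 1 \<and> atr h * h = 1\<^sub>m (2 * r)"
  by (auto simp: SO_even_def orthogonal_iff)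

lemma mult_SO_even [simp]: "mult (SO_even d) = (*)"
  and one_SO_even [simp]: "\<one>\<^bsub>SO_even r\<^esub> = 1\<^sub>m (2 * r)"
  by (simp_all add: SO_even_def)

lemma atr_mult_orthogonal:
  fixes g h :: "'a::comm_ring_1 mat"
  assumes g: "g \<in> carrier_mat n n" and h: "h \<in> carrier_mat n n"
    and "atr g * g = 1\<^sub>m n" "atr h * h = 1\<^sub>m n"
  shows "atr (g * h) * (g * h) = 1\<^sub>m n"
proof -
  have "atr (g * h) * (g * h) = atr h * ((atr g * g) * h)"
    using g h by (simp add: atr_mult[OF g h] assoc_mult_mat[of _ n n _ n _ n])
  then show ?thesis
    using assms by simp
qed

lemma SO_even_mult_closed:
  "g \<in> carrier (SO_even r) \<Longrightarrow> h \<in> carrier (SO_even r) \<Longrightarrow> g * h \<in> carrier (SO_even r)"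
  by (auto simp: carrier_SO_even det_mult atr_mult_orthogonal)

lemma SO_even_atr:
  assumes "h \<in> carrier (SO_even r)"
  shows "h * atr h = 1\<^sub>m (2 * r)" "atr h * h = 1\<^sub>m (2 * r)" "atr h \<in> carrier (SO_even r)"
proof -
  show "h * atr h = 1\<^sub>m (2 * r)"
    using assms mat_mult_left_right_inverse[of "atr h" "2 * r" h] by (auto simp: carrier_SO_even)
  then show "atr h * h = 1\<^sub>m (2 * r)" "atr h \<in> carrier (SO_even r)"
    using assms by (auto simp: carrier_SO_even det_atr)
qed

lemma one_in_SO_even [simp]: "1\<^sub>m (2 * r) \<in> carrier (SO_even r)"
  by (auto simp: carrier_SO_even)

lemma SO_even_carrier_mat: "h \<in> carrier (SO_even r) \<Longrightarrow> h \<in> carrier_mat (2 * r) (2 * r)"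
  by (simp add: carrier_SO_even)

lemma group_SO_even: "group (SO_even r :: 'f::padic_field mat monoid)"
proof (rule groupI)
  fix x :: "'f mat" assume x: "x \<in> carrier (SO_even r)"
  then show "\<exists>y\<in>carrier (SO_even r). y \<otimes>\<^bsub>SO_even r\<^esub> x = \<one>\<^bsub>SO_even r\<^esub>"
    using SO_even_atr[OF x] by auto
qed (auto simp: SO_even_mult_closed, auto simp: carrier_SO_even assoc_mult_mat[of _ "2 * r" "2 * r" _ "2 * r" _ "2 * r"])

section \<open>Block matrices and the orthogonality relations between their quadrants\<close>

lemma atr_four_block:
  assumes "a \<in> carrier_mat p p'" "b \<in> carrier_mat p q'" "c \<in> carrier_mat q p'" "d \<in> carrier_mat q q'"
  shows "atr (four_block_mat a b c d) = four_block_mat (atr d) (atr b) (atr c) (atr a)"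
proof (rule eq_matI)
  fix i j
  assume "i < dim_row (four_block_mat (atr d) (atr b) (atr c) (atr a))"
    and "j < dim_col (four_block_mat (atr d) (atr b) (atr c) (atr a))"
  then have ij: "i < p' + q'" "j < p + q"
    using assms by auto
  have "p' + q' - 1 - i < p' \<longleftrightarrow> \<not> i < q'" "p + q - 1 - j < p \<longleftrightarrow> \<not> j < q"
    using ij by auto
  moreover have "i < q' \<Longrightarrow> p' + q' - 1 - i - p' = q' - 1 - i" "j < q \<Longrightarrow> p + q - 1 - j - p = q - 1 - j"
    "\<not> i < q' \<Longrightarrow> p' + q' - 1 - i = p' - 1 - (i - q')" "\<not> j < q \<Longrightarrow> p + q - 1 - j = p - 1 - (j - q)"
    using ij by auto
  ultimately show "atr (four_block_mat a b c d) $$ (i, j) =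
      four_block_mat (atr d) (atr b) (atr c) (atr a) $$ (i, j)"
    using assms ij by (subst index_atr[of _ "p + q" "p' + q'"])
      (auto simp: index_atr[OF assms(1)] index_atr[OF assms(2)] index_atr[OF assms(3)] index_atr[OF assms(4)])
qed (use assms in auto)

definition ul :: "nat \<Rightarrow> 'a mat \<Rightarrow> 'a mat" where "ul r h = mat r r (\<lambda>(i, j). h $$ (i, j))"
definition ur :: "nat \<Rightarrow> 'a mat \<Rightarrow> 'a mat" where "ur r h = mat r r (\<lambda>(i, j). h $$ (i, j + r))"
definition ll :: "nat \<Rightarrow> 'a mat \<Rightarrow> 'a mat" where "ll r h = mat r r (\<lambda>(i, j). h $$ (i + r, j))"
definition lr :: "nat \<Rightarrow> 'a mat \<Rightarrow> 'a mat" where "lr r h = mat r r (\<lambda>(i, j). h $$ (i + r, j + r))"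

lemma quadrant_carrier [simp, intro]:
  "ul r h \<in> carrier_mat r r" "ur r h \<in> carrier_mat r r"
  "ll r h \<in> carrier_mat r r" "lr r h \<in> carrier_mat r r"
  by (simp_all add: ul_def ur_def ll_def lr_def)

lemma quadrants_eq:
  "h \<in> carrier_mat (2 * r) (2 * r) \<Longrightarrow> four_block_mat (ul r h) (ur r h) (ll r h) (lr r h) = h"
  by (rule eq_matI) (auto simp: ul_def ur_def ll_def lr_def)

lemma quadrant_four_block:
  assumes "a \<in> carrier_mat r r" "b \<in> carrier_mat r r" "c \<in> carrier_mat r r" "d \<in> carrier_mat r r"
  shows "ul r (four_block_mat a b c d) = a" "ur r (four_block_mat a b c d) = b"
    "ll r (four_block_mat a b c d) = c" "lr r (four_block_mat a b c d) = d"
  using assms by (auto simp: ul_def ur_def ll_def lr_def intro!: eq_matI)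

lemma four_block_eq_iff:
  assumes "a \<in> carrier_mat r r" "b \<in> carrier_mat r r" "c \<in> carrier_mat r r" "d \<in> carrier_mat r r"
    and "a' \<in> carrier_mat r r" "b' \<in> carrier_mat r r" "c' \<in> carrier_mat r r" "d' \<in> carrier_mat r r"
  shows "four_block_mat a b c d = four_block_mat a' b' c' d' \<longleftrightarrow> a = a' \<and> b = b' \<and> c = c' \<and> d = d'"
  using quadrant_four_block[OF assms(1-4)] quadrant_four_block[OF assms(5-8)] by metis

lemma four_block_mult:
  assumes "a \<in> carrier_mat r r" "b \<in> carrier_mat r r" "c \<in> carrier_mat r r" "d \<in> carrier_mat r r"
    and "a' \<in> carrier_mat r r" "b' \<in> carrier_mat r r" "c' \<in> carrier_mat r r" "d' \<in> carrier_mat r r"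
  shows "four_block_mat a b c d * four_block_mat a' b' c' d' =
    four_block_mat (a * a' + b * c') (a * b' + b * d') (c * a' + d * c') (c * b' + d * d')"
  using assms by (rule mult_four_block_mat)

lemma four_block_one: "four_block_mat (1\<^sub>m r) (0\<^sub>m r r) (0\<^sub>m r r) (1\<^sub>m r) = 1\<^sub>m (2 * r)"
  by (simp add: mult_2)

lemma four_block_carrier:
  "a \<in> carrier_mat r r \<Longrightarrow> d \<in> carrier_mat r r \<Longrightarrow> four_block_mat a b c d \<in> carrier_mat (2 * r) (2 * r)"
  by (auto simp: mult_2)

lemma orthogonal_blocks_iff:
  fixes a b c d :: "'a::comm_ring_1 mat"
  assumes "a \<in> carrier_mat r r" "b \<in> carrier_mat r r" "c \<in> carrier_mat r r" "d \<in> carrier_mat r r"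
  shows "atr (four_block_mat a b c d) * four_block_mat a b c d = 1\<^sub>m (2 * r) \<longleftrightarrow>
    atr d * a + atr b * c = 1\<^sub>m r \<and> atr d * b + atr b * d = 0\<^sub>m r r \<and>
    atr c * a + atr a * c = 0\<^sub>m r r \<and> atr c * b + atr a * d = 1\<^sub>m r"
  using assms unfolding atr_four_block[OF assms] four_block_one[symmetric]
    four_block_mult[OF atr_carrier[OF assms(4)] atr_carrier[OF assms(2)] atr_carrier[OF assms(3)]
      atr_carrier[OF assms(1)] assms]
  by (subst four_block_eq_iff) (auto intro!: add_carrier_mat mult_carrier_mat[of _ r r])

section \<open>The Siegel parabolic subgroup\<close>

lemma m_Siegel_eq:
  assumes "a \<in> carrier (GL r)"
  shows "m_Siegel r a = four_block_mat a (0\<^sub>m r r) (0\<^sub>m r r) (atr (inv\<^bsub>GL r\<^esub> a))"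
  using antidiag_conj[of "inv\<^bsub>GL r\<^esub> a" r r] inv_GL[OF assms]
  by (simp add: m_Siegel_def carrier_GL)

lemma N_Siegel_iff:
  fixes u :: "'f::padic_field mat"
  shows "u \<in> N_Siegel r \<longleftrightarrow>
    (\<exists>b\<in>carrier_mat r r. u = four_block_mat (1\<^sub>m r) b (0\<^sub>m r r) (1\<^sub>m r) \<and> b = - atr b)"
  unfolding N_Siegel_def using antidiag_conj[of _ r r, where 'f = 'f] by auto

lemma eq_uminus_iff_mat:
  fixes x y :: "'a::ab_group_add mat"
  assumes "x \<in> carrier_mat p q" "y \<in> carrier_mat p q"
  shows "x = - y \<longleftrightarrow> x + y = 0\<^sub>m p q"
  using assms by (auto simp: mat_eq_iff add_eq_0_iff2)

lemma det_lower_zero: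
  fixes a b d :: "'a::idom mat"
  assumes "a \<in> carrier_mat r r" "b \<in> carrier_mat r r" "d \<in> carrier_mat r r"
  shows "det (four_block_mat a b (0\<^sub>m r r) d) = det a * det d"
  by (rule det_four_block_mat_lower_left_zero[OF assms(1,2) refl assms(3)])

lemma det_upper_zero:
  fixes a c d :: "'a::idom mat"
  assumes "a \<in> carrier_mat r r" "c \<in> carrier_mat r r" "d \<in> carrier_mat r r"
  shows "det (four_block_mat a (0\<^sub>m r r) c d) = det a * det d"
  by (rule det_four_block_mat_upper_right_zero[OF assms(1) refl assms(2,3)])

lemma m_Siegel_in_SO_even:
  fixes a :: "'f::padic_field mat"
  assumes "a \<in> carrier (GL r)"
  shows "m_Siegel r a \<in> carrier (SO_even r)"
proof -
  let ?b = "inv\<^bsub>GL r\<^esub> a"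
  have a: "a \<in> carrier_mat r r" and b: "?b \<in> carrier_mat r r" and ab: "a * ?b = 1\<^sub>m r" "?b * a = 1\<^sub>m r"
    using assms inv_GL[OF assms] by (auto simp: carrier_GL)
  have "det a * det ?b = 1"
    using det_mult[OF a b] ab by simp
  moreover have "atr a * atr ?b = 1\<^sub>m r"
    using atr_mult[OF b a] ab by simp
  ultimately show ?thesis
    unfolding carrier_SO_even m_Siegel_eq[OF assms]
    using a b ab by (subst orthogonal_blocks_iff)
      (auto simp: det_lower_zero det_atr four_block_carrier)
qed

lemma N_Siegel_in_SO_even:
  fixes u :: "'f::padic_field mat"
  assumes "u \<in> N_Siegel r"
  shows "u \<in> carrier (SO_even r)"
proof -
  obtain b where b: "b \<in> carrier_mat r r" "u = four_block_mat (1\<^sub>m r) b (0\<^sub>m r r) (1\<^sub>m r)" "b = - atr b"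
    using assms by (auto simp: N_Siegel_iff)
  have "b + atr b = 0\<^sub>m r r"
    using b eq_uminus_iff_mat[of b r r "atr b"] by auto
  then show ?thesis
    unfolding carrier_SO_even b(2) using b(1)
    by (subst orthogonal_blocks_iff) (auto simp: det_lower_zero four_block_carrier)
qed

lemma GL_mult_closed: "a \<in> carrier (GL r) \<Longrightarrow> b \<in> carrier (GL r) \<Longrightarrow> a * b \<in> carrier (GL r)"
  by (auto simp: carrier_GL det_mult)

lemma inv_GL_mult:
  assumes "a \<in> carrier (GL r)" "b \<in> carrier (GL r)"
  shows "inv\<^bsub>GL r\<^esub> (a * b) = inv\<^bsub>GL r\<^esub> b * inv\<^bsub>GL r\<^esub> a"
  using group.inv_mult_group[OF group_GL assms] by simp

lemma m_Siegel_mult: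
  assumes a: "a \<in> carrier (GL r)" and b: "b \<in> carrier (GL r)"
  shows "m_Siegel r a * m_Siegel r b = m_Siegel r (a * b)"
proof -
  have car: "a \<in> carrier_mat r r" "b \<in> carrier_mat r r"
    "inv\<^bsub>GL r\<^esub> a \<in> carrier_mat r r" "inv\<^bsub>GL r\<^esub> b \<in> carrier_mat r r"
    using a b inv_GL(1)[OF a] inv_GL(1)[OF b] by (auto simp: carrier_GL)
  show ?thesis
    unfolding m_Siegel_eq[OF a] m_Siegel_eq[OF b] m_Siegel_eq[OF GL_mult_closed[OF a b]]
      inv_GL_mult[OF a b] atr_mult[OF car(4,3)]
    by (subst four_block_mult) (use car mult_carrier_mat[OF car(1,2)] in auto)
qed

lemma m_Siegel_one: "m_Siegel r (1\<^sub>m r) = (1\<^sub>m (2 * r) :: 'f::padic_field mat)"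
proof -
  have "inv\<^bsub>GL r\<^esub> (1\<^sub>m r) = (1\<^sub>m r :: 'f mat)"
    by (rule inv_GL_eqI) auto
  then show ?thesis
    by (subst m_Siegel_eq) (auto simp: carrier_GL four_block_one)
qed

text \<open>With a vanishing lower left quadrant, orthogonality makes \<open>atr d\<close> the
  inverse of \<open>a\<close>, so the diagonal blocks are those of the Levi element of
  \<open>a\<close>. The block \<open>x\<close> is then the inverse of \<open>a\<close> times
  \<open>b\<close>, and the remaining relation is its skewness.\<close>

lemma parabolic_decomposition:
  fixes h :: "'f::padic_field mat"
  assumes h: "h \<in> carrier_mat (2 * r) (2 * r)" "atr h * h = 1\<^sub>m (2 * r)" and c: "ll r h = 0\<^sub>m r r"
  shows "ul r h \<in> carrier (GL r)"
    and "\<exists>u\<in>N_Siegel r. h = m_Siegel r (ul r h) * u"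
proof -
  define a b d where "a = ul r h" and "b = ur r h" and "d = lr r h"
  have car: "a \<in> carrier_mat r r" "b \<in> carrier_mat r r" "d \<in> carrier_mat r r"
    by (auto simp: a_def b_def d_def)
  have heq: "h = four_block_mat a b (0\<^sub>m r r) d"
    using quadrants_eq[OF h(1)] c by (simp add: a_def b_def d_def)
  have rel: "atr d * a = 1\<^sub>m r" "atr d * b + atr b * d = 0\<^sub>m r r"
    using h(2) car orthogonal_blocks_iff[OF car(1,2) zero_carrier_mat car(3)]
      right_add_zero_mat[OF mult_carrier_mat[OF atr_carrier[OF car(3)] car(1)]]
    unfolding heq by simp_all
  have ad: "a * atr d = 1\<^sub>m r"
    using mat_mult_left_right_inverse[OF _ car(1) rel(1)] car by auto
  show a: "ul r h \<in> carrier (GL r)"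
    unfolding a_def[symmetric] using mult_one_imp_det_nonzero[OF car(1) _ ad] car
    by (auto simp: carrier_GL)
  have inv: "inv\<^bsub>GL r\<^esub> a = atr d"
    using car ad by (intro inv_GL_eqI) auto
  define x where "x = atr d * b"
  have x: "x \<in> carrier_mat r r"
    using car by (auto simp: x_def)
  have "atr x = atr b * d"
    by (simp add: x_def atr_mult[OF atr_carrier[OF car(3)] car(2)])
  then have "x = - atr x"
    using rel(2) eq_uminus_iff_mat[OF x atr_carrier[OF x]] by (simp only: x_def)
  then have u: "four_block_mat (1\<^sub>m r) x (0\<^sub>m r r) (1\<^sub>m r) \<in> N_Siegel r"
    using x by (auto simp: N_Siegel_iff)
  have "a * x = (a * atr d) * b"
    unfolding x_def by (rule assoc_mult_mat[symmetric, OF car(1) atr_carrier[OF car(3)] car(2)])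
  then have ax: "a * x = b"
    using ad car by simp
  have "h = m_Siegel r a * four_block_mat (1\<^sub>m r) x (0\<^sub>m r r) (1\<^sub>m r)"
    unfolding heq m_Siegel_eq[OF a[folded a_def]] inv
    by (subst four_block_mult) (use car x ax in auto)
  with u show "\<exists>u\<in>N_Siegel r. h = m_Siegel r (ul r h) * u"
    unfolding a_def by blast
qed


section \<open>The absolute value\<close>

lemma absF_0 [simp]: "absF 0 = 0"
  and absF_nonneg [simp]: "0 \<le> absF x"
  and absF_eq_0_iff [simp]: "absF x = 0 \<longleftrightarrow> x = 0"
  by (auto simp: absF_def)

lemma absF_mult: "absF (x * y) = absF x * absF y"
  by (simp add: absF_def dist_mult_0)

lemma absF_1 [simp]: "absF 1 = 1"
  using absF_mult[of 1 1] by (metis absF_eq_0_iff mult_cancel_left1 one_neq_zero)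

lemma absF_uminus [simp]: "absF (- x) = absF x"
proof -
  have "absF (- 1 :: 'a) ^ 2 = 1"
    using absF_mult[of "- 1 :: 'a" "- 1"] by (simp add: power2_eq_square)
  then have "absF (- 1 :: 'a) = 1"
    by (simp add: power2_eq_1_iff) (metis absF_nonneg neg_0_le_iff_le not_one_le_zero)
  then show ?thesis
    using absF_mult[of "- 1" x] by simp
qed

lemma absF_add: "absF (x + y) \<le> max (absF x) (absF y)"
  by (simp add: absF_def dist_ultrametric)

lemma absF_diff: "absF (x - y) \<le> max (absF x) (absF y)"
  using absF_add[of x "- y"] by simp

lemma dist_absF: "dist x y = absF (x - y)"
  using dist_translate[of "x - y" y 0] by (simp add: absF_def)

lemma absF_power: "absF (x ^ k) = absF x ^ k"
  by (induction k) (auto simp: absF_mult)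

lemma absF_inverse: "absF (inverse x) = inverse (absF x)"
proof (cases "x = 0")
  case False
  then have "absF x * absF (inverse x) = 1"
    by (simp flip: absF_mult)
  then show ?thesis
    by (simp add: inverse_unique)
qed simp

lemma absF_sum_le:
  assumes "\<And>i. i \<in> A \<Longrightarrow> absF (f i) \<le> e" "0 \<le> e"
  shows "absF (\<Sum>i\<in>A. f i) \<le> e"
  using assms
proof (induction A rule: infinite_finite_induct)
  case (insert x F)
  have "absF (f x + sum f F) \<le> max (absF (f x)) (absF (sum f F))"
    by (rule absF_add)
  also have "\<dots> \<le> e"
    using insert by auto
  finally show ?case
    using insert by simp
qed auto


section \<open>The Iwasawa decomposition\<close>

text \<open>
  \<open>Q\<close> is a set of column indices of the lower right quadrant; each \<open>q \<in> Q\<close> exchanges the index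
  \<open>q + r\<close> with the opposite one, \<open>r - 1 - q\<close>.
\<close>

definition pair_swap :: "nat \<Rightarrow> nat set \<Rightarrow> nat \<Rightarrow> nat" where
  "pair_swap r Q j = (if (r \<le> j \<and> j - r \<in> Q) \<or> (j < r \<and> r - 1 - j \<in> Q) then 2 * r - 1 - j else j)"

definition swap_mat :: "nat \<Rightarrow> nat set \<Rightarrow> 'a::zero_neq_one mat" where
  "swap_mat r Q = mat (2 * r) (2 * r) (\<lambda>(i, j). if i = pair_swap r Q j then 1 else 0)"

lemma pair_swap_less: "Q \<subseteq> {..<r} \<Longrightarrow> j < 2 * r \<Longrightarrow> pair_swap r Q j < 2 * r"
  by (auto simp: pair_swap_def)

text \<open>Different pairs of opposite indices are disjoint, and exchanging one pair twice does
  nothing. So the exchanges form an elementary abelian 2-group in which sets add by symmetric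
  difference.\<close>

lemma pair_swap_diff:
  assumes "Q \<subseteq> {..<r}" "R \<subseteq> {..<r}" "j < 2 * r"
  shows "pair_swap r Q (pair_swap r R j) = pair_swap r (sym_diff Q R) j"
proof (cases "j < r")
  case True
  then have "\<not> 2 * r - 1 - j < r" "2 * r - 1 - j - r = r - 1 - j" "2 * r - 1 - (2 * r - 1 - j) = j"
    by auto
  with True show ?thesis
    by (auto simp: pair_swap_def)
next
  case False
  then have "2 * r - 1 - j < r" "r - 1 - (2 * r - 1 - j) = j - r" "2 * r - 1 - (2 * r - 1 - j) = j"
    using assms by auto
  with False show ?thesis
    by (auto simp: pair_swap_def)
qed

lemma pair_swap_empty [simp]: "pair_swap r {} j = j"
  by (simp add: pair_swap_def)

lemma pair_swap_involution:
  "Q \<subseteq> {..<r} \<Longrightarrow> j < 2 * r \<Longrightarrow> pair_swap r Q (pair_swap r Q j) = j"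
  by (simp add: pair_swap_diff)

lemma pair_swap_opposite:
  assumes "j < 2 * r"
  shows "pair_swap r Q (2 * r - 1 - j) = 2 * r - 1 - pair_swap r Q j"
proof (cases "j < r")
  case True
  then have "\<not> 2 * r - 1 - j < r" "2 * r - 1 - j - r = r - 1 - j" "2 * r - 1 - (2 * r - 1 - j) = j"
    by auto
  with True show ?thesis
    by (auto simp: pair_swap_def)
next
  case False
  then have "2 * r - 1 - j < r" "r - 1 - (2 * r - 1 - j) = j - r" "2 * r - 1 - (2 * r - 1 - j) = j"
    using assms by auto
  with False show ?thesis
    by (auto simp: pair_swap_def)
qed

lemma swap_mat_carrier [simp, intro]: "swap_mat r Q \<in> carrier_mat (2 * r) (2 * r)"
  by (simp add: swap_mat_def)

lemma dim_swap_mat [simp]: "dim_row (swap_mat r Q) = 2 * r" "dim_col (swap_mat r Q) = 2 * r"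
  by (simp_all add: swap_mat_def)

lemma index_mult_swap_mat:
  fixes h :: "'a::semiring_1 mat"
  assumes h: "h \<in> carrier_mat (2 * r) (2 * r)" and Q: "Q \<subseteq> {..<r}" and ij: "i < 2 * r" "j < 2 * r"
  shows "(h * swap_mat r Q) $$ (i, j) = h $$ (i, pair_swap r Q j)"
proof -
  have "(h * swap_mat r Q) $$ (i, j) = (\<Sum>k<2 * r. if k = pair_swap r Q j then h $$ (i, k) else 0)"
    unfolding index_mult_sum[OF h swap_mat_carrier ij]
    by (rule sum.cong) (use ij in \<open>auto simp: swap_mat_def\<close>)
  also have "\<dots> = h $$ (i, pair_swap r Q j)"
    using pair_swap_less[OF Q ij(2)] by (subst sum.delta) auto
  finally show ?thesis .
qed

lemma swap_mat_mult:
  assumes "Q \<subseteq> {..<r}" "R \<subseteq> {..<r}"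
  shows "swap_mat r Q * swap_mat r R = (swap_mat r (sym_diff Q R) :: 'a::semiring_1 mat)"
proof (rule eq_matI)
  fix i j assume "i < dim_row (swap_mat r (sym_diff Q R) :: 'a mat)"
    "j < dim_col (swap_mat r (sym_diff Q R) :: 'a mat)"
  then have "i < 2 * r" "j < 2 * r"
    by auto
  then show "(swap_mat r Q * swap_mat r R) $$ (i, j) = (swap_mat r (sym_diff Q R) :: 'a mat) $$ (i, j)"
    using pair_swap_less[OF assms(2), of j] assms
    by (subst index_mult_swap_mat) (auto simp: swap_mat_def pair_swap_diff simp del: index_mult_mat)
qed auto

lemma swap_mat_empty [simp]: "swap_mat r {} = (1\<^sub>m (2 * r) :: 'a::semiring_1 mat)"
  by (rule eq_matI) (auto simp: swap_mat_def)

text \<open>The permutation is an involution and commutes with the reflection of the indices, so the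
  matrix is symmetric and also unchanged when the order of rows and columns is reversed.\<close>

lemma atr_swap_mat: "Q \<subseteq> {..<r} \<Longrightarrow> atr (swap_mat r Q) = (swap_mat r Q :: 'a::semiring_1 mat)"
proof (rule eq_matI)
  fix i j assume Q: "Q \<subseteq> {..<r}" and "i < dim_row (swap_mat r Q :: 'a mat)" "j < dim_col (swap_mat r Q :: 'a mat)"
  then have ij: "i < 2 * r" "j < 2 * r"
    by auto
  have "2 * r - 1 - j = 2 * r - 1 - pair_swap r Q i \<longleftrightarrow> j = pair_swap r Q i"
    using ij pair_swap_less[OF Q ij(1)] by linarith
  also have "\<dots> \<longleftrightarrow> i = pair_swap r Q j"
    using pair_swap_involution[OF Q] ij by metis
  finally have *: "2 * r - 1 - j = 2 * r - 1 - pair_swap r Q i \<longleftrightarrow> i = pair_swap r Q j" .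
  then show "atr (swap_mat r Q) $$ (i, j) = (swap_mat r Q :: 'a mat) $$ (i, j)"
    unfolding index_atr[OF swap_mat_carrier ij] using ij *
    by (simp add: swap_mat_def pair_swap_opposite[OF ij(1)] del: One_nat_def diff_diff_left)
qed auto

lemma swap_mat_orthogonal:
  "Q \<subseteq> {..<r} \<Longrightarrow> atr (swap_mat r Q) * swap_mat r Q = (1\<^sub>m (2 * r) :: 'a::semiring_1 mat)"
  by (simp add: atr_swap_mat swap_mat_mult)

lemma pair_swap_singleton:
  "q < r \<Longrightarrow> j < 2 * r \<Longrightarrow>
    pair_swap r {q} j = (if j = q + r then r - 1 - q else if j = r - 1 - q then q + r else j)"
  by (auto simp: pair_swap_def)

lemma swap_mat_singleton:
  assumes q: "q < r"
  shows "swap_mat r {q} = (swaprows_mat (2 * r) (r - 1 - q) (q + r) :: 'a::comm_ring_1 mat)"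
proof (rule eq_matI)
  fix i j assume "i < dim_row (swaprows_mat (2 * r) (r - 1 - q) (q + r) :: 'a mat)"
    "j < dim_col (swaprows_mat (2 * r) (r - 1 - q) (q + r) :: 'a mat)"
  then have ij: "i < 2 * r" "j < 2 * r"
    by (simp_all add: swaprows_mat_def)
  have "r - 1 - q < 2 * r" "q + r < 2 * r" "r - 1 - q \<noteq> q + r"
    using q by auto
  then show "(swap_mat r {q} :: 'a mat) $$ (i, j) = swaprows_mat (2 * r) (r - 1 - q) (q + r) $$ (i, j)"
    unfolding swap_mat_def swaprows_mat_def index_mat(1)[OF ij] case_prod_conv
      pair_swap_singleton[OF q ij(2)]
    by presburger
qed (auto simp: swaprows_mat_def)

text \<open>A product of \<open>card Q\<close> transpositions. This ties the parity of
  \<open>Q\<close> to membership in the special orthogonal group.\<close>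

lemma det_swap_mat:
  assumes "Q \<subseteq> {..<r}"
  shows "det (swap_mat r Q :: 'a::comm_ring_1 mat) = (- 1) ^ card Q"
proof -
  have "finite Q"
    using assms finite_subset by blast
  then show ?thesis
    using assms
  proof (induction Q)
    case (insert q Q)
    have "swap_mat r {q} = (swaprows_mat (2 * r) (r - 1 - q) (q + r) :: 'a mat)"
      using insert.prems by (intro swap_mat_singleton) auto
    moreover have "det (swaprows_mat (2 * r) (r - 1 - q) (q + r) :: 'a mat) = - 1"
      using insert.prems by (intro det_swaprows_mat) auto
    moreover have "swap_mat r (insert q Q) = (swap_mat r {q} * swap_mat r Q :: 'a mat)"
      using insert by (subst swap_mat_mult) (auto intro!: arg_cong[where f = "swap_mat r"])
    ultimately show ?case
      using insert by (simp add: det_mult[of _ "2 * r"])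
  qed simp
qed

section \<open>Isotropic rows and pivots in the lower right quadrant\<close>

lemma sum_pairs:
  fixes f :: "nat \<Rightarrow> 'a::comm_monoid_add"
  shows "(\<Sum>k<2 * r. f k) = (\<Sum>q<r. f (q + r)) + (\<Sum>q<r. f (r - 1 - q))"
proof -
  have "(\<Sum>k<2 * r. f k) = (\<Sum>k\<in>{0..<r}. f k) + (\<Sum>k\<in>{r..<2 * r}. f k)"
    by (simp add: sum.atLeastLessThan_concat lessThan_atLeast0)
  also have "(\<Sum>k\<in>{r..<2 * r}. f k) = (\<Sum>q<r. f (q + r))"
    using sum.shift_bounds_nat_ivl[of f 0 r r] by (simp add: mult_2 lessThan_atLeast0)
  also have "(\<Sum>k\<in>{0..<r}. f k) = (\<Sum>q<r. f (r - 1 - q))"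
    using sum.nat_diff_reindex[of f r] by (simp add: lessThan_atLeast0)
  finally show ?thesis
    by (simp add: add.commute)
qed

text \<open>The last \<open>r\<close> rows of an orthogonal matrix span an isotropic subspace. The
  pairing of two of them is an entry of \<open>g * atr g\<close> off the diagonal, and grouping the
  columns into the opposite pairs \<open>q + r\<close>, \<open>r - 1 - q\<close> gives the two
  products in each summand.\<close>

lemma rows_isotropic:
  fixes g :: "'a::field mat"
  assumes g: "g \<in> carrier_mat (2 * r) (2 * r)" and orth: "atr g * g = 1\<^sub>m (2 * r)"
    and p: "p < r" "p' < r"
  shows "(\<Sum>q<r. g $$ (p + r, q + r) * g $$ (p' + r, r - 1 - q) +
    g $$ (p + r, r - 1 - q) * g $$ (p' + r, q + r)) = 0"
proof -
  have gg: "g * atr g = 1\<^sub>m (2 * r)"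
    by (rule mat_mult_left_right_inverse[OF _ g orth]) (use g in auto)
  have "0 = (g * atr g) $$ (p + r, r - 1 - p')"
    unfolding gg using p by simp
  also have "\<dots> = (\<Sum>k<2 * r. g $$ (p + r, k) * g $$ (p' + r, 2 * r - 1 - k))"
    by (subst index_mult_sum[OF g atr_carrier[OF g]])
       (use p in \<open>auto intro!: sum.cong simp: index_atr[OF g] add.commute\<close>)
  also have "\<dots> = (\<Sum>q<r. g $$ (p + r, q + r) * g $$ (p' + r, r - 1 - q)) +
      (\<Sum>q<r. g $$ (p + r, r - 1 - q) * g $$ (p' + r, q + r))"
    unfolding sum_pairs by (intro arg_cong2[where f = "(+)"] sum.cong)
      (auto intro!: arg_cong2[where f = "(*)"] arg_cong[where f = "\<lambda>x. g $$ x"])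
  finally show ?thesis
    by (simp add: sum.distrib)
qed

text \<open>One step of Gaussian elimination by row operations that keeps the unit columns already
  reached. \<open>M\<close>, the identity with column \<open>q\<close> replaced by that of
  \<open>D\<close>, agrees with \<open>D\<close> in all columns of \<open>insert q P\<close>, so its
  inverse sends these columns to unit vectors.\<close>

lemma pivot:
  fixes D :: "'f::padic_field mat"
  assumes D: "D \<in> carrier_mat r r" and P: "P \<subseteq> {..<r}" and pq: "p < r" "q < r" "p \<notin> P" "q \<notin> P"
    and nz: "D $$ (p, q) \<noteq> 0" and unit: "\<And>l. l \<in> P \<Longrightarrow> col D l = unit_vec r l"
  shows "\<exists>b\<in>carrier (GL r). \<forall>l\<in>insert q P. col (b * D) l = unit_vec r l"
proof -
  have *: "\<exists>b\<in>carrier (GL r). \<forall>l\<in>insert q P. col (b * D) l = unit_vec r l"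
    if D: "D \<in> carrier_mat r r" and nz: "D $$ (q, q) \<noteq> 0"
      and unit: "\<And>l. l \<in> P \<Longrightarrow> col D l = unit_vec r l" for D :: "'f mat"
  proof -
    define M where "M = replace_col (1\<^sub>m r) (col D q) q"
    have M: "M \<in> carrier_mat r r"
      by (simp add: M_def replace_col_def)
    \<comment> \<open>Cramer's rule for the identity matrix: replacing column \<open>q\<close> by a
      vector gives entry \<open>q\<close> of that vector as the determinant.\<close>
    have "det M = D $$ (q, q)"
      using cramer_lemma_mat[of "1\<^sub>m r :: 'f mat" r "col D q" q] D pq unfolding M_def by simp
    then obtain B where B: "B \<in> carrier_mat r r" "M * B = 1\<^sub>m r" "B * M = 1\<^sub>m r"
      using det_nonzero_inverse[OF M] nz by metis
    have M_col: "col M l = col D l" if "l \<in> insert q P" for l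
      using that P pq unit D by (intro eq_vecI) (auto simp: M_def replace_col_def)
    have "col (B * D) l = unit_vec r l" if l: "l \<in> insert q P" for l
    proof -
      have lr: "l < r"
        using l P pq by auto
      have "col (B * D) l = B *\<^sub>v col M l"
        using M_col[OF l] col_mult2[OF B(1) D lr] by simp
      also have "\<dots> = col (B * M) l"
        using col_mult2[OF B(1) M lr] by simp
      finally show ?thesis
        using B lr by simp
    qed
    moreover have "B \<in> carrier (GL r)"
      using mult_one_imp_det_nonzero(2)[OF M B(1,2)] B(1) by (simp add: carrier_GL)
    ultimately show ?thesis
      by blast
  qed
  show ?thesis
  proof (cases "D $$ (q, q) = 0")
    case False
    then show ?thesis
      using * D unit by blast
  next
    case True
    with nz have "p \<noteq> q"
      by auto
    \<comment> \<open>Adding row \<open>p\<close> to row \<open>q\<close> moves the nonzero entry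
      onto the diagonal. It does not disturb the unit columns in \<open>P\<close>, because these are
      zero in row \<open>p\<close>.\<close>
    define E where "E = (addrow_mat r 1 q p :: 'f mat)"
    have E: "E \<in> carrier (GL r)"
      using \<open>p \<noteq> q\<close> by (auto simp: E_def carrier_GL det_addrow_mat)
    have ED: "E * D = addrow 1 q p D"
      unfolding E_def using D pq by (intro addrow_mat[symmetric]) auto
    have "\<exists>b\<in>carrier (GL r). \<forall>l\<in>insert q P. col (b * (E * D)) l = unit_vec r l"
    proof (rule *)
      show "E * D \<in> carrier_mat r r"
        unfolding ED using D by simp
      show "(E * D) $$ (q, q) \<noteq> 0"
        unfolding ED using D pq True nz by simp
      show "col (E * D) l = unit_vec r l" if l: "l \<in> P" for l
      proof (rule eq_vecI)
        have lr: "l < r"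
          using P l by auto
        have Dl: "D $$ (i, l) = (if i = l then 1 else 0)" if "i < r" for i
          using arg_cong[OF unit[OF l], of "\<lambda>v. vec_index v i"] that lr D by (simp add: unit_vec_def)
        fix i assume "i < dim_vec (unit_vec r l :: 'f vec)"
        then show "vec_index (col (E * D) l) i = vec_index (unit_vec r l) i"
          unfolding ED using D lr pq l Dl by (auto simp: unit_vec_def)
      qed (use D E in \<open>auto simp: carrier_GL\<close>)
    qed
    then obtain b where b: "b \<in> carrier (GL r)" "\<forall>l\<in>insert q P. col (b * (E * D)) l = unit_vec r l"
      by blast
    moreover have "b * (E * D) = b * E * D"
      using b E D by (intro assoc_mult_mat[symmetric]) (auto simp: carrier_GL)
    ultimately show ?thesis
      using GL_mult_closed[OF b(1) E] by metis
  qed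
qed

lemma lower_quadrants_mult:
  fixes g h :: "'a::comm_ring_1 mat"
  assumes g: "g \<in> carrier_mat (2 * r) (2 * r)" and h: "h \<in> carrier_mat (2 * r) (2 * r)"
  shows "ll r (g * h) = ll r g * ul r h + lr r g * ll r h"
    and "lr r (g * h) = ll r g * ur r h + lr r g * lr r h"
proof -
  have "g * h = four_block_mat (ul r g) (ur r g) (ll r g) (lr r g) *
      four_block_mat (ul r h) (ur r h) (ll r h) (lr r h)"
    by (simp only: quadrants_eq[OF g] quadrants_eq[OF h])
  also have "\<dots> = four_block_mat (ul r g * ul r h + ur r g * ll r h) (ul r g * ur r h + ur r g * lr r h)
      (ll r g * ul r h + lr r g * ll r h) (ll r g * ur r h + lr r g * lr r h)"
    by (rule four_block_mult) auto
  finally show "ll r (g * h) = ll r g * ul r h + lr r g * ll r h"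
    "lr r (g * h) = ll r g * ur r h + lr r g * lr r h"
    by (auto simp: quadrant_four_block add_carrier_mat mult_carrier_mat[of _ r r])
qed

lemma lower_quadrants_m_Siegel:
  fixes a :: "'f::padic_field mat"
  assumes a: "a \<in> carrier (GL r)"
  shows "ll r (m_Siegel r a) = 0\<^sub>m r r" "lr r (m_Siegel r a) = atr (inv\<^bsub>GL r\<^esub> a)"
  using a inv_GL(1)[OF a] unfolding m_Siegel_eq[OF a]
  by (auto simp: quadrant_four_block carrier_GL)

lemma lr_m_mult:
  fixes a :: "'f::padic_field mat"
  assumes a: "a \<in> carrier (GL r)" and g: "g \<in> carrier_mat (2 * r) (2 * r)"
  shows "lr r (m_Siegel r a * g) = atr (inv\<^bsub>GL r\<^esub> a) * lr r g"
proof -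
  have c: "atr (inv\<^bsub>GL r\<^esub> a) \<in> carrier_mat r r"
    using inv_GL(1)[OF a] by (simp add: carrier_GL)
  show ?thesis
    using lower_quadrants_mult(2)[OF SO_even_carrier_mat[OF m_Siegel_in_SO_even[OF a]] g]
      left_add_zero_mat[OF mult_carrier_mat[OF c quadrant_carrier(4)]]
    by (simp add: lower_quadrants_m_Siegel[OF a] left_mult_zero_mat[OF quadrant_carrier(2)])
qed

text \<open>Left multiplication by a Levi element acts on the lower right quadrant through
  \<open>atr\<close> of the inverse. Solving for the element realizes any invertible row operation
  there.\<close>

lemma lower_quadrants_m_mult:
  fixes b :: "'f::padic_field mat"
  assumes b: "b \<in> carrier (GL r)"
  obtains a where "a \<in> carrier (GL r)"
    "\<And>g. g \<in> carrier_mat (2 * r) (2 * r) \<Longrightarrow> lr r (m_Siegel r a * g) = b * lr r g"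
proof
  let ?a = "inv\<^bsub>GL r\<^esub> (atr b)"
  have b': "b \<in> carrier_mat r r"
    using b by (simp add: carrier_GL)
  have ab: "atr b \<in> carrier (GL r)"
    using b by (auto simp: carrier_GL det_atr)
  show a: "?a \<in> carrier (GL r)"
    using inv_GL(1)[OF ab] .
  have a': "?a \<in> carrier_mat r r"
    using a by (simp add: carrier_GL)
  have inv: "inv\<^bsub>GL r\<^esub> ?a = atr b"
    by (rule inv_GL_eqI) (use inv_GL[OF ab] a' b' in auto)
  show "lr r (m_Siegel r ?a * g) = b * lr r g" if "g \<in> carrier_mat (2 * r) (2 * r)" for g
    using lr_m_mult[OF a that] by (simp add: inv)
qed

lemma orthogonal_row_nonzero:
  fixes g :: "'a::field mat"
  assumes g: "g \<in> carrier_mat (2 * r) (2 * r)" and orth: "atr g * g = 1\<^sub>m (2 * r)" and p: "p < r"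
  obtains q where "q < r" "g $$ (p + r, q + r) \<noteq> 0 \<or> g $$ (p + r, r - 1 - q) \<noteq> 0"
proof (rule ccontr)
  assume "\<not> thesis"
  then have z: "\<And>q. q < r \<Longrightarrow> g $$ (p + r, q + r) = 0 \<and> g $$ (p + r, r - 1 - q) = 0"
    using that by blast
  have gg: "g * atr g = 1\<^sub>m (2 * r)"
    by (rule mat_mult_left_right_inverse[OF _ g orth]) (use g in auto)
  have "1 = (g * atr g) $$ (p + r, p + r)"
    unfolding gg using p by simp
  also have "\<dots> = (\<Sum>k<2 * r. g $$ (p + r, k) * atr g $$ (k, p + r))"
    by (rule index_mult_sum[OF g atr_carrier[OF g]]) (use p in auto)
  also have "\<dots> = 0"
    unfolding sum_pairs using z by simp
  finally show False
    by simp
qed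

text \<open>Induction on the number \<open>k\<close> of unit columns. A further pivot needs a row
  \<open>p\<close> and a pair of opposite columns indexed by \<open>q\<close>, both outside
  \<open>P\<close>, with a nonzero entry in either column of the pair. If the entry is in the left
  half, exchanging the pair brings it into the quadrant without touching the columns in
  \<open>P\<close>. Isotropy of the lower rows guarantees that such an entry exists.\<close>

lemma lr_pivots:
  fixes h :: "'f::padic_field mat"
  assumes h: "h \<in> carrier_mat (2 * r) (2 * r)" and orth: "atr h * h = 1\<^sub>m (2 * r)" and "k \<le> r"
  shows "\<exists>a\<in>carrier (GL r). \<exists>Q P. Q \<subseteq> {..<r} \<and> P \<subseteq> {..<r} \<and> card P = k \<and>
    (\<forall>l\<in>P. col (lr r (m_Siegel r a * h * swap_mat r Q)) l = unit_vec r l)"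
  using \<open>k \<le> r\<close>
proof (induction k)
  case 0
  show ?case
    by (rule bexI[of _ "1\<^sub>m r"], rule exI[of _ "{}"], rule exI[of _ "{}"]) (auto simp: carrier_GL)
next
  case (Suc k)
  then obtain a Q P where a: "a \<in> carrier (GL r)" and Q: "Q \<subseteq> {..<r}" and P: "P \<subseteq> {..<r}" "card P = k"
    and unit: "\<And>l. l \<in> P \<Longrightarrow> col (lr r (m_Siegel r a * h * swap_mat r Q)) l = unit_vec r l"
    by auto
  have m: "m_Siegel r a \<in> carrier_mat (2 * r) (2 * r)" "atr (m_Siegel r a) * m_Siegel r a = 1\<^sub>m (2 * r)"
    using m_Siegel_in_SO_even[OF a] by (auto simp: carrier_SO_even)
  define g where "g R = m_Siegel r a * h * swap_mat r R" for R
  have g: "g R \<in> carrier_mat (2 * r) (2 * r)" for R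
    unfolding g_def using m h by auto
  have g_orth: "atr (g R) * g R = 1\<^sub>m (2 * r)" if "R \<subseteq> {..<r}" for R
    unfolding g_def using m h orth that
    by (intro atr_mult_orthogonal swap_mat_orthogonal) auto
  have lr_g: "lr r (g R) $$ (i, j) = g R $$ (i + r, j + r)" if "i < r" "j < r" for i j R
    using that by (simp add: lr_def)
  have unit': "g Q $$ (i + r, l + r) = (if i = l then 1 else 0)" if "l \<in> P" "i < r" for i l
  proof -
    have "l < r"
      using that P by auto
    then have "g Q $$ (i + r, l + r) = vec_index (col (lr r (g Q)) l) i"
      using that by (simp add: lr_def)
    also have "\<dots> = (if i = l then 1 else 0)"
      using unit[OF that(1)] that \<open>l < r\<close> by (simp add: g_def)
    finally show ?thesis .
  qed
  have "\<exists>p q. p < r \<and> q < r \<and> p \<notin> P \<and> q \<notin> P \<and>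
      (g Q $$ (p + r, q + r) \<noteq> 0 \<or> g Q $$ (p + r, r - 1 - q) \<noteq> 0)"
  proof -
    have "P \<noteq> {..<r}"
      using P Suc.prems by auto
    then obtain p where p: "p < r" "p \<notin> P"
      using P by auto
    obtain q where q: "q < r" "g Q $$ (p + r, q + r) \<noteq> 0 \<or> g Q $$ (p + r, r - 1 - q) \<noteq> 0"
      using orthogonal_row_nonzero[OF g g_orth[OF Q] p(1)] by blast
    show ?thesis
    proof (rule ccontr)
      assume "\<not> ?thesis"
      then have z: "\<And>l. l < r \<Longrightarrow> l \<notin> P \<Longrightarrow> g Q $$ (p + r, l + r) = 0 \<and> g Q $$ (p + r, r - 1 - l) = 0"
        using p by blast
      then have "q \<in> P"
        using q by blast
      \<comment> \<open>Row \<open>p\<close> is paired with row \<open>q\<close>, where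
        \<open>q\<close> now lies in \<open>P\<close>. For \<open>l\<close> outside \<open>P\<close>
        row \<open>p\<close> vanishes in both columns of the pair; for \<open>l\<close> in
        \<open>P\<close> the unit column kills the first product and leaves the second only at
        \<open>l = q\<close>. What survives is the left entry of pair \<open>q\<close>, so this pair
        carries no nonzero entry of row \<open>p\<close> at all, against its choice.\<close>
      have "0 = (\<Sum>l<r. g Q $$ (p + r, l + r) * g Q $$ (q + r, r - 1 - l) +
          g Q $$ (p + r, r - 1 - l) * g Q $$ (q + r, l + r))"
        using rows_isotropic[OF g g_orth[OF Q] p(1) q(1)] by simp
      also have "\<dots> = (\<Sum>l<r. if l = q then g Q $$ (p + r, r - 1 - l) else 0)"
      proof (rule sum.cong)
        fix l assume l: "l \<in> {..<r}"
        show "g Q $$ (p + r, l + r) * g Q $$ (q + r, r - 1 - l) +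
          g Q $$ (p + r, r - 1 - l) * g Q $$ (q + r, l + r) = (if l = q then g Q $$ (p + r, r - 1 - l) else 0)"
        proof (cases "l \<in> P")
          case True
          then have "l \<noteq> p"
            using p by auto
          with True show ?thesis
            using unit'[of l p] unit'[of l q] p q by auto
        next
          case False
          then show ?thesis
            using z[of l] l \<open>q \<in> P\<close> by auto
        qed
      qed simp
      also have "\<dots> = g Q $$ (p + r, r - 1 - q)"
        using q by simp
      finally have "g Q $$ (p + r, r - 1 - q) = 0"
        by simp
      moreover have "g Q $$ (p + r, q + r) = 0"
        using unit'[OF \<open>q \<in> P\<close> p(1)] \<open>q \<in> P\<close> p by auto
      ultimately show False
        using q by blast
    qed
  qed
  then obtain p q where pq: "p < r" "q < r" "p \<notin> P" "q \<notin> P"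
    and nz: "g Q $$ (p + r, q + r) \<noteq> 0 \<or> g Q $$ (p + r, r - 1 - q) \<noteq> 0"
    by blast
  \<comment> \<open>The pair is exchanged only if its right column has a zero in row
    \<open>p\<close>.\<close>
  define R where "R = (if g Q $$ (p + r, q + r) \<noteq> 0 then Q else sym_diff Q {q})"
  have R: "R \<subseteq> {..<r}"
    using Q pq by (auto simp: R_def)
  have gh: "m_Siegel r a * h \<in> carrier_mat (2 * r) (2 * r)"
    using m h by auto
  have g_swap: "g R $$ (i + r, l + r) = g Q $$ (i + r, pair_swap r (if g Q $$ (p + r, q + r) \<noteq> 0 then {} else {q}) (l + r))"
    if "i < r" "l < r" for i l
  proof (cases "g Q $$ (p + r, q + r) = 0")
    case True
    have "pair_swap r {q} (l + r) < 2 * r"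
      by (rule pair_swap_less) (use pq that in auto)
    then show ?thesis
      using True that pq Q R unfolding g_def
      by (simp add: R_def g_def index_mult_swap_mat[OF gh] pair_swap_diff del: index_mult_mat)
  qed (simp add: R_def)
  have "\<exists>b\<in>carrier (GL r). \<forall>l\<in>insert q P. col (b * lr r (g R)) l = unit_vec r l"
  proof (rule pivot[OF _ P(1) pq])
    show "lr r (g R) $$ (p, q) \<noteq> 0"
    proof (cases "g Q $$ (p + r, q + r) = 0")
      case True
      then show ?thesis
        using nz pq by (simp add: lr_g g_swap pair_swap_def)
    next
      case False
      then show ?thesis
        using pq by (simp add: lr_g g_swap)
    qed
    show "col (lr r (g R)) l = unit_vec r l" if l: "l \<in> P" for l
    proof (rule eq_vecI)
      fix i assume "i < dim_vec (unit_vec r l :: 'f vec)"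
      moreover have "l < r" "l \<noteq> q"
        using l P pq by auto
      ultimately show "vec_index (col (lr r (g R)) l) i = vec_index (unit_vec r l) i"
        using g_swap[of i l] unit'[OF l, of i] by (auto simp: lr_def pair_swap_def unit_vec_def)
    qed (simp add: lr_def)
  qed auto
  then obtain b where b: "b \<in> carrier (GL r)" and bcol: "\<And>l. l \<in> insert q P \<Longrightarrow> col (b * lr r (g R)) l = unit_vec r l"
    by blast
  obtain c where c: "c \<in> carrier (GL r)" "lr r (m_Siegel r c * g R) = b * lr r (g R)"
    using lower_quadrants_m_mult[OF b] g by metis
  have mc: "m_Siegel r c \<in> carrier_mat (2 * r) (2 * r)"
    using m_Siegel_in_SO_even[OF c(1)] by (auto simp: carrier_SO_even)
  have "m_Siegel r c * g R = m_Siegel r c * m_Siegel r a * h * swap_mat r R"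
    unfolding g_def using mc m h
    by (simp add: assoc_mult_mat[of _ "2 * r" "2 * r" _ "2 * r" _ "2 * r"] mult_carrier_mat[of _ "2*r" "2*r" _ "2*r"])
  then have "m_Siegel r c * g R = m_Siegel r (c * a) * h * swap_mat r R"
    by (simp add: m_Siegel_mult[OF c(1) a])
  moreover have "card (insert q P) = Suc k"
    using P pq finite_subset[OF P(1)] by simp
  ultimately show ?case
    using R P pq bcol c GL_mult_closed[OF c(1) a]
    by (intro bexI[of _ "c * a"] exI[of _ R] exI[of _ "insert q P"]) auto
qed

text \<open>With \<open>r\<close> pivots every column of the quadrant is a unit vector, so up to an
  invertible factor from the Levi subgroup the quadrant is the identity.\<close>

lemma swap_lr_nonsingular:
  fixes h :: "'f::padic_field mat"
  assumes h: "h \<in> carrier_mat (2 * r) (2 * r)" and orth: "atr h * h = 1\<^sub>m (2 * r)"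
  obtains Q where "Q \<subseteq> {..<r}" "det (lr r (h * swap_mat r Q)) \<noteq> 0"
proof -
  obtain a Q P where a: "a \<in> carrier (GL r)" and Q: "Q \<subseteq> {..<r}" and P: "P \<subseteq> {..<r}" "card P = r"
    and unit: "\<And>l. l \<in> P \<Longrightarrow> col (lr r (m_Siegel r a * h * swap_mat r Q)) l = unit_vec r l"
    using lr_pivots[OF assms le_refl] by blast
  have P': "P = {..<r}"
    using P by (simp add: card_subset_eq)
  define g where "g = h * swap_mat r Q"
  have g: "g \<in> carrier_mat (2 * r) (2 * r)"
    using h by (auto simp: g_def)
  have ia: "inv\<^bsub>GL r\<^esub> a \<in> carrier_mat r r" "a \<in> carrier_mat r r"
    using a inv_GL[OF a] by (auto simp: carrier_GL)
  have m: "m_Siegel r a \<in> carrier_mat (2 * r) (2 * r)"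
    using m_Siegel_in_SO_even[OF a] by (auto simp: carrier_SO_even)
  have c: "ul r g \<in> carrier_mat r r" "ur r g \<in> carrier_mat r r" "ll r g \<in> carrier_mat r r" "lr r g \<in> carrier_mat r r"
    by auto
  have "lr r (m_Siegel r a * g) = atr (inv\<^bsub>GL r\<^esub> a) * lr r g"
    by (rule lr_m_mult[OF a g])
  moreover have "m_Siegel r a * h * swap_mat r Q = m_Siegel r a * g"
    unfolding g_def using m h by (intro assoc_mult_mat) auto
  ultimately have "col (atr (inv\<^bsub>GL r\<^esub> a) * lr r g) l = unit_vec r l" if "l < r" for l
    using unit that P' by auto
  then have "atr (inv\<^bsub>GL r\<^esub> a) * lr r g = 1\<^sub>m r"
    using ia c by (intro mat_col_eqI) (auto simp: lr_def simp del: col_mult2)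
  then have "det (lr r g) \<noteq> 0"
    using mult_one_imp_det_nonzero(2)[OF atr_carrier[OF ia(1)] c(4)] by blast
  then show ?thesis
    using that Q unfolding g_def by blast
qed

section \<open>Skewness with respect to the antidiagonal, and lower unipotent elements\<close>

lemma skew_entry:
  fixes Y :: "'f::padic_field mat"
  assumes Y: "Y \<in> carrier_mat r r" "atr Y = - Y" and ij: "i < r" "j < r"
  shows "Y $$ (i, r - 1 - j) = - Y $$ (j, r - 1 - i)"
proof -
  have "atr Y $$ (i, r - 1 - j) = Y $$ (j, r - 1 - i)"
    using ij by (subst index_atr[OF Y(1)]) auto
  moreover have "atr Y $$ (i, r - 1 - j) = - Y $$ (i, r - 1 - j)"
    using Y ij by simp
  ultimately show ?thesis
    by simp
qed

text \<open>The determinant is the principal minor of \<open>T\<close> on \<open>{p, q}\<close>,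
  whose diagonal vanishes since 2 is invertible. After exchanging the two columns it is evaluated by
  Cramer's rule, applied once to the identity and once to \<open>A\<close>.\<close>

lemma det_two_columns:
  fixes T :: "nat \<Rightarrow> nat \<Rightarrow> 'f::padic_field"
  assumes skew: "\<And>i j. i < r \<Longrightarrow> j < r \<Longrightarrow> T i j = - T j i" and pq: "p < r" "q < r" "p \<noteq> q"
  shows "det (mat r r (\<lambda>(i, j). if j \<in> {p, q} then T i j else if i = j then 1 else 0)) = (T p q)\<^sup>2"
    (is "det ?M = _")
proof -
  have z: "T i i = 0" if "i < r" for i
    using skew[OF that that] by (simp add: eq_neg_iff_add_eq_0)
  define A where "A = replace_col (1\<^sub>m r) (vec r (\<lambda>i. T i q)) p"
  have A: "A \<in> carrier_mat r r"
    by (simp add: A_def replace_col_def)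
  have detA: "det A = T p q"
    using cramer_lemma_mat[of "1\<^sub>m r :: 'f mat" r "vec r (\<lambda>i. T i q)" p] pq unfolding A_def by simp
  define y where "y = vec r (\<lambda>i. T i p)"
  \<comment> \<open>\<open>A\<close> differs from the identity only in column \<open>p\<close>, and
    \<open>y\<close> vanishes at \<open>p\<close>.\<close>
  have Ay: "A *\<^sub>v y = y"
  proof (rule eq_vecI)
    fix i assume "i < dim_vec y"
    then have i: "i < r"
      by (simp add: y_def)
    have "vec_index (A *\<^sub>v y) i = (\<Sum>k<r. A $$ (i, k) * T k p)"
      using A i by (simp add: scalar_prod_def y_def atLeast0LessThan)
    also have "\<dots> = (\<Sum>k<r. if k = i then T k p else 0)"
    proof (rule sum.cong)
      fix k assume "k \<in> {..<r}"
      then show "A $$ (i, k) * T k p = (if k = i then T k p else 0)"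
        using i z pq by (auto simp: A_def replace_col_def)
    qed simp
    also have "\<dots> = vec_index y i"
      using i by (simp add: y_def)
    finally show "vec_index (A *\<^sub>v y) i = vec_index y i" .
  qed (use A in \<open>auto simp: y_def\<close>)
  have "det (replace_col A y q) = T q p * det A"
    using cramer_lemma_mat[OF A, of y q] pq by (simp add: Ay) (simp add: y_def)
  moreover have "swapcols p q ?M = replace_col A y q"
    using pq by (intro eq_matI) (auto simp: A_def replace_col_def y_def mat_swapcols_def)
  moreover have "det (swapcols p q ?M) = - det ?M"
    using pq by (intro det_swapcols[of _ r]) auto
  ultimately have "det ?M = - (T q p * T p q)"
    by (simp add: detA equation_minus_iff)
  then show ?thesis
    using skew[OF pq(2,1)] by (simp add: power2_eq_square)
qed

definition lower_unip :: "nat \<Rightarrow> 'f::padic_field mat \<Rightarrow> 'f mat" where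
  "lower_unip r Y = four_block_mat (1\<^sub>m r) (0\<^sub>m r r) Y (1\<^sub>m r)"

lemma lower_unip_in_SO_even:
  assumes Y: "Y \<in> carrier_mat r r" "atr Y = - Y"
  shows "lower_unip r Y \<in> carrier (SO_even r)"
proof -
  have "atr Y + Y = 0\<^sub>m r r"
    using Y eq_uminus_iff_mat[of "atr Y" r r Y] by simp
  then show ?thesis
    unfolding carrier_SO_even lower_unip_def using Y(1)
    by (subst orthogonal_blocks_iff) (auto simp: det_upper_zero four_block_carrier)
qed

lemma lower_unip_mult:
  assumes "Y \<in> carrier_mat r r" "Z \<in> carrier_mat r r"
  shows "lower_unip r Y * lower_unip r Z = lower_unip r (Y + Z)"
  unfolding lower_unip_def using assms
  by (subst four_block_mult) auto

text \<open>
  Among the right translates of \<open>h\<close> by the \<open>swap_mat r Q\<close>, take one whose lower right quadrant has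
  a determinant of maximal absolute value. It is an element of the parabolic times
  \<open>lower_unip r Y\<close>. By maximality the \<open>2 \<times> 2\<close> principal minors of \<open>Y\<close> are integral, and up to
  the order of the columns \<open>Y\<close> is skew-symmetric, so these are the squares of its entries. Only
  generators with an evident Dickson invariant occur on the right, so the residue characteristic 2
  needs no separate treatment.
\<close>

theorem iwasawa:
  fixes h :: "'f::padic_field mat"
  assumes h: "h \<in> carrier (SO_even r)"
  obtains a u Y Q where "a \<in> carrier (GL r)" "u \<in> N_Siegel r"
    "Y \<in> carrier_mat r r" "atr Y = - Y" "\<And>i j. i < r \<Longrightarrow> j < r \<Longrightarrow> absF (Y $$ (i, j)) \<le> 1"
    "Q \<subseteq> {..<r}" "even (card Q)"
    "h = m_Siegel r a * u * (lower_unip r Y * swap_mat r Q)"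
proof -
  have hc: "h \<in> carrier_mat (2 * r) (2 * r)" and ho: "atr h * h = 1\<^sub>m (2 * r)"
    using h by (auto simp: carrier_SO_even)
  define D where "D Q = absF (det (lr r (h * swap_mat r Q)))" for Q
  obtain Q0 where Q0: "Q0 \<subseteq> {..<r}" "D Q0 > 0"
    using swap_lr_nonsingular[OF hc ho] unfolding D_def by (metis absF_eq_0_iff absF_nonneg less_eq_real_def)
  obtain Q where Q: "Q \<subseteq> {..<r}" and Qmax: "\<And>R. R \<subseteq> {..<r} \<Longrightarrow> D R \<le> D Q"
  proof -
    have "finite (D ` Pow {..<r})" "D ` Pow {..<r} \<noteq> {}"
      by auto
    then have "Max (D ` Pow {..<r}) \<in> D ` Pow {..<r}" "\<And>R. R \<subseteq> {..<r} \<Longrightarrow> D R \<le> Max (D ` Pow {..<r})"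
      by (auto intro!: Max_in)
    then show ?thesis
      using that by (metis (no_types, lifting) PowD imageE)
  qed
  define g where "g = h * swap_mat r Q"
  have g: "g \<in> carrier_mat (2 * r) (2 * r)" and go: "atr g * g = 1\<^sub>m (2 * r)"
    unfolding g_def using hc ho Q by (auto intro!: atr_mult_orthogonal swap_mat_orthogonal)
  define c d where "c = ll r g" and "d = lr r g"
  have cd: "c \<in> carrier_mat r r" "d \<in> carrier_mat r r"
    by (auto simp: c_def d_def)
  have "D Q \<noteq> 0"
    using Qmax[OF Q0(1)] Q0 by auto
  then have "det d \<noteq> 0"
    by (simp add: D_def d_def g_def)
  then obtain d' where d': "d' \<in> carrier_mat r r" "d * d' = 1\<^sub>m r" "d' * d = 1\<^sub>m r"
    using det_nonzero_inverse[OF cd(2)] by metis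
  \<comment> \<open>Chosen so that right multiplication of \<open>g\<close> by the lower unipotent
    matrix of \<open>- Y\<close> clears its lower left quadrant.\<close>
  define Y where "Y = d' * c"
  have Y: "Y \<in> carrier_mat r r"
    using cd d' by (auto simp: Y_def)
  have dY: "d * Y = c"
    using assoc_mult_mat[OF cd(2) d'(1) cd(1)] d' cd by (simp add: Y_def)
  \<comment> \<open>Isotropy of the lower rows in matrix form: the orthogonality of
    \<open>atr g\<close>, read off from its blocks.\<close>
  have cd_rel: "c * atr d + d * atr c = 0\<^sub>m r r"
  proof -
    have "g * atr g = 1\<^sub>m (2 * r)"
      by (rule mat_mult_left_right_inverse[OF _ g go]) (use g in auto)
    then have "atr (atr g) * atr g = 1\<^sub>m (2 * r)"
      by simp
    moreover have "atr g = four_block_mat (atr d) (atr (ur r g)) (atr c) (atr (ul r g))"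
      unfolding c_def d_def using quadrants_eq[OF g]
        atr_four_block[OF quadrant_carrier(1-4)[of r g]] by simp
    ultimately show ?thesis
      using orthogonal_blocks_iff[OF atr_carrier[OF cd(2)] atr_carrier[OF quadrant_carrier(2)]
          atr_carrier[OF cd(1)] atr_carrier[OF quadrant_carrier(1)], of g g]
      by simp
  qed
  have Y_skew: "atr Y = - Y"
  proof -
    have "atr d * atr d' = 1\<^sub>m r"
      using atr_mult[OF d'(1) cd(2)] d'(3) by simp
    then have "c * atr d * atr d' = c"
      using assoc_mult_mat[OF cd(1) atr_carrier[OF cd(2)] atr_carrier[OF d'(1)]] cd by simp
    moreover have "d * atr c * atr d' = d * atr Y"
      using assoc_mult_mat[OF cd(2) atr_carrier[OF cd(1)] atr_carrier[OF d'(1)]]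
      by (simp add: Y_def atr_mult[OF d'(1) cd(1)])
    moreover have "(c * atr d + d * atr c) * atr d' = c * atr d * atr d' + d * atr c * atr d'"
      using cd d' by (intro add_mult_distrib_mat) auto
    ultimately have "d * Y + d * atr Y = 0\<^sub>m r r"
      using d' cd_rel by (simp add: dY)
    then have "d * (Y + atr Y) = 0\<^sub>m r r"
      using mult_add_distrib_mat[OF cd(2) Y atr_carrier[OF Y]] by simp
    then have "d' * d * (Y + atr Y) = 0\<^sub>m r r"
      using assoc_mult_mat[OF d'(1) cd(2) add_carrier_mat[OF atr_carrier[OF Y], of Y]] d' by simp
    then have "Y + atr Y = 0\<^sub>m r r"
      using d' Y by simp
    then show ?thesis
      using eq_uminus_iff_mat[OF atr_carrier[OF Y] Y] comm_add_mat[OF Y atr_carrier[OF Y]] by simp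
  qed
  \<comment> \<open>Reversing the columns turns skewness with respect to the antidiagonal into
    ordinary skew-symmetry.\<close>
  define T where "T i j = Y $$ (i, r - 1 - j)" for i j
  have T_skew: "T i j = - T j i" if "i < r" "j < r" for i j
    using skew_entry[OF Y Y_skew that] by (simp add: T_def)
  have T_int: "absF (T p q) \<le> 1" if pq: "p < r" "q < r" for p q
  proof (cases "p = q")
    case True
    then have "T p q = 0"
      using T_skew[OF pq] by (simp add: eq_neg_iff_add_eq_0)
    then show ?thesis
      by simp
  next
    case False
    define M where "M = mat r r (\<lambda>(i, j). if j \<in> {p, q} then T i j else if i = j then 1 else 0)"
    have M: "M \<in> carrier_mat r r"
      by (simp add: M_def)
    define R where "R = sym_diff Q {p, q}"
    have R: "R \<subseteq> {..<r}"
      using Q pq by (auto simp: R_def)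
    \<comment> \<open>Exchanging the pairs \<open>p\<close> and \<open>q\<close> in addition
      replaces columns \<open>p\<close> and \<open>q\<close> of \<open>d\<close> by columns
      \<open>r - 1 - p\<close> and \<open>r - 1 - q\<close> of \<open>c = d * Y\<close>. These are
      \<open>d\<close> times columns \<open>p\<close> and \<open>q\<close> of
      \<open>T\<close>.\<close>
    have "lr r (h * swap_mat r R) = d * M"
    proof (rule eq_matI)
      fix i j assume "i < dim_row (d * M)" "j < dim_col (d * M)"
      then have ij: "i < r" "j < r"
        using cd M by auto
      have pqs: "{p, q} \<subseteq> {..<r}"
        using pq by auto
      have ps: "pair_swap r {p, q} (j + r) < 2 * r"
        using ij pair_swap_less[OF pqs] by auto
      have "lr r (h * swap_mat r R) $$ (i, j) = (h * swap_mat r R) $$ (i + r, j + r)"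
        using ij by (simp add: lr_def)
      also have "\<dots> = h $$ (i + r, pair_swap r Q (pair_swap r {p, q} (j + r)))"
        using ij by (subst index_mult_swap_mat[OF hc R]) (auto simp: R_def pair_swap_diff[OF Q pqs])
      also have "\<dots> = g $$ (i + r, pair_swap r {p, q} (j + r))"
        unfolding g_def using ij ps by (subst index_mult_swap_mat[OF hc Q]) auto
      also have "\<dots> = (if j \<in> {p, q} then c $$ (i, r - 1 - j) else d $$ (i, j))"
        using ij by (auto simp: pair_swap_def c_def d_def ll_def lr_def)
      also have "\<dots> = (d * M) $$ (i, j)"
      proof (cases "j \<in> {p, q}")
        case True
        have "(d * M) $$ (i, j) = (\<Sum>k<r. d $$ (i, k) * Y $$ (k, r - 1 - j))"
          unfolding index_mult_sum[OF cd(2) M ij]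
          by (rule sum.cong) (use ij True in \<open>auto simp: M_def T_def\<close>)
        also have "\<dots> = (d * Y) $$ (i, r - 1 - j)"
          by (rule index_mult_sum[OF cd(2) Y, symmetric]) (use ij in auto)
        finally show ?thesis
          using True by (simp add: dY)
      next
        case False
        have "(d * M) $$ (i, j) = (\<Sum>k<r. if k = j then d $$ (i, k) else 0)"
          unfolding index_mult_sum[OF cd(2) M ij]
          by (rule sum.cong) (use ij False in \<open>auto simp: M_def\<close>)
        then show ?thesis
          using False ij by simp
      qed
      finally show "lr r (h * swap_mat r R) $$ (i, j) = (d * M) $$ (i, j)" .
    qed (use cd M in \<open>auto simp: lr_def\<close>)
    moreover have "det M = (T p q)\<^sup>2"
      unfolding M_def by (rule det_two_columns[OF T_skew pq False])
    ultimately have "D R = D Q * (absF (T p q))\<^sup>2"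
      using det_mult[OF cd(2) M] by (simp add: D_def absF_mult absF_power d_def g_def)
    then have "D Q * (absF (T p q))\<^sup>2 \<le> D Q * 1"
      using Qmax[OF R] by simp
    moreover have "D Q > 0"
      using Qmax[OF Q0(1)] Q0 by auto
    ultimately have "(absF (T p q))\<^sup>2 \<le> 1\<^sup>2"
      by simp
    then show ?thesis
      by (rule power2_le_imp_le) simp
  qed
  have Y_int: "absF (Y $$ (i, j)) \<le> 1" if "i < r" "j < r" for i j
    using T_int[of i "r - 1 - j"] that by (simp add: T_def)
  have mY: "- Y \<in> carrier_mat r r" "atr (- Y) = - (- Y)"
    using Y Y_skew by (auto simp: atr_uminus)
  define n where "n = lower_unip r Y"
  have n: "n \<in> carrier (SO_even r)"
    unfolding n_def by (rule lower_unip_in_SO_even[OF Y Y_skew])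
  define n' where "n' = lower_unip r (- Y)"
  have n': "n' \<in> carrier (SO_even r)"
    unfolding n'_def by (rule lower_unip_in_SO_even[OF mY])
  have n'c: "n' \<in> carrier_mat (2 * r) (2 * r)" and nc: "n \<in> carrier_mat (2 * r) (2 * r)"
    using n n' by (auto simp: carrier_SO_even)
  have n'n: "n' * n = 1\<^sub>m (2 * r)"
    unfolding n_def n'_def lower_unip_mult[OF mY(1) Y]
    using uminus_l_inv_mat[OF Y] by (simp add: lower_unip_def mult_2)
  define x where "x = g * n'"
  have x: "x \<in> carrier_mat (2 * r) (2 * r)" and xo: "atr x * x = 1\<^sub>m (2 * r)"
    unfolding x_def using g go n' by (auto simp: carrier_SO_even intro!: atr_mult_orthogonal)
  have "ll r x = c * 1\<^sub>m r + d * (- Y)"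
    unfolding x_def lower_quadrants_mult(1)[OF g n'c] c_def d_def
    by (simp add: n'_def lower_unip_def quadrant_four_block Y)
  also have "d * (- Y) = - c"
    using mult_minus_distrib_mat[OF cd(2) zero_carrier_mat Y] by (simp add: dY) (metis Y cd(1) cd(2) dY uminus_mult_right_mat carrier_matD)
  also have "c * 1\<^sub>m r + - c = 0\<^sub>m r r"
    using cd by (intro eq_matI) auto
  finally have llx: "ll r x = 0\<^sub>m r r" .
  obtain a u where au: "a \<in> carrier (GL r)" "u \<in> N_Siegel r" "x = m_Siegel r a * u"
    using parabolic_decomposition[OF x xo llx] by blast
  have x': "x \<in> carrier (SO_even r)"
    unfolding au(3) by (intro SO_even_mult_closed m_Siegel_in_SO_even N_Siegel_in_SO_even au)
  have "x * n = g * (n' * n)"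
    unfolding x_def by (rule assoc_mult_mat[OF g n'c nc])
  then have xn: "x * n = g"
    using g by (simp add: n'n)
  have "g * swap_mat r Q = h * (swap_mat r Q * swap_mat r Q)"
    unfolding g_def by (rule assoc_mult_mat[OF hc]) auto
  then have "h = g * swap_mat r Q"
    using hc Q by (simp add: swap_mat_mult)
  then have "h = x * (n * swap_mat r Q)"
    using assoc_mult_mat[OF x nc swap_mat_carrier] xn by simp
  then have heq: "h = m_Siegel r a * u * (lower_unip r Y * swap_mat r Q)"
    by (simp add: au n_def)
  have "det g = 1"
    unfolding xn[symmetric] using det_mult[OF x nc] x' n by (simp add: carrier_SO_even)
  \<comment> \<open>Both \<open>h\<close> and \<open>g\<close> have determinant 1, so the exchange
    matrix does too. The field has characteristic 0, so this decides the parity whatever the residue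
    characteristic is.\<close>
  then have "(- 1) ^ card Q = (1 :: 'f)"
    unfolding g_def using det_mult[OF hc swap_mat_carrier] h Q by (simp add: det_swap_mat carrier_SO_even)
  then have "even (card Q)"
    by (metis minus_one_power_iff one_neq_neg_one)
  then show ?thesis
    using that[OF au(1,2) Y Y_skew Y_int Q _ heq] by blast
qed


section \<open>The topology of matrix groups\<close>

definition mat_close :: "nat \<Rightarrow> real \<Rightarrow> 'f::padic_field mat \<Rightarrow> 'f mat \<Rightarrow> bool" where
  "mat_close d e A B \<longleftrightarrow> (\<forall>i<d. \<forall>j<d. dist (B $$ (i, j)) (A $$ (i, j)) < e)"

lemma finite_uniform_pos:
  fixes P :: "'a \<Rightarrow> real \<Rightarrow> bool"
  assumes "finite I" "\<And>i. i \<in> I \<Longrightarrow> \<exists>e>0. P i e" "\<And>i e e'. P i e \<Longrightarrow> 0 < e' \<Longrightarrow> e' \<le> e \<Longrightarrow> P i e'"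
  shows "\<exists>e>0. \<forall>i\<in>I. P i e"
  using assms(1,2)
proof (induction I)
  case (insert x F)
  then obtain e1 e2 where "e1 > 0" "P x e1" "e2 > 0" "\<forall>i\<in>F. P i e2"
    by blast
  then show ?case
    using assms(3) by (intro exI[of _ "min e1 e2"]) (auto intro: assms(3))
qed (auto intro: exI[of _ 1])

text \<open>Only finitely many entries are involved, so a basic open set of the product topology
  contains a neighbourhood with one radius for all entries. In this metric form openness in matrix
  groups is checked later on.\<close>

lemma openin_group_topology:
  fixes X :: "'f::padic_field mat set"
  assumes X: "X \<subseteq> carrier_mat d d"
  shows "openin (group_topology (mat_group d X)) U \<longleftrightarrow>
    U \<subseteq> X \<and> (\<forall>g\<in>U. \<exists>e>0. \<forall>h\<in>X. mat_close d e g h \<longrightarrow> h \<in> U)"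
proof -
  let ?I = "{..<d} \<times> {..<d}"
  let ?f = "\<lambda>A :: 'f mat. \<lambda>ij\<in>?I. A $$ ij"
  let ?T = "product_topology (\<lambda>_. euclidean :: 'f topology) ?I"
  have open_iff: "openin (group_topology (mat_group d X)) U \<longleftrightarrow> (\<exists>W. openin ?T W \<and> U = ?f -` W \<inter> X)"
  proof -
    have "(\<exists>T. (\<exists>W. openin ?T W \<and> T = ?f -` W \<inter> carrier_mat d d) \<and> U = T \<inter> X) \<longleftrightarrow>
        (\<exists>W. openin ?T W \<and> U = ?f -` W \<inter> carrier_mat d d \<inter> X)"
      by blast
    moreover have "?f -` W \<inter> carrier_mat d d \<inter> X = ?f -` W \<inter> X" for W
      using X by blast
    ultimately show ?thesis
      unfolding group_topology_def mat_topology_def mat_group_simps index_one_mat(2)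
        openin_subtopology openin_pullback_topology by simp
  qed
  show ?thesis
  proof
    assume "openin (group_topology (mat_group d X)) U"
    then obtain W where W: "openin ?T W" "U = ?f -` W \<inter> X"
      unfolding open_iff by blast
    have "\<exists>e>0. \<forall>h\<in>X. mat_close d e g h \<longrightarrow> h \<in> U" if g: "g \<in> U" for g
    proof -
      have "?f g \<in> W"
        using g W by auto
      with W(1)[unfolded openin_product_topology_alt]
      have "\<exists>V. finite {ij \<in> ?I. V ij \<noteq> topspace (euclidean :: 'f topology)} \<and>
          (\<forall>ij\<in>?I. openin euclidean (V ij)) \<and> ?f g \<in> Pi\<^sub>E ?I V \<and> Pi\<^sub>E ?I V \<subseteq> W"
        by (rule bspec)
      then obtain V where V: "\<forall>ij\<in>?I. openin euclidean (V ij)" "?f g \<in> Pi\<^sub>E ?I V" "Pi\<^sub>E ?I V \<subseteq> W"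
        by (elim exE conjE)
      have "\<exists>e>0. \<forall>ij\<in>?I. ball (g $$ ij) e \<subseteq> V ij"
      proof (rule finite_uniform_pos)
        fix ij assume ij: "ij \<in> ?I"
        then have "g $$ ij \<in> V ij"
          using PiE_mem[OF V(2) ij] by simp
        then show "\<exists>e>0. ball (g $$ ij) e \<subseteq> V ij"
          using bspec[OF V(1) ij] unfolding open_openin[symmetric] by (meson openE)
      qed (auto simp: ball_def)
      then obtain e where e: "e > 0" "\<And>ij. ij \<in> ?I \<Longrightarrow> ball (g $$ ij) e \<subseteq> V ij"
        by blast
      have "h \<in> U" if h: "h \<in> X" "mat_close d e g h" for h
      proof -
        have "h $$ ij \<in> V ij" if "ij \<in> ?I" for ij
          using e(2)[OF that] h(2) that by (auto simp: mat_close_def dist_commute subset_iff)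
        then have "?f h \<in> Pi\<^sub>E ?I V"
          by auto
        then show ?thesis
          using V(3) W(2) h(1) by blast
      qed
      then show ?thesis
        using e by blast
    qed
    then show "U \<subseteq> X \<and> (\<forall>g\<in>U. \<exists>e>0. \<forall>h\<in>X. mat_close d e g h \<longrightarrow> h \<in> U)"
      using W by blast
  next
    assume U: "U \<subseteq> X \<and> (\<forall>g\<in>U. \<exists>e>0. \<forall>h\<in>X. mat_close d e g h \<longrightarrow> h \<in> U)"
    then obtain e where e: "\<And>g. g \<in> U \<Longrightarrow> e g > (0::real)"
      "\<And>g h. g \<in> U \<Longrightarrow> h \<in> X \<Longrightarrow> mat_close d (e g) g h \<Longrightarrow> h \<in> U"
      by metis
    define W where "W = (\<Union>g\<in>U. Pi\<^sub>E ?I (\<lambda>ij. ball (g $$ ij) (e g)))"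
    have "openin ?T W"
      unfolding W_def
    proof (intro openin_Union ballI)
      fix S assume "S \<in> (\<lambda>g. Pi\<^sub>E ?I (\<lambda>ij. ball (g $$ ij) (e g))) ` U"
      then obtain g where S: "S = Pi\<^sub>E ?I (\<lambda>ij. ball (g $$ ij) (e g))"
        by (elim imageE)
      show "openin ?T S"
        unfolding S openin_PiE_gen by (intro disjI2 conjI ballI) (simp_all add: open_openin[symmetric])
    qed
    moreover have "U = ?f -` W \<inter> X"
    proof (intro equalityI subsetI)
      fix g assume g: "g \<in> U"
      then have "?f g \<in> Pi\<^sub>E ?I (\<lambda>ij. ball (g $$ ij) (e g))"
        using e(1)[OF g] by auto
      then show "g \<in> ?f -` W \<inter> X"
        using g U unfolding W_def by blast
    next
      fix h assume h: "h \<in> ?f -` W \<inter> X"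
      then obtain g where g: "g \<in> U" "?f h \<in> Pi\<^sub>E ?I (\<lambda>ij. ball (g $$ ij) (e g))"
        unfolding W_def by blast
      have "mat_close d (e g) g h"
        unfolding mat_close_def
      proof (intro allI impI)
        fix i j assume "i < d" "j < d"
        then show "dist (h $$ (i, j)) (g $$ (i, j)) < e g"
          using PiE_mem[OF g(2), of "(i, j)"] by (simp add: dist_commute)
      qed
      then show "h \<in> U"
        using e(2) g h by blast
    qed
    ultimately show "openin (group_topology (mat_group d X)) U"
      unfolding open_iff by blast
  qed
qed

lemma topspace_group_topology:
  assumes X: "X \<subseteq> carrier_mat d d"
  shows "topspace (group_topology (mat_group d X)) = X"
proof -
  have "openin (group_topology (mat_group d X)) X"
    unfolding openin_group_topology[OF X] by (auto intro: exI[of _ 1])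
  then have "X \<subseteq> topspace (group_topology (mat_group d X))"
    by (rule openin_subset)
  moreover have "topspace (group_topology (mat_group d X)) \<subseteq> X"
    by (simp add: group_topology_def)
  ultimately show ?thesis
    by blast
qed

section \<open>Ultrametric estimates for products of matrices\<close>

lemma entries_bounded:
  fixes A :: "'f::padic_field mat"
  obtains c where "c > 0" "\<And>i j. i < d \<Longrightarrow> j < d \<Longrightarrow> absF (A $$ (i, j)) \<le> c"
proof -
  define c where "c = Max ((\<lambda>ij. absF (A $$ ij)) ` ({..<d} \<times> {..<d}))"
  have "absF (A $$ (i, j)) \<le> c" if "i < d" "j < d" for i j
    unfolding c_def by (rule Max_ge) (use that in auto)
  then have "absF (A $$ (i, j)) \<le> max c 1" if "i < d" "j < d" for i j
    using that by (simp add: le_max_iff_disj)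
  then show ?thesis
    using that[of "max c 1"] by auto
qed

lemma absF_sum_less:
  assumes "\<And>i. i \<in> A \<Longrightarrow> absF (f i) < e" "0 < e"
  shows "absF (\<Sum>i\<in>A. f i) < e"
  using assms
proof (induction A rule: infinite_finite_induct)
  case (insert x F)
  have "absF (f x + sum f F) \<le> max (absF (f x)) (absF (sum f F))"
    by (rule absF_add)
  also have "\<dots> < e"
    using insert by auto
  finally show ?case
    using insert by simp
qed auto

text \<open>The ultrametric inequality bounds a sum by its largest term, so the radius is divided
  only by the bound \<open>c\<close> of the entries, with no factor for the size of the
  matrix.\<close>

lemma mat_close_mult_left:
  fixes A B C :: "'f::padic_field mat"
  assumes A: "A \<in> carrier_mat d d" and B: "B \<in> carrier_mat d d" and C: "C \<in> carrier_mat d d"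
    and c: "c > 0" "\<And>i j. i < d \<Longrightarrow> j < d \<Longrightarrow> absF (C $$ (i, j)) \<le> c"
    and e: "e > 0" "mat_close d (e / c) A B"
  shows "mat_close d e (C * A) (C * B)"
  unfolding mat_close_def
proof (intro allI impI)
  fix i j assume ij: "i < d" "j < d"
  have "(C * B) $$ (i, j) - (C * A) $$ (i, j) = (\<Sum>k<d. C $$ (i, k) * (B $$ (k, j) - A $$ (k, j)))"
    unfolding index_mult_sum[OF C A ij] index_mult_sum[OF C B ij]
    by (simp add: sum_subtractf algebra_simps)
  moreover have "absF (\<Sum>k<d. C $$ (i, k) * (B $$ (k, j) - A $$ (k, j))) < e"
  proof (rule absF_sum_less[OF _ e(1)])
    fix k assume "k \<in> {..<d}"
    then have "absF (C $$ (i, k)) \<le> c" "absF (B $$ (k, j) - A $$ (k, j)) < e / c"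
      using c e ij by (auto simp: mat_close_def dist_absF)
    then have "absF (C $$ (i, k)) * absF (B $$ (k, j) - A $$ (k, j)) \<le> c * absF (B $$ (k, j) - A $$ (k, j))"
      by (intro mult_right_mono) auto
    also have "\<dots> < c * (e / c)"
      using c \<open>absF (B $$ (k, j) - A $$ (k, j)) < e / c\<close> by (intro mult_strict_left_mono)
    finally show "absF (C $$ (i, k) * (B $$ (k, j) - A $$ (k, j))) < e"
      using c by (simp add: absF_mult)
  qed
  ultimately show "dist ((C * B) $$ (i, j)) ((C * A) $$ (i, j)) < e"
    by (simp add: dist_absF del: index_mult_mat)
qed

lemma mat_close_mult_right:
  fixes A B C :: "'f::padic_field mat"
  assumes A: "A \<in> carrier_mat d d" and B: "B \<in> carrier_mat d d" and C: "C \<in> carrier_mat d d"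
    and c: "c > 0" "\<And>i j. i < d \<Longrightarrow> j < d \<Longrightarrow> absF (C $$ (i, j)) \<le> c"
    and e: "e > 0" "mat_close d (e / c) A B"
  shows "mat_close d e (A * C) (B * C)"
  unfolding mat_close_def
proof (intro allI impI)
  fix i j assume ij: "i < d" "j < d"
  have "(B * C) $$ (i, j) - (A * C) $$ (i, j) = (\<Sum>k<d. C $$ (k, j) * (B $$ (i, k) - A $$ (i, k)))"
    unfolding index_mult_sum[OF A C ij] index_mult_sum[OF B C ij]
    by (simp add: sum_subtractf algebra_simps)
  moreover have "absF (\<Sum>k<d. C $$ (k, j) * (B $$ (i, k) - A $$ (i, k))) < e"
  proof (rule absF_sum_less[OF _ e(1)])
    fix k assume "k \<in> {..<d}"
    then have "absF (C $$ (k, j)) \<le> c" "absF (B $$ (i, k) - A $$ (i, k)) < e / c"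
      using c e ij by (auto simp: mat_close_def dist_absF)
    then have "absF (C $$ (k, j)) * absF (B $$ (i, k) - A $$ (i, k)) \<le> c * absF (B $$ (i, k) - A $$ (i, k))"
      by (intro mult_right_mono) auto
    also have "\<dots> < c * (e / c)"
      using c \<open>absF (B $$ (i, k) - A $$ (i, k)) < e / c\<close> by (intro mult_strict_left_mono)
    finally show "absF (C $$ (k, j) * (B $$ (i, k) - A $$ (i, k))) < e"
      using c by (simp add: absF_mult)
  qed
  ultimately show "dist ((B * C) $$ (i, j)) ((A * C) $$ (i, j)) < e"
    by (simp add: dist_absF del: index_mult_mat)
qed

lemma openin_translate:
  fixes X :: "'f::padic_field mat set"
  assumes X: "X \<subseteq> carrier_mat d d" and k: "k \<in> carrier_mat d d"
    and U: "openin (group_topology (mat_group d X)) U"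
  shows "(\<And>g. g \<in> X \<Longrightarrow> k * g \<in> X) \<Longrightarrow> openin (group_topology (mat_group d X)) {g \<in> X. k * g \<in> U}"
    and "(\<And>g. g \<in> X \<Longrightarrow> g * k \<in> X) \<Longrightarrow> openin (group_topology (mat_group d X)) {g \<in> X. g * k \<in> U}"
proof -
  obtain c where c: "c > 0" "\<And>i j. i < d \<Longrightarrow> j < d \<Longrightarrow> absF (k $$ (i, j)) \<le> c"
    using entries_bounded by blast
  have U': "\<exists>e>0. \<forall>h\<in>X. mat_close d e g h \<longrightarrow> h \<in> U" if "g \<in> U" for g
    using U that unfolding openin_group_topology[OF X] by blast
  show "openin (group_topology (mat_group d X)) {g \<in> X. k * g \<in> U}" if kX: "\<And>g. g \<in> X \<Longrightarrow> k * g \<in> X"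
    unfolding openin_group_topology[OF X]
  proof (intro conjI ballI)
    fix g assume g: "g \<in> {g \<in> X. k * g \<in> U}"
    then obtain e where e: "e > 0" "\<forall>h\<in>X. mat_close d e (k * g) h \<longrightarrow> h \<in> U"
      using U' by blast
    have "h \<in> {g \<in> X. k * g \<in> U}" if "h \<in> X" "mat_close d (e / c) g h" for h
      using mat_close_mult_left[OF _ _ k c e(1) that(2)] g that X kX e(2) by blast
    then show "\<exists>e>0. \<forall>h\<in>X. mat_close d e g h \<longrightarrow> h \<in> {g \<in> X. k * g \<in> U}"
      using e c by (intro exI[of _ "e / c"]) auto
  qed auto
  show "openin (group_topology (mat_group d X)) {g \<in> X. g * k \<in> U}" if kX: "\<And>g. g \<in> X \<Longrightarrow> g * k \<in> X"
    unfolding openin_group_topology[OF X]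
  proof (intro conjI ballI)
    fix g assume g: "g \<in> {g \<in> X. g * k \<in> U}"
    then obtain e where e: "e > 0" "\<forall>h\<in>X. mat_close d e (g * k) h \<longrightarrow> h \<in> U"
      using U' by blast
    have "h \<in> {g \<in> X. g * k \<in> U}" if "h \<in> X" "mat_close d (e / c) g h" for h
      using mat_close_mult_right[OF _ _ k c e(1) that(2)] g that X kX e(2) by blast
    then show "\<exists>e>0. \<forall>h\<in>X. mat_close d e g h \<longrightarrow> h \<in> {g \<in> X. g * k \<in> U}"
      using e c by (intro exI[of _ "e / c"]) auto
  qed auto
qed

section \<open>Open subgroups of the even orthogonal group\<close>

lemma SO_even_eq_mat_group: "SO_even r = mat_group (2 * r) (carrier (SO_even r))"
  by (simp add: SO_even_def)

lemma SO_even_subset: "carrier (SO_even r) \<subseteq> carrier_mat (2 * r) (2 * r)"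
  by (auto simp: carrier_SO_even)

lemmas openin_SO_even =
  openin_group_topology[OF SO_even_subset, folded SO_even_eq_mat_group]

lemmas openin_SO_even_translate =
  openin_translate[OF SO_even_subset, folded SO_even_eq_mat_group]

lemma SO_even_assoc:
  "a \<in> carrier (SO_even r) \<Longrightarrow> b \<in> carrier (SO_even r) \<Longrightarrow> c \<in> carrier (SO_even r) \<Longrightarrow>
    a * b * c = a * (b * c)"
  by (rule assoc_mult_mat) (rule SO_even_carrier_mat; assumption)+

lemma SO_even_one_mult: "a \<in> carrier (SO_even r) \<Longrightarrow> 1\<^sub>m (2 * r) * a = a" "a \<in> carrier (SO_even r) \<Longrightarrow> a * 1\<^sub>m (2 * r) = a"
  by (auto simp: carrier_SO_even)

text \<open>Each \<open>x \<in> S\<close> has the open neighbourhood \<open>x V\<close>, which stays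
  in \<open>S\<close>. So the openness of a stabilizer has to be checked at the identity
  only.\<close>

lemma open_subgroup_SO_even:
  assumes S: "S \<subseteq> carrier (SO_even r)" "\<And>x y. x \<in> S \<Longrightarrow> y \<in> S \<Longrightarrow> x * y \<in> S"
    and V: "openin (group_topology (SO_even r)) V" "1\<^sub>m (2 * r) \<in> V" "V \<subseteq> S"
  shows "openin (group_topology (SO_even r)) S"
proof (subst openin_subopen, intro ballI)
  fix x assume x: "x \<in> S"
  let ?T = "{g \<in> carrier (SO_even r). atr x * g \<in> V}"
  have xc: "x \<in> carrier (SO_even r)"
    using x S by blast
  have "openin (group_topology (SO_even r)) ?T"
    using SO_even_atr(3)[OF xc] V(1) by (intro openin_SO_even_translate SO_even_mult_closed SO_even_carrier_mat)
  moreover have "x \<in> ?T"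
    using SO_even_atr[OF xc] xc V by simp
  moreover have "?T \<subseteq> S"
  proof
    fix g assume g: "g \<in> ?T"
    then have "x * (atr x * g) \<in> S"
      using S x V by blast
    moreover have "x * (atr x * g) = g"
      using SO_even_atr[OF xc] xc g by (simp flip: SO_even_assoc add: SO_even_one_mult)
    ultimately show "g \<in> S"
      by simp
  qed
  ultimately show "\<exists>T. openin (group_topology (SO_even r)) T \<and> x \<in> T \<and> T \<subseteq> S"
    by blast
qed


section \<open>Standard sections\<close>

lemma SO_even_int_iff:
  "h \<in> SO_even_int r \<longleftrightarrow> h \<in> carrier (SO_even r) \<and> (\<forall>i<2 * r. \<forall>j<2 * r. absF (h $$ (i, j)) \<le> 1)"
proof -
  have "elements_mat h \<subseteq> integers \<longleftrightarrow> (\<forall>i<2 * r. \<forall>j<2 * r. absF (h $$ (i, j)) \<le> 1)"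
    if "h \<in> carrier_mat (2 * r) (2 * r)"
  proof
    assume *: "elements_mat h \<subseteq> integers"
    show "\<forall>i<2 * r. \<forall>j<2 * r. absF (h $$ (i, j)) \<le> 1"
      using subsetD[OF * elements_matI[OF that _ _ refl]] by (simp add: integers_def)
  next
    assume "\<forall>i<2 * r. \<forall>j<2 * r. absF (h $$ (i, j)) \<le> 1"
    then show "elements_mat h \<subseteq> integers"
      using that by (auto simp: integers_def dest!: elements_matD)
  qed
  then show ?thesis
    by (auto simp: SO_even_int_def SO_even_carrier_mat)
qed

lemma SO_even_int_subset: "SO_even_int r \<subseteq> carrier (SO_even r)"
  by (auto simp: SO_even_int_iff)

lemma SO_even_int_mult:
  assumes "g \<in> SO_even_int r" "h \<in> SO_even_int r"
  shows "g * h \<in> SO_even_int r"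
  unfolding SO_even_int_iff
proof (intro conjI allI impI)
  fix i j assume ij: "i < 2 * r" "j < 2 * r"
  have c: "g \<in> carrier_mat (2 * r) (2 * r)" "h \<in> carrier_mat (2 * r) (2 * r)"
    using assms by (auto simp: SO_even_int_iff carrier_SO_even)
  show "absF ((g * h) $$ (i, j)) \<le> 1"
    unfolding index_mult_sum[OF c ij] using assms ij
    by (intro absF_sum_le) (auto simp: SO_even_int_iff absF_mult intro!: mult_le_one)
qed (use assms in \<open>auto simp: SO_even_int_iff SO_even_mult_closed\<close>)

lemma SO_even_int_atr:
  assumes "h \<in> SO_even_int r"
  shows "atr h \<in> SO_even_int r"
  using assms SO_even_atr(3)[of h r] index_atr[of h "2 * r" "2 * r"]
  by (auto simp: SO_even_int_iff SO_even_carrier_mat)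

lemma one_in_SO_even_int: "1\<^sub>m (2 * r) \<in> SO_even_int r"
  by (auto simp: SO_even_int_iff)

lemma openin_SO_even_int: "openin (group_topology (SO_even r)) (SO_even_int r)"
  unfolding openin_SO_even
\<comment> \<open>Radius 1 is enough: an entry at distance less than 1 from an integral one is
  integral.\<close>
proof (intro conjI ballI exI[of _ 1] impI)
  fix g h :: "'a mat" assume g: "g \<in> SO_even_int r" and h: "h \<in> carrier (SO_even r)" "mat_close (2 * r) 1 g h"
  have "absF (h $$ (i, j)) \<le> 1" if "i < 2 * r" "j < 2 * r" for i j
    using absF_add[of "g $$ (i, j)" "h $$ (i, j) - g $$ (i, j)"] that g h(2)
    by (force simp: SO_even_int_iff mat_close_def dist_absF)
  then show "h \<in> SO_even_int r"
    using h by (simp add: SO_even_int_iff)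
qed (auto simp: SO_even_int_iff)

lemma absF_det_le_1:
  fixes A :: "'f::padic_field mat"
  assumes A: "A \<in> carrier_mat d d" and int: "\<And>i j. i < d \<Longrightarrow> j < d \<Longrightarrow> absF (A $$ (i, j)) \<le> 1"
  shows "absF (det A) \<le> 1"
  unfolding det_def'[OF A]
proof (rule absF_sum_le)
  fix p assume "p \<in> {p. p permutes {0..<d}}"
  then have "absF (\<Prod>i = 0..<d. A $$ (i, p i)) \<le> 1"
  proof -
    assume p: "p \<in> {p. p permutes {0..<d}}"
    have "absF (\<Prod>i\<in>I. A $$ (i, p i)) \<le> 1" if "finite I" "I \<subseteq> {0..<d}" for I
      using that
    proof (induction I)
      case (insert i I)
      have "p i < d"
        using p insert.prems permutes_in_image[of p "{0..<d}" i] by auto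
      then show ?case
        using insert by (auto simp: absF_mult intro!: mult_le_one int)
    qed simp
    then show ?thesis
      by auto
  qed
  then show "absF (signof p * (\<Prod>i = 0..<d. A $$ (i, p i))) \<le> 1"
    by (auto simp: absF_mult sign_def)
qed simp

lemma SO_even_int_lr:
  assumes "x \<in> SO_even_int r"
  shows "absF (det (lr r x)) \<le> 1"
  using assms by (intro absF_det_le_1[of _ r]) (auto simp: SO_even_int_iff lr_def)

section \<open>The absolute value of the Levi determinant as a function on the group\<close>

lemma nu_pos: "a \<in> carrier (GL r) \<Longrightarrow> nu a > 0"
  by (simp add: nu_def carrier_GL less_le)

lemma nu_mult: "a \<in> carrier (GL r) \<Longrightarrow> b \<in> carrier (GL r) \<Longrightarrow> nu (a * b) = nu a * nu b"
  by (auto simp: nu_def carrier_GL det_mult absF_mult)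

lemma nu_one: "nu (1\<^sub>m r :: 'f::padic_field mat) = 1"
  by (simp add: nu_def)

lemma one_in_N_Siegel: "1\<^sub>m (2 * r) \<in> N_Siegel r"
  unfolding N_Siegel_iff
  by (rule bexI[of _ "0\<^sub>m r r"]) (auto simp: mult_2 intro!: eq_matI)

lemma parabolic_quadrants:
  fixes a :: "'f::padic_field mat"
  assumes a: "a \<in> carrier (GL r)" and u: "u \<in> N_Siegel r"
  shows "ul r (m_Siegel r a * u) = a" "ll r (m_Siegel r a * u) = 0\<^sub>m r r"
    "lr r (m_Siegel r a * u) = atr (inv\<^bsub>GL r\<^esub> a)"
proof -
  obtain b where b: "b \<in> carrier_mat r r" "u = four_block_mat (1\<^sub>m r) b (0\<^sub>m r r) (1\<^sub>m r)"
    using u by (auto simp: N_Siegel_iff)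
  have a': "a \<in> carrier_mat r r" "atr (inv\<^bsub>GL r\<^esub> a) \<in> carrier_mat r r"
    using a inv_GL(1)[OF a] by (auto simp: carrier_GL)
  have "m_Siegel r a * u = four_block_mat a (a * b) (0\<^sub>m r r) (atr (inv\<^bsub>GL r\<^esub> a))"
    unfolding m_Siegel_eq[OF a] b(2) using a' b(1)
    by (subst four_block_mult) (auto simp: right_mult_zero_mat[OF a'(2)] right_mult_one_mat[OF a'(2)])
  then show "ul r (m_Siegel r a * u) = a" "ll r (m_Siegel r a * u) = 0\<^sub>m r r"
    "lr r (m_Siegel r a * u) = atr (inv\<^bsub>GL r\<^esub> a)"
    using a' mult_carrier_mat[OF a'(1) b(1)] by (auto simp: quadrant_four_block)
qed

lemma parabolic_in_SO_even:
  "a \<in> carrier (GL r) \<Longrightarrow> u \<in> N_Siegel r \<Longrightarrow> m_Siegel r a * u \<in> carrier (SO_even r)"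
  by (intro SO_even_mult_closed m_Siegel_in_SO_even N_Siegel_in_SO_even)

text \<open>Only the Levi component of the product is made explicit, as the transformation law of a
  section depends on nothing else.\<close>

lemma parabolic_mult:
  fixes a b :: "'f::padic_field mat"
  assumes a: "a \<in> carrier (GL r)" "u \<in> N_Siegel r" and b: "b \<in> carrier (GL r)" "v \<in> N_Siegel r"
  obtains w where "w \<in> N_Siegel r" "m_Siegel r a * u * (m_Siegel r b * v) = m_Siegel r (a * b) * w"
proof -
  let ?g = "m_Siegel r a * u" and ?h = "m_Siegel r b * v"
  have g: "?g \<in> carrier (SO_even r)" and h: "?h \<in> carrier (SO_even r)"
    using a b by (auto intro: parabolic_in_SO_even)
  have gh: "?g * ?h \<in> carrier_mat (2 * r) (2 * r)" "atr (?g * ?h) * (?g * ?h) = 1\<^sub>m (2 * r)"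
    using SO_even_mult_closed[OF g h] by (auto simp: carrier_SO_even)
  have c: "a \<in> carrier_mat r r" "b \<in> carrier_mat r r" "atr (inv\<^bsub>GL r\<^esub> a) \<in> carrier_mat r r"
    using a b inv_GL(1)[OF a(1)] by (auto simp: carrier_GL)
  have "ll r (?g * ?h) = 0\<^sub>m r r"
    using lower_quadrants_mult(1)[OF SO_even_carrier_mat[OF g] SO_even_carrier_mat[OF h]] c
    by (simp add: parabolic_quadrants[OF a] parabolic_quadrants[OF b] right_mult_zero_mat[OF c(3)])
  moreover have "ul r (?g * ?h) = a * b"
  proof -
    have "?g * ?h = four_block_mat (ul r ?g) (ur r ?g) (ll r ?g) (lr r ?g) *
        four_block_mat (ul r ?h) (ur r ?h) (ll r ?h) (lr r ?h)"
      by (simp only: quadrants_eq[OF SO_even_carrier_mat[OF g]] quadrants_eq[OF SO_even_carrier_mat[OF h]])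
    also have "\<dots> = four_block_mat (ul r ?g * ul r ?h + ur r ?g * ll r ?h) (ul r ?g * ur r ?h + ur r ?g * lr r ?h)
        (ll r ?g * ul r ?h + lr r ?g * ll r ?h) (ll r ?g * ur r ?h + lr r ?g * lr r ?h)"
      by (rule four_block_mult) auto
    finally have "ul r (?g * ?h) = ul r ?g * ul r ?h + ur r ?g * ll r ?h"
      by (auto simp: quadrant_four_block add_carrier_mat mult_carrier_mat[of _ r r])
    then show ?thesis
      using c by (simp add: parabolic_quadrants[OF a] parabolic_quadrants[OF b] right_mult_zero_mat[OF quadrant_carrier(2)]
        mult_carrier_mat[OF c(1,2)])
  qed
  ultimately show ?thesis
    using parabolic_decomposition(2)[OF gh] that by metis
qed

text \<open>Comparing lower right quadrants expresses the one for \<open>b\<close> as that for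
  \<open>a\<close> times the quadrant of \<open>x\<close>, whose determinant is integral. The
  quadrants of parabolic elements carry the inverses of \<open>a\<close> and \<open>b\<close>,
  whence the direction of the inequality. Used in both directions, it makes \<open>nu a\<close>
  independent of the Iwasawa decomposition.\<close>

lemma nu_le:
  fixes a b :: "'f::padic_field mat"
  assumes a: "a \<in> carrier (GL r)" "u \<in> N_Siegel r" and b: "b \<in> carrier (GL r)" "v \<in> N_Siegel r"
    and x: "x \<in> SO_even_int r" and eq: "m_Siegel r a * u * x = m_Siegel r b * v"
  shows "nu a \<le> nu b"
proof -
  have xc: "x \<in> carrier_mat (2 * r) (2 * r)"
    using x by (auto simp: SO_even_int_iff carrier_SO_even)
  have c: "atr (inv\<^bsub>GL r\<^esub> a) \<in> carrier_mat r r"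
    using inv_GL(1)[OF a(1)] by (auto simp: carrier_GL)
  have det_inv: "nu a * absF (det (atr (inv\<^bsub>GL r\<^esub> a))) = 1" if a: "a \<in> carrier (GL r)" for a :: "'f mat"
  proof -
    have "nu a * nu (inv\<^bsub>GL r\<^esub> a) = 1"
      using nu_mult[OF a inv_GL(1)[OF a]] inv_GL(3)[OF a] by (simp add: nu_one)
    then show ?thesis
      using det_atr[of "inv\<^bsub>GL r\<^esub> a" r] inv_GL(1)[OF a] by (simp add: nu_def carrier_GL)
  qed
  have "atr (inv\<^bsub>GL r\<^esub> b) = atr (inv\<^bsub>GL r\<^esub> a) * lr r x"
    using lower_quadrants_mult(2)[OF SO_even_carrier_mat[OF parabolic_in_SO_even[OF a]] xc] c
      left_add_zero_mat[OF mult_carrier_mat[OF c quadrant_carrier(4)]]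
    by (simp add: eq parabolic_quadrants[OF a] parabolic_quadrants[OF b] left_mult_zero_mat[OF quadrant_carrier(2)])
  then have "absF (det (atr (inv\<^bsub>GL r\<^esub> b))) = absF (det (atr (inv\<^bsub>GL r\<^esub> a))) * absF (det (lr r x))"
    using det_mult[OF c quadrant_carrier(4)] by (simp add: absF_mult)
  then have "absF (det (atr (inv\<^bsub>GL r\<^esub> b))) \<le> absF (det (atr (inv\<^bsub>GL r\<^esub> a)))"
    using SO_even_int_lr[OF x] by (simp add: mult_left_le)
  moreover have "absF (det (atr (inv\<^bsub>GL r\<^esub> a))) = 1 / nu a" "absF (det (atr (inv\<^bsub>GL r\<^esub> b))) = 1 / nu b"
    using det_inv[OF a(1)] det_inv[OF b(1)] nu_pos[OF a(1)] nu_pos[OF b(1)]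
    by (simp_all add: nonzero_eq_divide_eq mult.commute)
  ultimately show ?thesis
    using nu_pos[OF a(1)] nu_pos[OF b(1)] by (simp add: field_simps)
qed

lemma lower_unip_in_SO_even_int:
  assumes Y: "Y \<in> carrier_mat r r" "atr Y = - Y" "\<And>i j. i < r \<Longrightarrow> j < r \<Longrightarrow> absF (Y $$ (i, j)) \<le> 1"
  shows "lower_unip r Y \<in> SO_even_int r"
  unfolding SO_even_int_iff
  using lower_unip_in_SO_even[OF Y(1,2)] Y(1,3) by (auto simp: lower_unip_def)

lemma swap_mat_in_SO_even_int:
  assumes "Q \<subseteq> {..<r}" "even (card Q)"
  shows "swap_mat r Q \<in> SO_even_int r"
  unfolding SO_even_int_iff carrier_SO_even
  using assms by (auto simp: det_swap_mat swap_mat_orthogonal) (simp add: swap_mat_def)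

lemma iwasawa_int:
  fixes h :: "'f::padic_field mat"
  assumes "h \<in> carrier (SO_even r)"
  obtains a u k where "a \<in> carrier (GL r)" "u \<in> N_Siegel r" "k \<in> SO_even_int r" "h = m_Siegel r a * u * k"
  using iwasawa[OF assms] lower_unip_in_SO_even_int swap_mat_in_SO_even_int SO_even_int_mult by metis

text \<open>The function with value |det a| at h = m(a) u k. Its power with exponent
  \<open>s - s\<^sub>0\<close> moves a section from \<open>s\<^sub>0\<close> to \<open>s\<close>,
  and it is 1 on the integral subgroup.\<close>

definition iwasawa_nu :: "nat \<Rightarrow> 'f::padic_field mat \<Rightarrow> real" where
  "iwasawa_nu r h = nu (SOME a. a \<in> carrier (GL r) \<and>
    (\<exists>u\<in>N_Siegel r. \<exists>k\<in>SO_even_int r. h = m_Siegel r a * u * k))"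

lemma iwasawa_nu_eq:
  fixes a :: "'f::padic_field mat"
  assumes a: "a \<in> carrier (GL r)" "u \<in> N_Siegel r" and k: "k \<in> SO_even_int r"
  shows "iwasawa_nu r (m_Siegel r a * u * k) = nu a"
proof -
  define P where "P b \<longleftrightarrow> b \<in> carrier (GL r) \<and>
    (\<exists>v\<in>N_Siegel r. \<exists>l\<in>SO_even_int r. m_Siegel r a * u * k = m_Siegel r b * v * l)" for b
  have "P a"
    using assms unfolding P_def by blast
  then have "P (SOME b. P b)"
    by (rule someI)
  moreover have "nu b = nu a" if Pb: "P b" for b
  proof -
    obtain v l where b: "b \<in> carrier (GL r)" "v \<in> N_Siegel r" and l: "l \<in> SO_even_int r"
      and eq: "m_Siegel r a * u * k = m_Siegel r b * v * l"
      using Pb unfolding P_def by blast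
    have *: "x * (k * atr l) = y" if "x * k = y * l" "x \<in> carrier (SO_even r)" "y \<in> carrier (SO_even r)"
      "k \<in> SO_even_int r" "l \<in> SO_even_int r" for x y k l :: "'f mat"
    proof -
      have kl: "k \<in> carrier (SO_even r)" "l \<in> carrier (SO_even r)"
        using that by (auto simp: SO_even_int_iff)
      have "x * (k * atr l) = y * l * atr l"
        using that kl SO_even_atr(3)[OF kl(2)] by (simp flip: SO_even_assoc)
      also have "\<dots> = y"
        using that kl SO_even_atr[OF kl(2)] by (simp add: SO_even_assoc SO_even_one_mult)
      finally show ?thesis .
    qed
    have "m_Siegel r a * u * (k * atr l) = m_Siegel r b * v" "m_Siegel r b * v * (l * atr k) = m_Siegel r a * u"
      using *[OF eq] *[OF eq[symmetric]] parabolic_in_SO_even a b k l by blast+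
    then show ?thesis
      using nu_le[OF a b SO_even_int_mult[OF k SO_even_int_atr[OF l]]]
        nu_le[OF b a SO_even_int_mult[OF l SO_even_int_atr[OF k]]] by simp
  qed
  ultimately show ?thesis
    unfolding iwasawa_nu_def P_def by blast
qed

lemma iwasawa_nu_left:
  fixes a :: "'f::padic_field mat"
  assumes a: "a \<in> carrier (GL r)" "u \<in> N_Siegel r" and h: "h \<in> carrier (SO_even r)"
  shows "iwasawa_nu r (m_Siegel r a * u * h) = nu a * iwasawa_nu r h"
proof -
  obtain b v k where b: "b \<in> carrier (GL r)" "v \<in> N_Siegel r" and k: "k \<in> SO_even_int r"
    and h: "h = m_Siegel r b * v * k"
    using iwasawa_int[OF h] by blast
  obtain w where w: "w \<in> N_Siegel r" "m_Siegel r a * u * (m_Siegel r b * v) = m_Siegel r (a * b) * w"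
    using parabolic_mult[OF a b] by blast
  have "m_Siegel r a * u * h = m_Siegel r (a * b) * w * k"
    unfolding h w(2)[symmetric] using k
    using parabolic_in_SO_even[OF a] parabolic_in_SO_even[OF b]
    by (intro SO_even_assoc[symmetric]) (auto simp: SO_even_int_iff)
  then show ?thesis
    using a b k w by (simp add: iwasawa_nu_eq GL_mult_closed h nu_mult)
qed

lemma iwasawa_nu_right:
  fixes h :: "'f::padic_field mat"
  assumes h: "h \<in> carrier (SO_even r)" and k: "k \<in> SO_even_int r"
  shows "iwasawa_nu r (h * k) = iwasawa_nu r h"
proof -
  obtain b v l where b: "b \<in> carrier (GL r)" "v \<in> N_Siegel r" and l: "l \<in> SO_even_int r"
    and h: "h = m_Siegel r b * v * l"
    using iwasawa_int[OF h] by blast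
  have "h * k = m_Siegel r b * v * (l * k)"
    unfolding h using l k parabolic_in_SO_even[OF b]
    by (intro SO_even_assoc) (auto simp: SO_even_int_iff)
  then show ?thesis
    using b l k by (simp add: iwasawa_nu_eq h SO_even_int_mult)
qed

lemma iwasawa_nu_int: "k \<in> SO_even_int r \<Longrightarrow> iwasawa_nu r k = 1"
  using iwasawa_nu_eq[of "1\<^sub>m r" r "1\<^sub>m (2 * r)" k]
  by (auto simp: m_Siegel_one one_in_N_Siegel carrier_GL nu_one SO_even_int_iff carrier_SO_even)

lemma iwasawa_nu_pos: "h \<in> carrier (SO_even r) \<Longrightarrow> iwasawa_nu r h > 0"
  using iwasawa_int iwasawa_nu_eq nu_pos by metis

section \<open>Existence and uniqueness of standard sections\<close>

lemma induced_space_equivariant: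
  assumes "\<xi> \<in> induced_space r sc \<tau> s" "a \<in> carrier (GL r)" "u \<in> N_Siegel r" "h \<in> carrier (SO_even r)"
  shows "\<xi> (m_Siegel r a * u * h) =
    sc (complex_of_real (sqrt (delta_Siegel r a)) * complex_of_real (nu a) powr (s - 1 / 2)) (\<tau> a (\<xi> h))"
  using assms unfolding induced_space_def by blast

lemma standard_section_in_induced_space:
  fixes \<tau> :: "'f::padic_field mat \<Rightarrow> 'w::ab_group_add \<Rightarrow> 'w"
  assumes rep: "smooth_representation sc (GL r) \<tau>" and \<xi>: "\<xi> \<in> induced_space r sc \<tau> s\<^sub>0"
  shows "standard_section r sc \<tau> \<xi> s \<in> induced_space r sc \<tau> s"
proof -
  interpret smooth_representation sc "GL r" \<tau>
    by (rule rep)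
  let ?H = "carrier (SO_even r) :: 'f mat set"
  \<comment> \<open>The explicit standard section: the scalar factor is 1 on the integral subgroup,
    and its behaviour under the parabolic shifts the exponent from \<open>s\<^sub>0\<close> to
    \<open>s\<close>.\<close>
  define \<eta> where "\<eta> = (\<lambda>h\<in>?H. sc (complex_of_real (iwasawa_nu r h) powr (s - s\<^sub>0)) (\<xi> h))"
  have "\<eta> \<in> induced_space r sc \<tau> s"
    unfolding induced_space_def
  proof (intro CollectI conjI ballI)
    show "\<eta> \<in> extensional ?H"
      by (simp add: \<eta>_def)
  next
    let ?S = "{k \<in> ?H. \<forall>h\<in>?H. \<eta> (h * k) = \<eta> h}"
    \<comment> \<open>Right translations by the integral subgroup fix the scalar factor, those by
      the open stabilizer fix \<open>\<xi>\<close>.\<close>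
    let ?V = "SO_even_int r \<inter> {k \<in> ?H. \<forall>h\<in>?H. \<xi> (h * k) = \<xi> h}"
    show "openin (group_topology (SO_even r)) ?S"
    proof (rule open_subgroup_SO_even)
      show "openin (group_topology (SO_even r)) ?V"
        using \<xi> openin_SO_even_int by (intro openin_Int) (auto simp: induced_space_def)
      show "x * y \<in> ?S" if "x \<in> ?S" "y \<in> ?S" for x y
        using that by (auto simp: SO_even_mult_closed simp flip: SO_even_assoc)
      show "?V \<subseteq> ?S"
        by (auto simp: \<eta>_def SO_even_mult_closed iwasawa_nu_right)
    qed (auto simp: one_in_SO_even_int SO_even_one_mult)
  next
    fix a u h :: "'f mat" assume a: "a \<in> carrier (GL r)" "u \<in> N_Siegel r" and h: "h \<in> ?H"
    have pos: "nu a > 0" "iwasawa_nu r h > 0"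
      using nu_pos[OF a(1)] iwasawa_nu_pos[OF h] by auto
    define c where "c = complex_of_real (iwasawa_nu r h) powr (s - s\<^sub>0)"
    have "m_Siegel r a * u * h \<in> ?H"
      by (intro SO_even_mult_closed[OF parabolic_in_SO_even] a h)
    then have "\<eta> (m_Siegel r a * u * h) =
        sc (complex_of_real (nu a * iwasawa_nu r h) powr (s - s\<^sub>0)) (\<xi> (m_Siegel r a * u * h))"
      by (simp add: \<eta>_def iwasawa_nu_left[OF a h])
    \<comment> \<open>Complex powers with the principal branch are multiplicative here because both
      bases are positive reals.\<close>
    also have "complex_of_real (nu a * iwasawa_nu r h) powr (s - s\<^sub>0) = complex_of_real (nu a) powr (s - s\<^sub>0) * c"
      unfolding c_def of_real_mult using pos by (intro powr_times_real) auto
    also have "sc (complex_of_real (nu a) powr (s - s\<^sub>0) * c) (\<xi> (m_Siegel r a * u * h)) =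
        sc (complex_of_real (nu a) powr (s - s\<^sub>0) * c * (complex_of_real (sqrt (delta_Siegel r a)) * complex_of_real (nu a) powr (s\<^sub>0 - 1 / 2))) (\<tau> a (\<xi> h))"
      using induced_space_equivariant[OF \<xi> a h] by simp
    also have "complex_of_real (nu a) powr (s - s\<^sub>0) * c * (complex_of_real (sqrt (delta_Siegel r a)) * complex_of_real (nu a) powr (s\<^sub>0 - 1 / 2))
        = complex_of_real (sqrt (delta_Siegel r a)) * (complex_of_real (nu a) powr ((s - s\<^sub>0) + (s\<^sub>0 - 1 / 2))) * c"
      by (simp only: powr_add mult_ac)
    also have "(s - s\<^sub>0) + (s\<^sub>0 - 1 / 2) = s - 1 / 2"
      by simp
    also have "sc (complex_of_real (sqrt (delta_Siegel r a)) * complex_of_real (nu a) powr (s - 1 / 2) * c) (\<tau> a (\<xi> h)) =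
        sc (complex_of_real (sqrt (delta_Siegel r a)) * complex_of_real (nu a) powr (s - 1 / 2)) (\<tau> a (sc c (\<xi> h)))"
      using module_hom.scale[OF module_hom_iff_linear[THEN iffD2, OF rep_linear[OF a(1)]]] by simp
    also have "sc c (\<xi> h) = \<eta> h"
      using h by (simp add: \<eta>_def c_def)
    finally show "\<eta> (m_Siegel r a * u * h) =
        sc (complex_of_real (sqrt (delta_Siegel r a)) * complex_of_real (nu a) powr (s - 1 / 2)) (\<tau> a (\<eta> h))" .
  qed
  moreover have "\<eta> k = \<xi> k" if "k \<in> SO_even_int r" for k
    using that SO_even_int_subset by (auto simp: \<eta>_def iwasawa_nu_int)
  \<comment> \<open>By the Iwasawa decomposition and equivariance, the values on the integral
    subgroup determine the section. This makes the definite description in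
    \<open>standard_section\<close> meaningful.\<close>
  moreover have "\<zeta> = \<eta>" if \<zeta>: "\<zeta> \<in> induced_space r sc \<tau> s" "\<forall>k\<in>SO_even_int r. \<zeta> k = \<xi> k"
    and \<eta>: "\<eta> \<in> induced_space r sc \<tau> s" "\<forall>k\<in>SO_even_int r. \<eta> k = \<xi> k" for \<zeta> \<eta>
  proof (rule extensionalityI)
    show "\<zeta> \<in> extensional ?H" "\<eta> \<in> extensional ?H"
      using \<zeta> \<eta> by (auto simp: induced_space_def)
    fix h assume "h \<in> ?H"
    then obtain a u k where k: "a \<in> carrier (GL r)" "u \<in> N_Siegel r" "k \<in> SO_even_int r" "h = m_Siegel r a * u * k"
      using iwasawa_int by blast
    then have "k \<in> ?H"
      by (simp add: SO_even_int_iff)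
    then show "\<zeta> h = \<eta> h"
      using \<zeta> \<eta> k by (simp add: induced_space_equivariant[OF \<zeta>(1)] induced_space_equivariant[OF \<eta>(1)])
  qed
  ultimately show ?thesis
    unfolding standard_section_def
    by (intro theI2[where Q = "\<lambda>\<eta>. \<eta> \<in> induced_space r sc \<tau> s"]) auto
qed


section \<open>Embeddings\<close>

text \<open>\<open>h\<close> sits on the \<open>r + r\<close> outer coordinates and \<open>M\<close>
  on the middle ones. With the identity in the middle this is the embedding of H_r into G_n for
  \<open>N = 2 * n + 1\<close> and into H_n for \<open>N = 2 * n\<close>; with forms in both places
  it is the form of G_n.\<close>

definition blk :: "nat \<Rightarrow> nat \<Rightarrow> 'a::zero mat \<Rightarrow> 'a mat \<Rightarrow> 'a mat" where
  "blk N r h M = (let outer = (\<lambda>i. i < r \<or> N - r \<le> i); idx = (\<lambda>i. if i < r then i else i - (N - 2 * r))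
    in mat N N (\<lambda>(i, j). if outer i \<and> outer j then h $$ (idx i, idx j)
        else if \<not> outer i \<and> \<not> outer j then M $$ (i - r, j - r) else 0))"

definition outer_idx :: "nat \<Rightarrow> nat \<Rightarrow> nat \<Rightarrow> bool" where
  "outer_idx N r i \<longleftrightarrow> i < r \<or> N - r \<le> i"

definition blk_idx :: "nat \<Rightarrow> nat \<Rightarrow> nat \<Rightarrow> nat" where
  "blk_idx N r i = (if i < r then i else i - (N - 2 * r))"

lemma index_blk:
  "i < N \<Longrightarrow> j < N \<Longrightarrow> blk N r h M $$ (i, j) =
    (if outer_idx N r i \<and> outer_idx N r j then h $$ (blk_idx N r i, blk_idx N r j)
     else if \<not> outer_idx N r i \<and> \<not> outer_idx N r j then M $$ (i - r, j - r) else 0)"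
  by (simp add: blk_def Let_def outer_idx_def blk_idx_def)

lemma blk_idx_less: "2 * r \<le> N \<Longrightarrow> i < N \<Longrightarrow> outer_idx N r i \<Longrightarrow> blk_idx N r i < 2 * r"
  by (auto simp: outer_idx_def blk_idx_def)

lemma inner_idx_less: "2 * r \<le> N \<Longrightarrow> \<not> outer_idx N r i \<Longrightarrow> i - r < N - 2 * r"
  by (auto simp: outer_idx_def)

lemma blk_idx_eq_iff:
  "2 * r \<le> N \<Longrightarrow> outer_idx N r i \<Longrightarrow> outer_idx N r j \<Longrightarrow> blk_idx N r i = blk_idx N r j \<longleftrightarrow> i = j"
  by (auto simp: outer_idx_def blk_idx_def)

lemma inner_idx_eq_iff:
  "\<not> outer_idx N r i \<Longrightarrow> \<not> outer_idx N r j \<Longrightarrow> i - r = j - r \<longleftrightarrow> i = j"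
  by (auto simp: outer_idx_def)

lemma outer_idx_opposite:
  assumes "2 * r \<le> N" "i < N"
  shows "outer_idx N r (N - 1 - i) \<longleftrightarrow> outer_idx N r i"
    and "outer_idx N r i \<Longrightarrow> blk_idx N r (N - 1 - i) = 2 * r - 1 - blk_idx N r i"
    and "\<not> outer_idx N r i \<Longrightarrow> N - 1 - i - r = N - 2 * r - 1 - (i - r)"
  using assms by (auto simp: outer_idx_def blk_idx_def)

text \<open>Moves the outer indices to the front, so that \<open>blk\<close> becomes an ordinary
  block diagonal matrix up to a simultaneous permutation of rows and columns.\<close>

definition blk_perm :: "nat \<Rightarrow> nat \<Rightarrow> nat \<Rightarrow> nat" where
  "blk_perm N r i = (if i < r then i else if i < N - r then i + r else if i < N then i - (N - 2 * r) else i)"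

lemma blk_carrier [simp, intro]: "blk N r h M \<in> carrier_mat N N"
  by (simp add: blk_def Let_def)

lemma dim_blk [simp]: "dim_row (blk N r h M) = N" "dim_col (blk N r h M) = N"
  by (simp_all add: blk_def Let_def)

lemma blk_perm_permutes:
  assumes "2 * r \<le> N"
  shows "blk_perm N r permutes {0..<N}"
proof (rule bij_imp_permutes)
  have "inj_on (blk_perm N r) {0..<N}"
    using assms by (auto simp: inj_on_def blk_perm_def split: if_splits)
  moreover have "blk_perm N r ` {0..<N} \<subseteq> {0..<N}"
    using assms by (auto simp: blk_perm_def)
  ultimately show "bij_betw (blk_perm N r) {0..<N} {0..<N}"
    by (simp add: bij_betw_def endo_inj_surj)
qed (use assms in \<open>auto simp: blk_perm_def\<close>)

lemma blk_eq_permuted: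
  assumes rN: "2 * r \<le> N" and h: "h \<in> carrier_mat (2 * r) (2 * r)" and M: "M \<in> carrier_mat (N - 2 * r) (N - 2 * r)"
  shows "blk N r h M = mat N N (\<lambda>(i, j).
    four_block_mat h (0\<^sub>m (2 * r) (N - 2 * r)) (0\<^sub>m (N - 2 * r) (2 * r)) M $$ (blk_perm N r i, blk_perm N r j))"
    (is "_ = mat N N (\<lambda>(i, j). ?F $$ _)")
proof (rule eq_matI)
  fix i j assume "i < dim_row (mat N N (\<lambda>(i, j). ?F $$ (blk_perm N r i, blk_perm N r j)))"
    "j < dim_col (mat N N (\<lambda>(i, j). ?F $$ (blk_perm N r i, blk_perm N r j)))"
  then have ij: "i < N" "j < N"
    by auto
  have b: "outer_idx N r k \<Longrightarrow> blk_perm N r k = blk_idx N r k \<and> blk_perm N r k < 2 * r"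
    "\<not> outer_idx N r k \<Longrightarrow> blk_perm N r k - 2 * r = k - r \<and> \<not> blk_perm N r k < 2 * r \<and> blk_perm N r k < N"
    if "k < N" for k
    using rN that by (auto simp: outer_idx_def blk_idx_def blk_perm_def)
  have "blk N r h M $$ (i, j) = ?F $$ (blk_perm N r i, blk_perm N r j)"
    unfolding index_blk[OF ij] using b[OF ij(1)] b[OF ij(2)] h M rN
    by (cases "outer_idx N r i"; cases "outer_idx N r j") auto
  then show "blk N r h M $$ (i, j) = mat N N (\<lambda>(i, j). ?F $$ (blk_perm N r i, blk_perm N r j)) $$ (i, j)"
    using ij by simp
qed auto

lemma blk_mult:
  fixes h h' M M' :: "'a::comm_ring_1 mat"
  assumes rN: "2 * r \<le> N" and h: "h \<in> carrier_mat (2 * r) (2 * r)" "h' \<in> carrier_mat (2 * r) (2 * r)"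
    and M: "M \<in> carrier_mat (N - 2 * r) (N - 2 * r)" "M' \<in> carrier_mat (N - 2 * r) (N - 2 * r)"
  shows "blk N r h M * blk N r h' M' = blk N r (h * h') (M * M')"
proof (rule eq_matI)
  let ?s = "blk_perm N r" and ?z = "0\<^sub>m (2 * r) (N - 2 * r) :: 'a mat" and ?z' = "0\<^sub>m (N - 2 * r) (2 * r) :: 'a mat"
  define F F' where "F = four_block_mat h ?z ?z' M" and "F' = four_block_mat h' ?z ?z' M'"
  have F: "F \<in> carrier_mat N N" "F' \<in> carrier_mat N N"
    using rN h M by (auto simp: F_def F'_def)
  have FF: "F * F' = four_block_mat (h * h') ?z ?z' (M * M')"
    unfolding F_def F'_def using h M
    by (subst mult_four_block_mat[OF h(1) _ _ M(1) h(2) _ _ M(2)]) auto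
  fix i j assume "i < dim_row (blk N r (h * h') (M * M'))" "j < dim_col (blk N r (h * h') (M * M'))"
  then have ij: "i < N" "j < N"
    by auto
  have bij: "bij_betw ?s {..<N} {..<N}"
    using permutes_imp_bij[OF blk_perm_permutes[OF rN]] by (simp add: lessThan_atLeast0)
  have sij: "?s i < N" "?s j < N"
    using bij_betwE[OF bij] ij by auto
  have e: "blk N r h M $$ (k, l) = F $$ (?s k, ?s l)" "blk N r h' M' $$ (k, l) = F' $$ (?s k, ?s l)"
    if "k < N" "l < N" for k l
    unfolding F_def F'_def blk_eq_permuted[OF rN h(1) M(1)] blk_eq_permuted[OF rN h(2) M(2)]
    using that by auto
  have "(blk N r h M * blk N r h' M') $$ (i, j) = (\<Sum>k<N. F $$ (?s i, ?s k) * F' $$ (?s k, ?s j))"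
    unfolding index_mult_sum[OF blk_carrier blk_carrier ij]
    by (rule sum.cong) (use ij in \<open>auto simp: e\<close>)
  also have "\<dots> = (\<Sum>k<N. F $$ (?s i, k) * F' $$ (k, ?s j))"
    by (rule sum.reindex_bij_betw[OF bij])
  also have "\<dots> = (F * F') $$ (?s i, ?s j)"
    by (rule index_mult_sum[OF F sij, symmetric])
  also have "\<dots> = blk N r (h * h') (M * M') $$ (i, j)"
    unfolding FF using ij h M by (subst blk_eq_permuted[OF rN]) auto
  finally show "(blk N r h M * blk N r h' M') $$ (i, j) = blk N r (h * h') (M * M') $$ (i, j)" .
qed auto

text \<open>Rows and columns undergo the same permutation, so its sign occurs twice.\<close>

lemma det_blk:
  fixes h M :: "'a::idom mat"
  assumes rN: "2 * r \<le> N" and h: "h \<in> carrier_mat (2 * r) (2 * r)" and M: "M \<in> carrier_mat (N - 2 * r) (N - 2 * r)"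
  shows "det (blk N r h M) = det h * det M"
proof -
  let ?s = "blk_perm N r"
  define F where "F = four_block_mat h (0\<^sub>m (2 * r) (N - 2 * r)) (0\<^sub>m (N - 2 * r) (2 * r)) M"
  have F: "F \<in> carrier_mat N N"
    using rN h M by (auto simp: F_def)
  note p = blk_perm_permutes[OF rN]
  define G where "G = mat N N (\<lambda>(i, j). F $$ (?s i, j))"
  have G: "G \<in> carrier_mat N N"
    by (simp add: G_def)
  have lt: "?s i < N" if "i < N" for i
    using permutes_in_image[OF p, of i] that by simp
  have "blk N r h M = transpose_mat (mat N N (\<lambda>(i, j). transpose_mat G $$ (?s i, j)))"
    unfolding blk_eq_permuted[OF rN h M] F_def[symmetric]
    by (rule eq_matI) (auto simp: G_def lt)
  then have "det (blk N r h M) = det (mat N N (\<lambda>(i, j). transpose_mat G $$ (?s i, j)))"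
    by (simp add: det_transpose[of _ N])
  also have "\<dots> = signof ?s * (signof ?s * det F)"
    using det_permute_rows[OF transpose_carrier_mat[THEN iffD2, OF G] p] det_permute_rows[OF F p] det_transpose[OF G]
    by (simp add: G_def)
  also have "\<dots> = det F"
    by (simp add: sign_def)
  also have "\<dots> = det h * det M"
    unfolding F_def by (rule det_four_block_mat_lower_left_zero[OF h zero_carrier_mat refl M])
  finally show ?thesis .
qed

lemma transpose_blk:
  assumes rN: "2 * r \<le> N" and h: "h \<in> carrier_mat (2 * r) (2 * r)" and M: "M \<in> carrier_mat (N - 2 * r) (N - 2 * r)"
  shows "transpose_mat (blk N r h M) = blk N r (transpose_mat h) (transpose_mat M)"
  by (rule eq_matI) (use assms in \<open>auto simp: index_blk blk_idx_less inner_idx_less\<close>)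

lemma blk_one:
  assumes "2 * r \<le> N"
  shows "blk N r (1\<^sub>m (2 * r)) (1\<^sub>m (N - 2 * r)) = 1\<^sub>m N"
  by (rule eq_matI)
    (use assms in \<open>auto simp: index_blk blk_idx_less inner_idx_less blk_idx_eq_iff inner_idx_eq_iff\<close>)

section \<open>The embeddings of H_r into H_n and G_n\<close>

lemma embed_SO_eq_blk:
  assumes "r \<le> n"
  shows "embed_SO n r h = blk (2 * n + 1) r h (1\<^sub>m (2 * (n - r) + 1))"
  by (rule eq_matI) (use assms in \<open>auto simp: blk_def embed_SO_def Let_def\<close>)

text \<open>The space is the orthogonal sum of the split space on the outer coordinates and the odd
  space of dimension \<open>2 * (n - r) + 1\<close>. Block multiplication then shows that embedded
  elements lie in G_n.\<close>

lemma S_form_eq_blk: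
  assumes "r \<le> n"
  shows "S_form n = (blk (2 * n + 1) r (antidiag (2 * r)) (S_form (n - r)) :: 'f::padic_field mat)"
proof (rule eq_matI)
  fix i j assume "i < dim_row (blk (2 * n + 1) r (antidiag (2 * r)) (S_form (n - r)) :: 'f mat)"
    "j < dim_col (blk (2 * n + 1) r (antidiag (2 * r)) (S_form (n - r)) :: 'f mat)"
  then have ij: "i < 2 * n + 1" "j < 2 * n + 1"
    by auto
  let ?o = "outer_idx (2 * n + 1) r" and ?b = "blk_idx (2 * n + 1) r"
  have mid: "\<not> ?o n"
    using assms by (auto simp: outer_idx_def)
  have 1: "?o i \<Longrightarrow> ?o j \<Longrightarrow> ?b i + ?b j + 1 = 2 * r \<longleftrightarrow> i + j = 2 * n"
    "\<not> ?o i \<Longrightarrow> \<not> ?o j \<Longrightarrow> (i - r) + (j - r) = 2 * (n - r) \<longleftrightarrow> i + j = 2 * n"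
    "?o i \<noteq> ?o j \<Longrightarrow> i + j \<noteq> 2 * n" "\<not> ?o i \<Longrightarrow> i - r = n - r \<longleftrightarrow> i = n"
    using ij assms by (auto simp: outer_idx_def blk_idx_def)
  have 2: "?o i \<Longrightarrow> ?b i < 2 * r" "?o j \<Longrightarrow> ?b j < 2 * r"
    "\<not> ?o i \<Longrightarrow> i - r < 2 * (n - r) + 1" "\<not> ?o j \<Longrightarrow> j - r < 2 * (n - r) + 1"
    using ij assms by (auto simp: outer_idx_def blk_idx_def)
  show "S_form n $$ (i, j) = (blk (2 * n + 1) r (antidiag (2 * r)) (S_form (n - r)) :: 'f mat) $$ (i, j)"
  proof (cases "?o i"; cases "?o j")
    assume *: "?o i" "?o j"
    then have "i \<noteq> n"
      using mid by auto
    then show ?thesis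
      unfolding index_blk[OF ij] using * 1(1) 2 ij by (simp add: S_form_def antidiag_def)
  next
    assume *: "\<not> ?o i" "\<not> ?o j"
    then show ?thesis
      unfolding index_blk[OF ij] using 1(2,4) 2 ij by (simp add: S_form_def)
  qed (unfold index_blk[OF ij], use 1(3) ij in \<open>simp_all add: S_form_def\<close>)
qed (auto simp: S_form_def)

lemma S_form_carrier [simp]: "S_form n \<in> carrier_mat (2 * n + 1) (2 * n + 1)"
  by (simp add: S_form_def)

lemma carrier_SO_odd:
  "g \<in> carrier (SO_odd n) \<longleftrightarrow> g \<in> carrier_mat (2 * n + 1) (2 * n + 1) \<and> det g = 1 \<and>
    transpose_mat g * S_form n * g = S_form n"
  by (simp add: SO_odd_def)

lemma mult_SO_odd [simp]: "mult (SO_odd n) = (*)" and one_SO_odd [simp]: "\<one>\<^bsub>SO_odd n\<^esub> = 1\<^sub>m (2 * n + 1)"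
  by (simp_all add: SO_odd_def)

lemma embed_SO_carrier [simp, intro]: "embed_SO n r h \<in> carrier_mat (2 * n + 1) (2 * n + 1)"
  by (simp add: embed_SO_def Let_def)

lemma embed_SO_mult:
  fixes g h :: "'f::padic_field mat"
  assumes "r \<le> n" "g \<in> carrier_mat (2 * r) (2 * r)" "h \<in> carrier_mat (2 * r) (2 * r)"
  shows "embed_SO n r (g * h) = embed_SO n r g * embed_SO n r h"
proof -
  have e: "2 * n + 1 - 2 * r = 2 * (n - r) + 1"
    using assms by simp
  show ?thesis
    unfolding embed_SO_eq_blk[OF assms(1)] using assms
    by (subst blk_mult) (auto simp: e)
qed

lemma embed_SO_one: "r \<le> n \<Longrightarrow> embed_SO n r (1\<^sub>m (2 * r)) = 1\<^sub>m (2 * n + 1)"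
  using blk_one[of r "2 * n + 1"] by (simp add: embed_SO_eq_blk Suc_diff_le diff_mult_distrib2)

lemma embed_SO_in_SO_odd:
  fixes h :: "'f::padic_field mat"
  assumes r: "r \<le> n" and h: "h \<in> carrier (SO_even r)"
  shows "embed_SO n r h \<in> carrier (SO_odd n)"
proof -
  have e: "2 * n + 1 - 2 * r = 2 * (n - r) + 1" "2 * r \<le> 2 * n + 1"
    using r by auto
  have h': "h \<in> carrier_mat (2 * r) (2 * r)" "det h = 1"
    "transpose_mat h * antidiag (2 * r) * h = antidiag (2 * r)"
    using h orthogonal_iff by (auto simp: carrier_SO_even)
  have c: "transpose_mat h \<in> carrier_mat (2 * r) (2 * r)"
    "1\<^sub>m (2 * (n - r) + 1) \<in> carrier_mat (2 * n + 1 - 2 * r) (2 * n + 1 - 2 * r)"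
    "S_form (n - r) \<in> carrier_mat (2 * n + 1 - 2 * r) (2 * n + 1 - 2 * r)"
    using h'(1) unfolding e(1) by (auto simp del: One_nat_def)
  have "transpose_mat (embed_SO n r h) * S_form n * embed_SO n r h =
      blk (2 * n + 1) r (transpose_mat h * antidiag (2 * r) * h)
        (1\<^sub>m (2 * (n - r) + 1) * S_form (n - r) * 1\<^sub>m (2 * (n - r) + 1))"
    unfolding embed_SO_eq_blk[OF r] S_form_eq_blk[OF r] transpose_blk[OF e(2) h'(1) c(2)] transpose_one
      blk_mult[OF e(2) c(1) antidiag_carrier c(2,3)]
    by (rule blk_mult[OF e(2) mult_carrier_mat[OF c(1) antidiag_carrier] h'(1) mult_carrier_mat[OF c(2,3)] c(2)])
  also have "1\<^sub>m (2 * (n - r) + 1) * S_form (n - r) * 1\<^sub>m (2 * (n - r) + 1) = (S_form (n - r) :: 'f mat)"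
    by (simp only: left_mult_one_mat[OF S_form_carrier] right_mult_one_mat[OF S_form_carrier])
  finally have "transpose_mat (embed_SO n r h) * S_form n * embed_SO n r h =
      blk (2 * n + 1) r (transpose_mat h * antidiag (2 * r) * h) (S_form (n - r))" .
  moreover have "det (embed_SO n r h) = 1"
    unfolding embed_SO_eq_blk[OF r] using h' e by (subst det_blk) auto
  ultimately show ?thesis
    unfolding carrier_SO_odd h'(3) S_form_eq_blk[OF r, symmetric] by (intro conjI embed_SO_carrier)
qed

text \<open>The embedding factors through H_n. So the Levi and unipotent elements of H_r and the
  group of the matrices \<open>X_bar_mat n r x\<close> can be multiplied with each other inside the
  Siegel parabolic of H_n.\<close>

lemma embed_SO_trans:
  assumes "r \<le> n"
  shows "embed_SO n n (blk (2 * n) r h (1\<^sub>m (2 * (n - r)))) = embed_SO n r h"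
proof (rule eq_matI)
  fix i j assume "i < dim_row (embed_SO n r h)" "j < dim_col (embed_SO n r h)"
  then have ij: "i < 2 * n + 1" "j < 2 * n + 1"
    by (auto simp: embed_SO_def Let_def)
  let ?L = "embed_SO n n (blk (2 * n) r h (1\<^sub>m (2 * (n - r))))"
  define di dj where "di = (if i < n then i else i - 1)" and "dj = (if j < n then j else j - 1)"
  show "?L $$ (i, j) = embed_SO n r h $$ (i, j)"
  proof (cases "i = n \<or> j = n")
    case True
    then show ?thesis
      using ij assms by (auto simp: embed_SO_def Let_def)
  next
    case False
    then have d: "di < 2 * n" "dj < 2 * n"
      using ij by (auto simp: di_def dj_def)
    have "?L $$ (i, j) = blk (2 * n) r h (1\<^sub>m (2 * (n - r))) $$ (di, dj)"
      using ij False by (auto simp: embed_SO_def Let_def di_def dj_def)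
    moreover have "di < r \<longleftrightarrow> i < r" "dj < r \<longleftrightarrow> j < r" "2 * n - r \<le> di \<longleftrightarrow> 2 * n + 1 - r \<le> i"
      "2 * n - r \<le> dj \<longleftrightarrow> 2 * n + 1 - r \<le> j" "di = dj \<longleftrightarrow> i = j"
      using False assms by (auto simp: di_def dj_def)
    moreover have "2 * n + 1 - r \<le> i \<Longrightarrow> di - (2 * n - 2 * r) = i - (2 * n + 1 - 2 * r)"
      "2 * n + 1 - r \<le> j \<Longrightarrow> dj - (2 * n - 2 * r) = j - (2 * n + 1 - 2 * r)"
      "i < r \<Longrightarrow> di = i" "j < r \<Longrightarrow> dj = j"
      using False assms by (auto simp: di_def dj_def)
    ultimately show ?thesis
      using d ij assms by (auto simp: embed_SO_def blk_def Let_def)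
  qed
qed (auto simp: embed_SO_def Let_def)

lemma blk_four_block:
  fixes a :: "'a::zero_neq_one mat"
  assumes r: "r \<le> n" and c: "a \<in> carrier_mat r r" "b \<in> carrier_mat r r" "c \<in> carrier_mat r r" "d \<in> carrier_mat r r"
  shows "blk (2 * n) r (four_block_mat a b c d) (1\<^sub>m (2 * (n - r))) = four_block_mat
    (four_block_mat a (0\<^sub>m r (n - r)) (0\<^sub>m (n - r) r) (1\<^sub>m (n - r)))
    (four_block_mat (0\<^sub>m r (n - r)) b (0\<^sub>m (n - r) (n - r)) (0\<^sub>m (n - r) r))
    (four_block_mat (0\<^sub>m (n - r) r) (0\<^sub>m (n - r) (n - r)) c (0\<^sub>m r (n - r)))
    (four_block_mat (1\<^sub>m (n - r)) (0\<^sub>m (n - r) r) (0\<^sub>m r (n - r)) d)"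
    (is "?L = ?R")
proof (rule eq_matI)
  fix i j assume "i < dim_row ?R" "j < dim_col ?R"
  then have ij: "i < 2 * n" "j < 2 * n"
    using c r by auto
  obtain p where n: "n = r + p"
    using r le_Suc_ex by blast
  let ?o = "outer_idx (2 * n) r" and ?b = "blk_idx (2 * n) r"
  have lo: "?o k \<longleftrightarrow> k < r" "k < r \<Longrightarrow> ?b k = k" if "k < n" for k
    using that by (auto simp: outer_idx_def blk_idx_def n)
  have hi: "?o (n + k) \<longleftrightarrow> \<not> k < p" "\<not> k < p \<Longrightarrow> ?b (n + k) = r + (k - p)" "n + k - r = p + k" for k
    by (auto simp: outer_idx_def blk_idx_def n)
  have np: "n - r = p"
    by (simp add: n)
  \<comment> \<open>Indices of the second half are written as \<open>n + k\<close>, which keeps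
    truncated subtraction out of the case distinction.\<close>
  have split: "k < n \<or> (\<exists>k'<n. k = n + k')" if "k < 2 * n" for k
    using that by (metis add_less_cancel_left le_Suc_ex mult_2 not_less)
  show "?L $$ (i, j) = ?R $$ (i, j)"
    using split[OF ij(1)] split[OF ij(2)]
  proof (elim disjE exE conjE)
    assume "i < n" "j < n"
    then show ?thesis
      unfolding index_blk[OF ij] unfolding lo(1)[OF \<open>i < n\<close>] lo(1)[OF \<open>j < n\<close>] np
      using c lo(2)[of i] lo(2)[of j]
      by (cases "i < r"; cases "j < r") (auto simp: n)
  next
    fix j' assume "i < n" "j' < n" and j: "j = n + j'"
    then show ?thesis
      unfolding index_blk[OF ij] unfolding j lo(1)[OF \<open>i < n\<close>] hi(1,3) np
      using c lo(2)[of i] hi(2)[of j']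
      by (cases "i < r"; cases "j' < p") (auto simp: n not_less nat_le_iff_add)
  next
    fix i' assume "i' < n" "j < n" and i: "i = n + i'"
    then show ?thesis
      unfolding index_blk[OF ij] unfolding i lo(1)[OF \<open>j < n\<close>] hi(1,3) np
      using c lo(2)[of j] hi(2)[of i']
      by (cases "j < r"; cases "i' < p") (auto simp: n not_less nat_le_iff_add)
  next
    fix i' j' assume "i' < n" "j' < n" and i: "i = n + i'" and j: "j = n + j'"
    then show ?thesis
      unfolding index_blk[OF ij] unfolding i j hi(1,3) np
      using c hi(2)[of i'] hi(2)[of j']
      by (cases "i' < p"; cases "j' < p") (auto simp: n not_less nat_le_iff_add)
  qed
qed (use c r in auto)

lemma atr_blk:
  assumes rN: "2 * r \<le> N" and h: "h \<in> carrier_mat (2 * r) (2 * r)" and M: "M \<in> carrier_mat (N - 2 * r) (N - 2 * r)"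
  shows "atr (blk N r h M) = blk N r (atr h) (atr M)"
proof (rule eq_matI)
  fix i j assume "i < dim_row (blk N r (atr h) (atr M))" "j < dim_col (blk N r (atr h) (atr M))"
  then have ij: "i < N" "j < N"
    by auto
  have ij': "N - 1 - j < N" "N - 1 - i < N"
    using ij by auto
  show "atr (blk N r h M) $$ (i, j) = blk N r (atr h) (atr M) $$ (i, j)"
    unfolding index_atr[OF blk_carrier ij] index_blk[OF ij] index_blk[OF ij']
    using blk_idx_less[OF rN ij(1)] blk_idx_less[OF rN ij(2)] inner_idx_less[OF rN, of i] inner_idx_less[OF rN, of j]
    by (auto simp: outer_idx_opposite[OF rN ij(1)] outer_idx_opposite[OF rN ij(2)]
      index_atr[OF h] index_atr[OF M] simp del: One_nat_def diff_diff_left)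
qed auto

lemma blk_in_SO_even:
  fixes h :: "'f::padic_field mat"
  assumes r: "r \<le> n" and h: "h \<in> carrier (SO_even r)"
  shows "blk (2 * n) r h (1\<^sub>m (2 * (n - r))) \<in> carrier (SO_even n)"
proof -
  have e: "2 * n - 2 * r = 2 * (n - r)" "2 * r \<le> 2 * n"
    using r by auto
  have h': "h \<in> carrier_mat (2 * r) (2 * r)" "det h = 1" "atr h * h = 1\<^sub>m (2 * r)"
    using h by (auto simp: carrier_SO_even)
  have "atr (blk (2 * n) r h (1\<^sub>m (2 * (n - r)))) * blk (2 * n) r h (1\<^sub>m (2 * (n - r))) =
      blk (2 * n) r (1\<^sub>m (2 * r)) (1\<^sub>m (2 * (n - r)))"
    using h' by (subst atr_blk[OF e(2)], simp, simp add: e, subst blk_mult[OF e(2)]) (auto simp: e)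
  then show ?thesis
    using blk_one[OF e(2)] det_blk[OF e(2) h'(1), of "1\<^sub>m (2 * (n - r))"] h'
    by (auto simp: carrier_SO_even e)
qed

text \<open>The element of GL_n whose image under \<open>m_Siegel n\<close> is the embedded
  \<open>m_Siegel r a\<close>; \<open>lower_x\<close> below plays the same role for
  \<open>X_bar_mat n r x\<close>. Together they reduce relations in G_n to products in GL_n.\<close>

definition diag_one :: "nat \<Rightarrow> nat \<Rightarrow> 'a::zero_neq_one mat \<Rightarrow> 'a mat" where
  "diag_one n r a = four_block_mat a (0\<^sub>m r (n - r)) (0\<^sub>m (n - r) r) (1\<^sub>m (n - r))"

definition lower_x :: "nat \<Rightarrow> nat \<Rightarrow> 'a::zero_neq_one mat \<Rightarrow> 'a mat" where
  "lower_x n r x = four_block_mat (1\<^sub>m r) (0\<^sub>m r (n - r)) x (1\<^sub>m (n - r))"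

lemma diag_one_carrier: "r \<le> n \<Longrightarrow> a \<in> carrier_mat r r \<Longrightarrow> diag_one n r a \<in> carrier_mat n n"
  by (auto simp: diag_one_def)

lemma lower_x_carrier: "r \<le> n \<Longrightarrow> lower_x n r x \<in> carrier_mat n n"
  by (auto simp: lower_x_def)

lemma diag_one_GL:
  fixes a :: "'f::padic_field mat"
  assumes r: "r \<le> n" and a: "a \<in> carrier (GL r)"
  shows "diag_one n r a \<in> carrier (GL n)" "inv\<^bsub>GL n\<^esub> (diag_one n r a) = diag_one n r (inv\<^bsub>GL r\<^esub> a)"
proof -
  have c: "a \<in> carrier_mat r r" "inv\<^bsub>GL r\<^esub> a \<in> carrier_mat r r"
    using a inv_GL(1)[OF a] by (auto simp: carrier_GL)
  have "diag_one n r a * diag_one n r (inv\<^bsub>GL r\<^esub> a) = four_block_mat (1\<^sub>m r) (0\<^sub>m r (n - r)) (0\<^sub>m (n - r) r) (1\<^sub>m (n - r))"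
    unfolding diag_one_def using c inv_GL(3)[OF a]
    by (subst mult_four_block_mat[OF c(1) _ _ one_carrier_mat c(2) _ _ one_carrier_mat]) auto
  then have 1: "diag_one n r a * diag_one n r (inv\<^bsub>GL r\<^esub> a) = 1\<^sub>m n"
    using r by simp
  show "diag_one n r a \<in> carrier (GL n)"
    using mult_one_imp_det_nonzero(1)[OF diag_one_carrier[OF r c(1)] diag_one_carrier[OF r c(2)] 1]
      diag_one_carrier[OF r c(1)] by (simp add: carrier_GL)
  show "inv\<^bsub>GL n\<^esub> (diag_one n r a) = diag_one n r (inv\<^bsub>GL r\<^esub> a)"
    by (rule inv_GL_eqI[OF diag_one_carrier[OF r c(1)] diag_one_carrier[OF r c(2)] 1])
qed

lemma lower_x_mult:
  fixes x y :: "'a::comm_ring_1 mat"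
  assumes "r \<le> n" "x \<in> carrier_mat (n - r) r" "y \<in> carrier_mat (n - r) r"
  shows "lower_x n r x * lower_x n r y = lower_x n r (x + y)"
  unfolding lower_x_def using assms
  by (subst mult_four_block_mat[OF one_carrier_mat zero_carrier_mat assms(2) one_carrier_mat
        one_carrier_mat zero_carrier_mat assms(3) one_carrier_mat]) auto

lemma lower_x_zero: "r \<le> n \<Longrightarrow> lower_x n r (0\<^sub>m (n - r) r) = 1\<^sub>m n"
  by (simp add: lower_x_def)

lemma lower_x_GL:
  fixes x :: "'f::padic_field mat"
  assumes r: "r \<le> n" and x: "x \<in> carrier_mat (n - r) r"
  shows "lower_x n r x \<in> carrier (GL n)" "inv\<^bsub>GL n\<^esub> (lower_x n r x) = lower_x n r (- x)"
proof -
  have x': "- x \<in> carrier_mat (n - r) r"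
    using x by simp
  have 1: "lower_x n r x * lower_x n r (- x) = 1\<^sub>m n"
  proof -
    have "x + - x = 0\<^sub>m (n - r) r"
      using x by (intro eq_matI) auto
    then show ?thesis
      unfolding lower_x_mult[OF r x x'] by (simp add: lower_x_zero[OF r])
  qed
  show "lower_x n r x \<in> carrier (GL n)"
    using mult_one_imp_det_nonzero(1)[OF lower_x_carrier[OF r] lower_x_carrier[OF r] 1]
      lower_x_carrier[OF r] by (simp add: carrier_GL)
  show "inv\<^bsub>GL n\<^esub> (lower_x n r x) = lower_x n r (- x)"
    by (rule inv_GL_eqI[OF lower_x_carrier[OF r] lower_x_carrier[OF r] 1])
qed

text \<open>The origin of the change of variables x \<mapsto> x z in the inner integral: moving
  diag(z, 1) to the left multiplies \<open>x\<close> by \<open>z\<close> on the right.\<close>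

lemma lower_x_diag_one:
  fixes x z :: "'a::comm_ring_1 mat"
  assumes r: "r \<le> n" and x: "x \<in> carrier_mat (n - r) r" and z: "z \<in> carrier_mat r r"
  shows "lower_x n r x * diag_one n r z = diag_one n r z * lower_x n r (x * z)"
  unfolding lower_x_def diag_one_def using x z mult_carrier_mat[OF x z]
  by (simp add: mult_four_block_mat[OF one_carrier_mat zero_carrier_mat x one_carrier_mat
        z zero_carrier_mat zero_carrier_mat one_carrier_mat]
      mult_four_block_mat[OF z zero_carrier_mat zero_carrier_mat one_carrier_mat
        one_carrier_mat zero_carrier_mat mult_carrier_mat[OF x z] one_carrier_mat])

lemma blk_m_Siegel:
  fixes a :: "'f::padic_field mat"
  assumes r: "r \<le> n" and a: "a \<in> carrier (GL r)"
  shows "blk (2 * n) r (m_Siegel r a) (1\<^sub>m (2 * (n - r))) = m_Siegel n (diag_one n r a)"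
proof -
  have c: "a \<in> carrier_mat r r" "inv\<^bsub>GL r\<^esub> a \<in> carrier_mat r r" "atr (inv\<^bsub>GL r\<^esub> a) \<in> carrier_mat r r"
    using a inv_GL(1)[OF a] by (auto simp: carrier_GL)
  have z: "four_block_mat (0\<^sub>m r (n - r)) (0\<^sub>m r r) (0\<^sub>m (n - r) (n - r)) (0\<^sub>m (n - r) r) = (0\<^sub>m n n :: 'f mat)"
    "four_block_mat (0\<^sub>m (n - r) r) (0\<^sub>m (n - r) (n - r)) (0\<^sub>m r r) (0\<^sub>m r (n - r)) = (0\<^sub>m n n :: 'f mat)"
    using r by (auto intro!: eq_matI)
  have "atr (diag_one n r (inv\<^bsub>GL r\<^esub> a)) = four_block_mat (1\<^sub>m (n - r)) (0\<^sub>m (n - r) r) (0\<^sub>m r (n - r)) (atr (inv\<^bsub>GL r\<^esub> a))"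
    unfolding diag_one_def by (subst atr_four_block[OF c(2) zero_carrier_mat zero_carrier_mat one_carrier_mat]) simp
  then show ?thesis
    unfolding m_Siegel_eq[OF a] m_Siegel_eq[OF diag_one_GL(1)[OF r a]] diag_one_GL(2)[OF r a]
      blk_four_block[OF r c(1) zero_carrier_mat zero_carrier_mat c(3)] z
    by (simp add: diag_one_def)
qed

text \<open>Skewness of the enlarged block is obtained without index computations: the matrix is
  orthogonal, its lower left quadrant is zero and its upper left one is the identity, so it is a
  parabolic element with trivial Levi component.\<close>

lemma blk_N_Siegel:
  fixes u :: "'f::padic_field mat"
  assumes r: "r \<le> n" and u: "u \<in> N_Siegel r"
  shows "blk (2 * n) r u (1\<^sub>m (2 * (n - r))) \<in> N_Siegel n"
proof -
  obtain b where b: "b \<in> carrier_mat r r" "u = four_block_mat (1\<^sub>m r) b (0\<^sub>m r r) (1\<^sub>m r)"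
    using u by (auto simp: N_Siegel_iff)
  let ?g = "blk (2 * n) r u (1\<^sub>m (2 * (n - r)))"
  define B where "B = four_block_mat (0\<^sub>m r (n - r)) b (0\<^sub>m (n - r) (n - r)) (0\<^sub>m (n - r) r)"
  have B: "B \<in> carrier_mat n n"
    using r b by (auto simp: B_def)
  have "four_block_mat (0\<^sub>m (n - r) r) (0\<^sub>m (n - r) (n - r)) (0\<^sub>m r r) (0\<^sub>m r (n - r)) = (0\<^sub>m n n :: 'f mat)"
    using r by (auto intro!: eq_matI)
  moreover have "four_block_mat (1\<^sub>m (n - r)) (0\<^sub>m (n - r) r) (0\<^sub>m r (n - r)) (1\<^sub>m r) = (1\<^sub>m n :: 'f mat)"
    "four_block_mat (1\<^sub>m r) (0\<^sub>m r (n - r)) (0\<^sub>m (n - r) r) (1\<^sub>m (n - r)) = (1\<^sub>m n :: 'f mat)"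
    using r by auto
  ultimately have g: "?g = four_block_mat (1\<^sub>m n) B (0\<^sub>m n n) (1\<^sub>m n)"
    unfolding b(2) blk_four_block[OF r one_carrier_mat b(1) zero_carrier_mat one_carrier_mat] B_def by simp
  have q: "ul n ?g = 1\<^sub>m n" "ll n ?g = 0\<^sub>m n n"
    unfolding g using B by (auto simp: quadrant_four_block)
  have gc: "?g \<in> carrier_mat (2 * n) (2 * n)" "atr ?g * ?g = 1\<^sub>m (2 * n)"
    using blk_in_SO_even[OF r N_Siegel_in_SO_even[OF u]] by (auto simp: carrier_SO_even)
  obtain v where "v \<in> N_Siegel n" "?g = m_Siegel n (1\<^sub>m n) * v"
    using parabolic_decomposition(2)[OF gc q(2)] unfolding q(1) by blast
  moreover have "v \<in> carrier_mat (2 * n) (2 * n)"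
    using N_Siegel_in_SO_even[OF \<open>v \<in> N_Siegel n\<close>] by (simp add: carrier_SO_even)
  ultimately show ?thesis
    by (simp add: m_Siegel_one)
qed

lemma index_embed_SO_full:
  fixes a :: "'f::padic_field mat"
  assumes c: "a \<in> carrier_mat n n" "b \<in> carrier_mat n n" "c \<in> carrier_mat n n" "d \<in> carrier_mat n n"
    and ij: "i < 2 * n + 1" "j < 2 * n + 1"
  shows "embed_SO n n (four_block_mat a b c d) $$ (i, j) =
    (if i = n \<or> j = n then if i = j then 1 else 0
     else if i < n then if j < n then a $$ (i, j) else b $$ (i, j - (n + 1))
     else if j < n then c $$ (i - (n + 1), j) else d $$ (i - (n + 1), j - (n + 1)))"
proof -
  consider "i < n" | "i = n" | "n < i"
    by linarith
  then show ?thesis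
    by cases (use ij c in \<open>auto simp: embed_SO_def Let_def\<close>)
qed

text \<open>The block \<open>x'\<close> is the negative of \<open>atr x\<close>, which is exactly
  the lower left part of \<open>atr\<close> of the inverse of \<open>lower_x n r x\<close>. So the
  group of these matrices lies in the Siegel Levi subgroup of H_n.\<close>

lemma X_bar_mat_eq:
  fixes x :: "'f::padic_field mat"
  assumes r: "r \<le> n" and x: "x \<in> carrier_mat (n - r) r"
  shows "X_bar_mat n r x = embed_SO n n (m_Siegel n (lower_x n r x))"
proof -
  have x': "- x \<in> carrier_mat (n - r) r"
    using x by simp
  define x1 where "x1 = - atr x"
  have x1: "x1 \<in> carrier_mat r (n - r)"
    using x by (simp add: x1_def)
  have "atr (lower_x n r (- x)) = four_block_mat (1\<^sub>m (n - r)) (0\<^sub>m (n - r) r) x1 (1\<^sub>m r)"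
    unfolding lower_x_def x1_def using r
    by (subst atr_four_block[OF one_carrier_mat zero_carrier_mat x' one_carrier_mat]) (simp add: atr_uminus)
  then have m: "m_Siegel n (lower_x n r x) = four_block_mat (four_block_mat (1\<^sub>m r) (0\<^sub>m r (n - r)) x (1\<^sub>m (n - r)))
      (0\<^sub>m n n) (0\<^sub>m n n) (four_block_mat (1\<^sub>m (n - r)) (0\<^sub>m (n - r) r) x1 (1\<^sub>m r))"
    unfolding m_Siegel_eq[OF lower_x_GL(1)[OF r x]] lower_x_GL(2)[OF r x] by (simp add: lower_x_def)
  show ?thesis
    unfolding X_bar_mat_def antidiag_conj[OF x] x1_def[symmetric] Let_def
  proof (rule eq_matI)
    fix i j assume "i < dim_row (embed_SO n n (m_Siegel n (lower_x n r x)))"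
      "j < dim_col (embed_SO n n (m_Siegel n (lower_x n r x)))"
    then have ij: "i < 2 * n + 1" "j < 2 * n + 1"
      by (auto simp: embed_SO_def Let_def)
    have c: "four_block_mat (1\<^sub>m r) (0\<^sub>m r (n - r)) x (1\<^sub>m (n - r)) \<in> carrier_mat n n"
      "four_block_mat (1\<^sub>m (n - r)) (0\<^sub>m (n - r) r) x1 (1\<^sub>m r) \<in> carrier_mat n n"
      using r by auto
    let ?L = "if r \<le> i \<and> i < n \<and> j < r then x $$ (i - r, j)
         else if 2 * n + 1 - r \<le> i \<and> n + 1 \<le> j \<and> j < 2 * n + 1 - r then x1 $$ (i - (2 * n + 1 - r), j - (n + 1))
         else if i = j then 1 else 0"
    consider "i = n \<or> j = n" | "i < n" "j < n" | "i < n" "n < j" | "n < i" "j < n" | "n < i" "n < j"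
      by linarith
    then have "?L = embed_SO n n (m_Siegel n (lower_x n r x)) $$ (i, j)"
    proof cases
      case 1
      then show ?thesis
        unfolding m index_embed_SO_full[OF c(1) zero_carrier_mat zero_carrier_mat c(2) ij] using r by auto
    next
      case 2
      then show ?thesis
        unfolding m index_embed_SO_full[OF c(1) zero_carrier_mat zero_carrier_mat c(2) ij] using r x by auto
    next
      case 3
      then show ?thesis
        unfolding m index_embed_SO_full[OF c(1) zero_carrier_mat zero_carrier_mat c(2) ij] using r ij by auto
    next
      case 4
      then show ?thesis
        unfolding m index_embed_SO_full[OF c(1) zero_carrier_mat zero_carrier_mat c(2) ij] using r ij by auto
    next
      case 5
      obtain p where n: "n = r + p"
        using r le_Suc_ex by blast
      obtain i' j' where i: "i = n + 1 + i'" and j: "j = n + 1 + j'"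
        using 5 by (metis Suc_eq_plus1 less_iff_Suc_add add_Suc)
      have "i' < r + p" "j' < r + p"
        using ij by (auto simp: i j n)
      moreover have "2 * n + 1 - r \<le> n + 1 + i' \<longleftrightarrow> \<not> i' < p" "n + 1 + j' < 2 * n + 1 - r \<longleftrightarrow> j' < p"
        "n + 1 + i' - (2 * n + 1 - r) = i' - p" "n - r = p"
        by (auto simp: n)
      moreover have "i' - p = j' - p \<longleftrightarrow> i' = j'" if "\<not> i' < p" "\<not> j' < p"
        using that by auto
      ultimately show ?thesis
        unfolding m index_embed_SO_full[OF c(1) zero_carrier_mat zero_carrier_mat c(2) ij]
        unfolding i j using x1
        by (cases "i' < p"; cases "j' < p") (simp_all add: n)
    qed
    then show "mat (2 * n + 1) (2 * n + 1) (\<lambda>(i, j). if r \<le> i \<and> i < n \<and> j < r then x $$ (i - r, j)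
         else if 2 * n + 1 - r \<le> i \<and> n + 1 \<le> j \<and> j < 2 * n + 1 - r then x1 $$ (i - (2 * n + 1 - r), j - (n + 1))
         else if i = j then 1 else 0) $$ (i, j) = embed_SO n n (m_Siegel n (lower_x n r x)) $$ (i, j)"
      using ij by simp
  qed (auto simp: embed_SO_def Let_def)
qed


section \<open>Paramodular subgroups\<close>

text \<open>
  Conjugation by $\mathrm{diag}(c I_r,I_r)$. For $c=\varpi^m$ it turns $\mathrm{SO}_{2r}(\mathfrak o)$
  into the stabilizer of the paramodular lattice in $H_r(F)$.
\<close>

definition scale_conj :: "'f::padic_field \<Rightarrow> nat \<Rightarrow> 'f mat \<Rightarrow> 'f mat" where
  "scale_conj c r k = mat (2 * r) (2 * r)
     (\<lambda>(i, j). (if i < r then inverse c else 1) * k $$ (i, j) * (if j < r then c else 1))"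

lemma scale_conj_carrier [simp, intro]: "scale_conj c r k \<in> carrier_mat (2 * r) (2 * r)"
  by (simp add: scale_conj_def)

lemma scale_conj_mult:
  assumes c: "c \<noteq> 0" and k: "k \<in> carrier_mat (2 * r) (2 * r)" "l \<in> carrier_mat (2 * r) (2 * r)"
  shows "scale_conj c r (k * l) = scale_conj c r k * scale_conj c r l"
proof (rule eq_matI)
  fix i j assume "i < dim_row (scale_conj c r k * scale_conj c r l)" "j < dim_col (scale_conj c r k * scale_conj c r l)"
  then have ij: "i < 2 * r" "j < 2 * r"
    by (auto simp: scale_conj_def)
  have "scale_conj c r (k * l) $$ (i, j) =
      (if i < r then inverse c else 1) * (\<Sum>x<2 * r. k $$ (i, x) * l $$ (x, j)) * (if j < r then c else 1)"
    using ij by (simp add: scale_conj_def index_mult_sum[OF k ij] del: index_mult_mat)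
  also have "\<dots> = (\<Sum>x<2 * r. scale_conj c r k $$ (i, x) * scale_conj c r l $$ (x, j))"
    unfolding sum_distrib_left sum_distrib_right
    by (rule sum.cong) (use c ij in \<open>auto simp: scale_conj_def\<close>)
  also have "\<dots> = (scale_conj c r k * scale_conj c r l) $$ (i, j)"
    by (rule index_mult_sum[symmetric]) (use ij in auto)
  finally show "scale_conj c r (k * l) $$ (i, j) = (scale_conj c r k * scale_conj c r l) $$ (i, j)" .
qed (auto simp: scale_conj_def)

lemma scale_conj_one: "c \<noteq> 0 \<Longrightarrow> scale_conj c r (1\<^sub>m (2 * r)) = 1\<^sub>m (2 * r)"
  by (rule eq_matI) (auto simp: scale_conj_def)

lemma scale_conj_atr:
  assumes c: "c \<noteq> 0" and k: "k \<in> carrier_mat (2 * r) (2 * r)"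
  shows "scale_conj c r (atr k) = atr (scale_conj c r k)"
proof (rule eq_matI)
  fix i j assume "i < dim_row (atr (scale_conj c r k))" "j < dim_col (atr (scale_conj c r k))"
  then have ij: "i < 2 * r" "j < 2 * r"
    by (auto simp: scale_conj_def)
  then have "2 * r - 1 - i < r \<longleftrightarrow> \<not> i < r" "2 * r - 1 - j < r \<longleftrightarrow> \<not> j < r"
    "2 * r - 1 - i < 2 * r" "2 * r - 1 - j < 2 * r"
    by auto
  then show "scale_conj c r (atr k) $$ (i, j) = atr (scale_conj c r k) $$ (i, j)"
    unfolding index_atr[OF scale_conj_carrier ij] using ij c
    by (simp add: scale_conj_def index_atr[OF k] del: diff_diff_left)
qed (auto simp: scale_conj_def)

lemma scale_conj_inverse:
  assumes c: "c \<noteq> 0" and k: "k \<in> carrier_mat (2 * r) (2 * r)"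
  shows "scale_conj c r (scale_conj (inverse c) r k) = k"
  by (rule eq_matI) (use c k in \<open>auto simp: scale_conj_def\<close>)

lemma det_scale_conj:
  fixes c :: "'f::padic_field"
  assumes c: "c \<noteq> 0" and k: "k \<in> carrier_mat (2 * r) (2 * r)"
  shows "det (scale_conj c r k) = det k"
proof -
  define T where "T e = mat_diag (2 * r) (\<lambda>i. if i < r then e else 1)" for e :: 'f
  have T: "T e \<in> carrier_mat (2 * r) (2 * r)" for e
    by (simp add: T_def)
  have "scale_conj c r k = T (inverse c) * k * T c"
    unfolding T_def using k by (intro eq_matI) (auto simp: scale_conj_def mat_diag_mult_left[OF k]
      mat_diag_mult_right[of _ "2 * r"] mult_carrier_mat)
  moreover have "T (inverse c) * T c = 1\<^sub>m (2 * r)"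
    unfolding T_def mat_diag_diag using c by (intro eq_matI) (auto simp: mat_diag_def)
  then have "det (T (inverse c)) * det (T c) = 1"
    using det_mult[OF T T, of "inverse c" c] by simp
  ultimately show ?thesis
    using det_mult[OF mult_carrier_mat[OF T k] T, of "inverse c" c] det_mult[OF T k, of "inverse c"]
    by (simp add: mult.commute mult.left_commute)
qed

lemma scale_conj_in_SO_even:
  assumes c: "c \<noteq> 0" and k: "k \<in> carrier (SO_even r)"
  shows "scale_conj c r k \<in> carrier (SO_even r)"
  using k unfolding carrier_SO_even
  by (auto simp: det_scale_conj[OF c] scale_conj_one[OF c] simp flip: scale_conj_atr[OF c] scale_conj_mult[OF c])

text \<open>Conjugation by a block scalar matrix preserves a zero lower left quadrant and leaves the
  upper left one unchanged, so only the unipotent factor is altered.\<close>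

lemma scale_conj_parabolic:
  fixes a :: "'f::padic_field mat"
  assumes c: "c \<noteq> 0" and a: "a \<in> carrier (GL r)" "u \<in> N_Siegel r"
  obtains w where "w \<in> N_Siegel r" "scale_conj c r (m_Siegel r a * u) = m_Siegel r a * w"
proof -
  let ?g = "m_Siegel r a * u"
  have g: "?g \<in> carrier (SO_even r)"
    by (rule parabolic_in_SO_even[OF a])
  have "scale_conj c r ?g \<in> carrier (SO_even r)"
    by (rule scale_conj_in_SO_even[OF c g])
  then have sc: "scale_conj c r ?g \<in> carrier_mat (2 * r) (2 * r)"
    "atr (scale_conj c r ?g) * scale_conj c r ?g = 1\<^sub>m (2 * r)"
    by (auto simp: carrier_SO_even)
  have "ul r (scale_conj c r ?g) = ul r ?g"
    using c by (intro eq_matI) (auto simp: ul_def scale_conj_def)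
  then have 1: "ul r (scale_conj c r ?g) = a"
    by (simp add: parabolic_quadrants[OF a])
  have "?g $$ (i + r, j) = 0" if "i < r" "j < r" for i j
    using arg_cong[OF parabolic_quadrants(2)[OF a], of "\<lambda>M. M $$ (i, j)"] that by (simp add: ll_def)
  then have 2: "ll r (scale_conj c r ?g) = 0\<^sub>m r r"
    by (intro eq_matI) (auto simp: ll_def scale_conj_def)
  show ?thesis
    using parabolic_decomposition(2)[OF sc 2] that unfolding 1 by blast
qed

section \<open>Uniformizers and the paramodular lattice\<close>

lemma absF_uniformizer:
  assumes "uniformizer w"
  shows "w \<noteq> 0" "absF w < 1"
proof -
  have w: "max_ideal = (*) w ` integers"
    using assms by (simp add: uniformizer_def)
  have "w \<in> (*) w ` integers"
    by (rule image_eqI[of _ _ 1]) (auto simp: integers_def)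
  then show "absF w < 1"
    using w by (auto simp: max_ideal_def)
  \<comment> \<open>If \<open>w\<close> were 0, the maximal ideal would be zero. But it contains the
    prime \<open>p\<close> of the absolute value, which is nonzero in characteristic 0.\<close>
  obtain p :: nat and c where p: "prime p" "c > 0" "\<And>k. dist (of_int k :: 'a) 0 = padic_abs p k powr c"
    using dist_of_int by blast
  have "multiplicity (int p) (int p) = 1"
    using p(1) by (intro multiplicity_self) (auto simp: not_prime_unit)
  then have "absF (of_nat p :: 'a) = (1 / real p) powr c"
    using p(3)[of "int p"] p(1) by (auto simp: absF_def padic_abs_def dest: prime_gt_0_nat)
  also have "\<dots> < 1 powr c"
    using p(1,2) prime_gt_1_nat[OF p(1)] by (intro powr_less_mono2) auto
  finally have "of_nat p \<in> (max_ideal :: 'a set)"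
    by (simp add: max_ideal_def)
  moreover have "(of_nat p :: 'a) \<noteq> 0"
    using p(1) by (auto dest: prime_gt_0_nat)
  moreover obtain y where "of_nat p = w * y"
    using \<open>of_nat p \<in> max_ideal\<close> w by blast
  ultimately show "w \<noteq> 0"
    by auto
qed

lemma scaled_integers_iff:
  assumes "c \<noteq> 0"
  shows "x \<in> (*) c ` integers \<longleftrightarrow> absF x \<le> absF c"
proof
  assume "x \<in> (*) c ` integers"
  then show "absF x \<le> absF c"
    by (auto simp: integers_def absF_mult mult_left_le)
next
  assume "absF x \<le> absF c"
  moreover have "absF c > 0"
    using absF_nonneg[of c] absF_eq_0_iff[of c] assms by linarith
  ultimately have "absF (x * inverse c) \<le> 1"
    unfolding absF_mult absF_inverse by (simp add: field_simps)
  moreover have "x = c * (x * inverse c)"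
    using assms by simp
  ultimately show "x \<in> (*) c ` integers"
    unfolding integers_def by blast
qed

lemma paramodular_lattice_iff:
  assumes "w \<noteq> 0"
  shows "x \<in> paramodular_lattice w n m \<longleftrightarrow> x \<in> carrier_vec (2 * n + 1) \<and>
    (\<forall>i<2 * n + 1. absF (vec_index x i) \<le> (if i < n then 1 else absF (w ^ m)))"
proof -
  have "w ^ m \<noteq> 0"
    using assms by simp
  then show ?thesis
    unfolding paramodular_lattice_def scaled_integers_iff[OF \<open>w ^ m \<noteq> 0\<close>]
    by (auto simp: integers_def)
qed

text \<open>For \<open>k\<close> in the integral group the determinant requirement of
  \<open>K_paramodular\<close> holds automatically, which leaves the Dickson condition in residue
  characteristic 2. It refers to \<open>k\<close> before conjugation because \<open>t_mat\<close>
  undoes \<open>scale_conj\<close>.\<close>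

definition K_condition :: "nat \<Rightarrow> nat \<Rightarrow> 'f::padic_field mat \<Rightarrow> bool" where
  "K_condition n r k \<longleftrightarrow> ((2 :: 'f) \<in> max_ideal \<longrightarrow> dickson n (blk (2 * n) r k (1\<^sub>m (2 * (n - r)))) \<in> max_ideal)"

text \<open>The scaling of the first \<open>r\<close> coordinates may be read as a scaling of the
  first \<open>n\<close>, since on the inner coordinates the matrix is the identity and the factors
  \<open>inverse c\<close> and \<open>c\<close> cancel on its diagonal. In this form the scaling
  matches \<open>t_mat\<close>.\<close>

lemma embed_scale_conj_index:
  assumes r: "r \<le> n" and c: "c \<noteq> 0" and ij: "i < 2 * n + 1" "j < 2 * n + 1"
  shows "embed_SO n r (scale_conj c r k) $$ (i, j) =
    (if i < n then inverse c else 1) * embed_SO n r k $$ (i, j) * (if j < n then c else 1)"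
proof -
  let ?o = "outer_idx (2 * n + 1) r" and ?b = "blk_idx (2 * n + 1) r"
  have rN: "2 * r \<le> 2 * n + 1"
    using r by simp
  have b: "?b x < r \<longleftrightarrow> x < n" if "?o x" for x
    using that r by (auto simp: outer_idx_def blk_idx_def)
  have bl: "?b x < 2 * r" if "?o x" "x < 2 * n + 1" for x
    by (rule blk_idx_less[OF rN that(2,1)])
  have il: "x - r < 2 * (n - r) + 1" if "\<not> ?o x" for x
    using inner_idx_less[OF rN that] r by simp
  have eq: "x - r = y - r \<longleftrightarrow> x = y" if "\<not> ?o x" "\<not> ?o y" for x y
    by (rule inner_idx_eq_iff[OF that])
  show ?thesis
  proof (cases "?o i"; cases "?o j")
    assume "?o i" "?o j"
    then show ?thesis
      unfolding embed_SO_eq_blk[OF r] index_blk[OF ij]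
      by (simp add: scale_conj_def bl ij b del: One_nat_def)
  next
    assume "\<not> ?o i" "\<not> ?o j"
    then show ?thesis
      unfolding embed_SO_eq_blk[OF r] index_blk[OF ij] using c eq[of i j] il[of i] il[of j] by auto
  qed (simp_all add: embed_SO_eq_blk[OF r] index_blk[OF ij] del: One_nat_def)
qed

lemma embed_SO_int:
  assumes r: "r \<le> n" and k: "k \<in> SO_even_int r" and ij: "i < 2 * n + 1" "j < 2 * n + 1"
  shows "absF (embed_SO n r k $$ (i, j)) \<le> 1"
proof -
  have rN: "2 * r \<le> 2 * n + 1"
    using r by simp
  have il: "x - r < 2 * (n - r) + 1" if "\<not> outer_idx (2 * n + 1) r x" for x
    using inner_idx_less[OF rN that] r by simp
  show ?thesis
    unfolding embed_SO_eq_blk[OF r] index_blk[OF ij]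
    using k blk_idx_less[OF rN ij(1)] blk_idx_less[OF rN ij(2)] il[of i] il[of j]
    by (auto simp: SO_even_int_iff)
qed

text \<open>With c = w^m and D = diag(c I_n, 1, I_n), the lattice is c times the image of the
  standard lattice under the inverse of D, and the matrix is the inverse of D times an integral
  matrix times D. The estimate of the entries spells out that such a conjugate maps the lattice into
  itself.\<close>

lemma embed_scale_conj_lattice:
  fixes w :: "'f::padic_field"
  assumes r: "r \<le> n" and w: "w \<noteq> 0" and k: "k \<in> SO_even_int r"
    and x: "x \<in> paramodular_lattice w n m"
  shows "embed_SO n r (scale_conj (w ^ m) r k) *\<^sub>v x \<in> paramodular_lattice w n m"
  unfolding paramodular_lattice_iff[OF w]
proof (intro conjI allI impI)
  let ?g = "embed_SO n r (scale_conj (w ^ m) r k)"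
  have g: "?g \<in> carrier_mat (2 * n + 1) (2 * n + 1)"
    by (rule embed_SO_carrier)
  have xc: "x \<in> carrier_vec (2 * n + 1)"
    and xi: "absF (vec_index x i) \<le> (if i < n then 1 else absF (w ^ m))" if "i < 2 * n + 1" for i
    using x that by (auto simp: paramodular_lattice_iff[OF w])
  have c: "w ^ m \<noteq> 0"
    using w by simp
  show "?g *\<^sub>v x \<in> carrier_vec (2 * n + 1)"
    using g x by (auto simp: paramodular_lattice_def)
  fix i assume i: "i < 2 * n + 1"
  have "vec_index (?g *\<^sub>v x) i = (\<Sum>j<2 * n + 1. ?g $$ (i, j) * vec_index x j)"
    using g i x by (auto simp: scalar_prod_def atLeast0LessThan paramodular_lattice_def)
  also have "absF \<dots> \<le> (if i < n then 1 else absF (w ^ m))"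
  proof (rule absF_sum_le)
    fix j assume "j \<in> {..<2 * n + 1}"
    then have j: "j < 2 * n + 1"
      by simp
    have cp: "absF (w ^ m) > 0"
      using absF_nonneg[of "w ^ m"] absF_eq_0_iff[of "w ^ m"] c by linarith
    have "absF (?g $$ (i, j) * vec_index x j) =
        (if i < n then inverse (absF (w ^ m)) else 1) * absF (embed_SO n r k $$ (i, j)) *
        ((if j < n then absF (w ^ m) else 1) * absF (vec_index x j))"
      by (simp add: embed_scale_conj_index[OF r c i j] absF_mult absF_inverse)
    also have "\<dots> \<le> (if i < n then inverse (absF (w ^ m)) else 1) * 1 * absF (w ^ m)"
    proof (intro mult_mono embed_SO_int[OF r k i j] order_refl)
      show "(if j < n then absF (w ^ m) else 1) * absF (vec_index x j) \<le> absF (w ^ m)"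
        using xi[OF j] cp by (auto simp: mult_left_le)
    qed (use cp in auto)
    also have "\<dots> = (if i < n then 1 else absF (w ^ m))"
      using w by simp
    finally show "absF (?g $$ (i, j) * vec_index x j) \<le> (if i < n then 1 else absF (w ^ m))" .
  qed simp
  finally show "absF (vec_index (?g *\<^sub>v x) i) \<le> (if i < n then 1 else absF (w ^ m))" .
qed

lemma embed_scale_conj_in_J:
  fixes w :: "'f::padic_field"
  assumes r: "r \<le> n" and w: "w \<noteq> 0" and k: "k \<in> SO_even_int r"
  shows "embed_SO n r (scale_conj (w ^ m) r k) \<in> J_paramodular w n m"
proof -
  let ?g = "embed_SO n r (scale_conj (w ^ m) r k)" and ?h = "embed_SO n r (scale_conj (w ^ m) r (atr k))"
  have c: "w ^ m \<noteq> 0"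
    using w by simp
  have k': "k \<in> carrier (SO_even r)"
    using k by (simp add: SO_even_int_iff)
  have gh: "?g * ?h = 1\<^sub>m (2 * n + 1)"
    using SO_even_atr[OF k'] k'
    by (simp add: scale_conj_one[OF c] embed_SO_one[OF r] SO_even_carrier_mat
        flip: embed_SO_mult[OF r scale_conj_carrier scale_conj_carrier] scale_conj_mult[OF c])
  have "x \<in> (\<lambda>x. ?g *\<^sub>v x) ` paramodular_lattice w n m" if x: "x \<in> paramodular_lattice w n m" for x
  proof
    show "?h *\<^sub>v x \<in> paramodular_lattice w n m"
      by (rule embed_scale_conj_lattice[OF r w SO_even_int_atr[OF k] x])
    have "?g *\<^sub>v (?h *\<^sub>v x) = (?g * ?h) *\<^sub>v x"
      using x by (intro assoc_mult_mat_vec[symmetric]) (auto simp: paramodular_lattice_def)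
    then show "x = ?g *\<^sub>v (?h *\<^sub>v x)"
      using x unfolding gh by (simp add: paramodular_lattice_def)
  qed
  then have "(\<lambda>x. ?g *\<^sub>v x) ` paramodular_lattice w n m = paramodular_lattice w n m"
    using embed_scale_conj_lattice[OF r w k] by blast
  then show ?thesis
    unfolding J_paramodular_def using embed_SO_in_SO_odd[OF r scale_conj_in_SO_even[OF c k']] by simp
qed

text \<open>Conjugation by \<open>t_mat\<close> undoes the scaling, and removing row and column
  \<open>n\<close> leaves the image of \<open>k\<close> in H_n, which has determinant exactly 1.
  What remains is the assumed condition on \<open>k\<close>.\<close>

lemma embed_scale_conj_in_K:
  fixes w :: "'f::padic_field"
  assumes r: "r \<le> n" and w: "w \<noteq> 0" and k: "k \<in> SO_even_int r" and K: "K_condition n r k"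
  shows "embed_SO n r (scale_conj (w ^ m) r k) \<in> K_paramodular w n m"
proof (cases "m = 0")
  case True
  then show ?thesis
    using embed_scale_conj_in_J[OF r w k, of 0] by (simp add: K_paramodular_def)
next
  case False
  let ?g = "embed_SO n r (scale_conj (w ^ m) r k)" and ?N = "2 * n + 1"
  have c: "w ^ m \<noteq> 0"
    using w by simp
  define t where "t = t_mat w n m"
  define t' where "t' = mat_diag ?N (\<lambda>i. if i < n then inverse (w ^ m) else 1)"
  have tc: "t \<in> carrier_mat ?N ?N" "t' \<in> carrier_mat ?N ?N"
    by (simp_all add: t_def t_mat_def t'_def)
  have "t * t' = 1\<^sub>m ?N"
    unfolding t_def t_mat_def t'_def mat_diag_diag by (intro eq_matI) (use c in \<open>auto simp: mat_diag_def\<close>)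
  then have inv: "inv\<^bsub>GL ?N\<^esub> t = t'"
    by (intro inv_GL_eqI tc)
  have tg: "t * ?g \<in> carrier_mat ?N ?N"
    by (rule mult_carrier_mat[OF tc(1) embed_SO_carrier])
  define A where "A = mat_delete (t * ?g * inv\<^bsub>GL ?N\<^esub> t) n n"
  define B where "B = t * ?g * t'"
  have B: "B \<in> carrier_mat ?N ?N"
    unfolding B_def by (rule mult_carrier_mat[OF tg tc(2)])
  have AB: "A = mat_delete B n n"
    by (simp only: A_def B_def inv)
  have "A = blk (2 * n) r k (1\<^sub>m (2 * (n - r)))"
  proof (rule eq_matI)
    fix i j assume "i < dim_row (blk (2 * n) r k (1\<^sub>m (2 * (n - r))))" "j < dim_col (blk (2 * n) r k (1\<^sub>m (2 * (n - r))))"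
    then have ij: "i < 2 * n" "j < 2 * n"
      by auto
    \<comment> \<open>The corresponding indices of the large matrix, with \<open>n\<close>
      skipped.\<close>
    define i' j' where "i' = (if i < n then i else Suc i)" and "j' = (if j < n then j else Suc j)"
    have i': "i' < ?N" "j' < ?N" "i' < n \<longleftrightarrow> i < n" "j' < n \<longleftrightarrow> j < n" "i' \<noteq> n" "j' \<noteq> n"
      using ij by (auto simp: i'_def j'_def)
    have "A $$ (i, j) = B $$ (i', j')"
      using ij B by (simp add: AB mat_delete_def i'_def j'_def)
    also have "\<dots> = (t * ?g) $$ (i', j') * (if j' < n then inverse (w ^ m) else 1)"
      unfolding B_def t'_def mat_diag_mult_right[OF tg] using i' by (simp del: One_nat_def)
    also have "(t * ?g) $$ (i', j') = (if i' < n then w ^ m else 1) * ?g $$ (i', j')"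
      unfolding t_def t_mat_def mat_diag_mult_left[OF embed_SO_carrier] using i' by (simp del: One_nat_def)
    also have "(if i' < n then w ^ m else 1) * ?g $$ (i', j') * (if j' < n then inverse (w ^ m) else 1) = embed_SO n r k $$ (i', j')"
      using c by (simp add: embed_scale_conj_index[OF r c i'(1,2)])
    also have "\<dots> = embed_SO n n (blk (2 * n) r k (1\<^sub>m (2 * (n - r)))) $$ (i', j')"
      by (simp add: embed_SO_trans[OF r])
    also have "\<dots> = blk (2 * n) r k (1\<^sub>m (2 * (n - r))) $$ (i, j)"
      using ij by (auto simp: embed_SO_def Let_def i'_def j'_def)
    finally show "A $$ (i, j) = blk (2 * n) r k (1\<^sub>m (2 * (n - r))) $$ (i, j)" .
  qed (use B in \<open>auto simp: AB mat_delete_def\<close>)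
  moreover have "det (blk (2 * n) r k (1\<^sub>m (2 * (n - r)))) = 1"
    using blk_in_SO_even[OF r, of k] k by (auto simp: SO_even_int_iff carrier_SO_even)
  ultimately have "det A - 1 \<in> max_ideal" "(2 :: 'f) \<in> max_ideal \<longrightarrow> dickson n A \<in> max_ideal"
    using K by (auto simp: max_ideal_def K_condition_def)
  then show ?thesis
    using False embed_scale_conj_in_J[OF r w k, of m] by (simp add: K_paramodular_def Let_def A_def t_def)
qed

text \<open>Each summand of the Dickson sum has a factor from the upper right quadrant, so the sum
  is 0. This covers the Levi elements and the lower unipotent ones.\<close>

lemma K_condition_if_ur_zero:
  assumes r: "r \<le> n" and z: "ur r k = 0\<^sub>m r r"
  shows "K_condition n r k"
proof -
  have "blk (2 * n) r k (1\<^sub>m (2 * (n - r))) $$ (j, 2 * n - 1 - i) = 0" if ij: "i < n" "j < n" for i j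
  proof -
    let ?o = "outer_idx (2 * n) r" and ?b = "blk_idx (2 * n) r"
    have o: "?o j \<longleftrightarrow> j < r" "?o (2 * n - 1 - i) \<longleftrightarrow> i < r" "j < r \<Longrightarrow> ?b j = j"
      "i < r \<Longrightarrow> ?b (2 * n - 1 - i) = (r - 1 - i) + r"
      "\<not> i < r \<Longrightarrow> \<not> j < r \<Longrightarrow> j - r \<noteq> 2 * n - 1 - i - r"
      "2 * n - 1 - i - r < 2 * (n - r) \<or> i < r" "j - r < 2 * (n - r) \<or> j < r"
      using ij r by (auto simp: outer_idx_def blk_idx_def)
    have "k $$ (j, (r - 1 - i) + r) = 0" if "i < r" "j < r"
      using arg_cong[OF z, of "\<lambda>M. M $$ (j, r - 1 - i)"] that by (simp add: ur_def)
    moreover have l: "j < 2 * n" "2 * n - 1 - i < 2 * n"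
      using ij by auto
    ultimately show ?thesis
      unfolding index_blk[OF l] o(1,2) using o(3-) by (auto simp del: diff_diff_left)
  qed
  then show ?thesis
    by (simp add: K_condition_def dickson_def max_ideal_def)
qed

text \<open>For an exchange of pairs the Dickson sum counts the pairs exchanged. An even count is a
  multiple of 2, which lies in the maximal ideal when 2 does.\<close>

lemma K_condition_swap_mat:
  assumes r: "r \<le> n" and Q: "Q \<subseteq> {..<r}" "even (card Q)"
  shows "K_condition n r (swap_mat r Q :: 'f::padic_field mat)"
proof -
  let ?A = "blk (2 * n) r (swap_mat r Q) (1\<^sub>m (2 * (n - r))) :: 'f mat"
  let ?o = "outer_idx (2 * n) r" and ?b = "blk_idx (2 * n) r"
  have o: "?o j \<longleftrightarrow> j < r" "?o (2 * n - 1 - j) \<longleftrightarrow> j < r" "j < r \<Longrightarrow> ?b j = j"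
    "j < r \<Longrightarrow> ?b (2 * n - 1 - j) = 2 * r - 1 - j"
    "2 * n - 1 - j - r < 2 * (n - r) \<or> j < r" "j - r < 2 * (n - r) \<or> j < r"
    if "j < n" for j
    using that r by (auto simp: outer_idx_def blk_idx_def)
  have ps: "pair_swap r Q j = (if r - 1 - j \<in> Q then 2 * r - 1 - j else j)"
    "pair_swap r Q (2 * r - 1 - j) = (if r - 1 - j \<in> Q then j else 2 * r - 1 - j)" if "j < r" for j
    using that pair_swap_opposite[of j r Q] by (auto simp: pair_swap_def)
  \<comment> \<open>In the upper right quadrant only antidiagonal positions are occupied, one for
    each exchanged pair.\<close>
  have A1: "?A $$ (j, 2 * n - 1 - i) = (if i = j \<and> i < r \<and> r - 1 - i \<in> Q then 1 else 0)" if ij: "i < n" "j < n" for i j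
  proof -
    have l: "j < 2 * n" "2 * n - 1 - i < 2 * n" "\<not> i < r \<Longrightarrow> \<not> j < r \<Longrightarrow> j - r \<noteq> 2 * n - 1 - i - r"
      using ij by auto
    have l': "2 * r - 1 - i < 2 * r" "j \<noteq> 2 * r - 1 - i" if "i < r" "j < r"
      using that by auto
    consider "i < r" "j < r" | "\<not> i < r" "\<not> j < r" | "(i < r) \<noteq> (j < r)"
      by blast
    then show ?thesis
    proof cases
      case 1
      then have "j < 2 * r"
        by simp
      then show ?thesis
        unfolding index_blk[OF l(1,2)] o(2)[OF ij(1)] o(1)[OF ij(2)] o(4)[OF ij(1) 1(1)] o(3)[OF ij(2) 1(2)]
        using 1 l' by (simp add: swap_mat_def ps(2)[OF 1(1)] del: diff_diff_left One_nat_def)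
    next
      case 2
      then show ?thesis
        unfolding index_blk[OF l(1,2)] o(2)[OF ij(1)] o(1)[OF ij(2)]
        using l(3) o(5)[OF ij(1)] o(6)[OF ij(2)] by (simp del: diff_diff_left One_nat_def)
    next
      case 3
      then show ?thesis
        unfolding index_blk[OF l(1,2)] o(2)[OF ij(1)] o(1)[OF ij(2)] by auto
    qed
  qed
  have A2: "?A $$ (2 * n - 1 - i, i) = 1" if i: "i < r" "r - 1 - i \<in> Q" for i
  proof -
    have l: "2 * n - 1 - i < 2 * n" "i < 2 * n" "i < n" "2 * r - 1 - i < 2 * r" "i < 2 * r"
      using i r by auto
    show ?thesis
      unfolding index_blk[OF l(1,2)] o(1,2)[OF l(3)]
      using i l o(3,4)[OF l(3) i(1)] by (simp add: swap_mat_def ps(1)[OF i(1)] del: diff_diff_left One_nat_def)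
  qed
  have "dickson n ?A = (\<Sum>i<n. \<Sum>j<n. if j = i then (if i < r \<and> r - 1 - i \<in> Q then 1 else 0) else 0)"
    unfolding dickson_def
    by (intro sum.cong refl) (use A1 A2 in auto)
  also have "\<dots> = (\<Sum>i<n. if i < r \<and> r - 1 - i \<in> Q then 1 else 0)"
    by (intro sum.cong) auto
  also have "\<dots> = of_nat (card {i\<in>{..<n}. i < r \<and> r - 1 - i \<in> Q})"
    by (simp add: sum.If_cases Int_def)
  also have "card {i\<in>{..<n}. i < r \<and> r - 1 - i \<in> Q} = card Q"
  proof (rule bij_betw_same_card[of "\<lambda>i. r - 1 - i"], rule bij_betwI')
    show "\<exists>x\<in>{i \<in> {..<n}. i < r \<and> r - 1 - i \<in> Q}. q = r - 1 - x" if "q \<in> Q" for q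
      using that Q(1) r by (intro bexI[of _ "r - 1 - q"]) auto
  qed auto
  also obtain l where "card Q = 2 * l"
    using Q(2) by blast
  finally have d: "dickson n ?A = 2 * of_nat l"
    by simp
  have "absF (of_nat l :: 'f) \<le> 1"
  proof (induction l)
    case (Suc l)
    then show ?case
      using absF_add[of 1 "of_nat l :: 'f"] by simp
  qed simp
  then have "(2 :: 'f) \<in> max_ideal \<longrightarrow> dickson n ?A \<in> max_ideal"
    unfolding d max_ideal_def by (auto simp: absF_mult intro: mult_left_le[THEN order.strict_trans1])
  then show ?thesis
    by (simp add: K_condition_def)
qed

section \<open>Integral points of the Levi subgroup\<close>

lemma GL_int_carrier: "a \<in> GL_int r \<Longrightarrow> a \<in> carrier (GL r)"
  by (auto simp: GL_int_def carrier_GL)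

lemma GL_int_entries: "a \<in> GL_int r \<Longrightarrow> i < r \<Longrightarrow> j < r \<Longrightarrow> absF (a $$ (i, j)) \<le> 1"
  by (auto simp: GL_int_def integers_def intro!: elements_matI)

text \<open>The inverse is the adjugate divided by the determinant; cofactors of an integral matrix
  are integral, and the determinant is a unit.\<close>

lemma GL_int_inverse_entries:
  fixes a :: "'f::padic_field mat"
  assumes a: "a \<in> GL_int r" and ij: "i < r" "j < r"
  shows "absF ((inv\<^bsub>GL r\<^esub> a) $$ (i, j)) \<le> 1"
proof -
  have ac: "a \<in> carrier_mat r r" and d: "absF (det a) = 1"
    using a by (auto simp: GL_int_def)
  have "inv\<^bsub>GL r\<^esub> a = inverse (det a) \<cdot>\<^sub>m adj_mat a"
  proof (rule inv_GL_eqI[OF ac])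
    show "inverse (det a) \<cdot>\<^sub>m adj_mat a \<in> carrier_mat r r"
      using adj_mat(1)[OF ac] by simp
    have "a * (inverse (det a) \<cdot>\<^sub>m adj_mat a) = inverse (det a) \<cdot>\<^sub>m (det a \<cdot>\<^sub>m 1\<^sub>m r)"
      using mult_smult_distrib[OF ac adj_mat(1)[OF ac]] adj_mat(2)[OF ac] by simp
    also have "\<dots> = 1\<^sub>m r"
      using GL_int_carrier[OF a] by (intro eq_matI) (auto simp: carrier_GL)
    finally show "a * (inverse (det a) \<cdot>\<^sub>m adj_mat a) = 1\<^sub>m r" .
  qed
  moreover have "absF (adj_mat a $$ (i, j)) \<le> 1"
  proof -
    have "absF (det (mat_delete a j i)) \<le> 1"
    proof (rule absF_det_le_1)
      show "mat_delete a j i \<in> carrier_mat (r - 1) (r - 1)"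
        using ac by (rule mat_delete_carrier)
      show "absF (mat_delete a j i $$ (x, y)) \<le> 1" if "x < r - 1" "y < r - 1" for x y
        using that ac GL_int_entries[OF a] by (auto simp: mat_delete_def)
    qed
    moreover have "absF ((- 1) ^ (j + i) :: 'f) = 1"
      by (simp add: absF_power)
    ultimately show ?thesis
      using ac ij by (simp add: adj_mat_def cofactor_def absF_mult)
  qed
  ultimately show ?thesis
    using adj_mat(1)[OF ac] ij d by (simp add: absF_mult absF_inverse)
qed

lemma m_Siegel_GL_int:
  fixes a :: "'f::padic_field mat"
  assumes a: "a \<in> GL_int r"
  shows "m_Siegel r a \<in> SO_even_int r" "ur r (m_Siegel r a) = 0\<^sub>m r r"
proof -
  note g = GL_int_carrier[OF a]
  have c: "a \<in> carrier_mat r r" "inv\<^bsub>GL r\<^esub> a \<in> carrier_mat r r"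
    using g inv_GL(1)[OF g] by (auto simp: carrier_GL)
  have "absF (m_Siegel r a $$ (i, j)) \<le> 1" if "i < 2 * r" "j < 2 * r" for i j
    unfolding m_Siegel_eq[OF g] using c that GL_int_entries[OF a] GL_int_inverse_entries[OF a]
    by (auto simp: index_atr[OF c(2)])
  then show "m_Siegel r a \<in> SO_even_int r"
    using m_Siegel_in_SO_even[OF g] by (simp add: SO_even_int_iff)
  show "ur r (m_Siegel r a) = 0\<^sub>m r r"
    unfolding m_Siegel_eq[OF g] using c by (simp add: quadrant_four_block)
qed


section \<open>Compactness\<close>

text \<open>Makes the normalisation axiom usable. There are finitely many residue classes because
  \<open>card\<close> of an infinite set is 0, which would force \<open>absF w\<close> to be 1 / 0 =
  0, whereas \<open>w\<close> is nonzero.\<close>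

lemma prime_element:
  obtains w :: "'f::padic_field" where "w \<noteq> 0" "absF w < 1"
    "\<And>x. absF x < 1 \<Longrightarrow> \<exists>y. absF y \<le> 1 \<and> x = w * y"
    "finite ((\<lambda>x :: 'f. {y. dist y x < 1}) ` {x. dist x 0 \<le> 1})"
proof -
  obtain w :: 'f where w: "dist w 0 < 1" "\<And>x. dist x 0 < 1 \<Longrightarrow> \<exists>y. dist y 0 \<le> 1 \<and> x = w * y"
    and c: "dist w 0 = 1 / real (card ((\<lambda>x :: 'f. {y. dist y x < 1}) ` {x. dist x 0 \<le> 1}))"
    using normalised by blast
  have "uniformizer w"
    unfolding uniformizer_def
  proof (intro equalityI subsetI)
    fix x :: 'f assume "x \<in> max_ideal"
    then obtain y where "dist y 0 \<le> 1" "x = w * y"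
      using w(2)[of x] by (auto simp: max_ideal_def absF_def)
    then show "x \<in> (*) w ` integers"
      by (auto simp: integers_def absF_def)
  next
    fix x :: 'f assume "x \<in> (*) w ` integers"
    then obtain y where "absF y \<le> 1" "x = w * y"
      by (auto simp: integers_def)
    then have "absF x \<le> absF w"
      by (simp add: absF_mult mult_left_le)
    then show "x \<in> max_ideal"
      using w(1) by (simp add: max_ideal_def absF_def)
  qed
  then have "w \<noteq> 0"
    by (rule absF_uniformizer(1))
  have "finite ((\<lambda>x :: 'f. {y. dist y x < 1}) ` {x. dist x 0 \<le> 1})"
  proof (rule ccontr)
    assume "infinite ((\<lambda>x :: 'f. {y. dist y x < 1}) ` {x. dist x 0 \<le> 1})"
    then have "card ((\<lambda>x :: 'f. {y. dist y x < 1}) ` {x. dist x 0 \<le> 1}) = 0"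
      by (rule card.infinite)
    then have "dist w 0 = 1 / real 0"
      using c by metis
    with \<open>w \<noteq> 0\<close> show False
      by simp
  qed
  moreover have "absF w < 1" "\<And>x. absF x < 1 \<Longrightarrow> \<exists>y. absF y \<le> 1 \<and> x = w * y"
    using w by (simp_all only: absF_def)
  ultimately show ?thesis
    using \<open>w \<noteq> 0\<close> by (intro that)
qed

text \<open>Expansion in powers of \<open>w\<close> with digits from a finite set of representatives
  of the residue classes: the first \<open>k\<close> digits determine the element up to an error of
  size at most \<open>absF w ^ k\<close>.\<close>

lemma integers_net_power:
  assumes w: "w \<noteq> 0" "\<And>x :: 'f::padic_field. absF x < 1 \<Longrightarrow> \<exists>y. absF y \<le> 1 \<and> x = w * y"
    and fin: "finite ((\<lambda>x :: 'f. {y. dist y x < 1}) ` {x. dist x 0 \<le> 1})"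
  shows "\<exists>B :: 'f set. finite B \<and> (\<forall>x. absF x \<le> 1 \<longrightarrow> (\<exists>b\<in>B. absF (x - b) \<le> absF w ^ k))"
proof (induction k)
  case 0
  show ?case
    by (rule exI[of _ "{0}"]) simp
next
  case (Suc k)
  then obtain B :: "'f set" where B: "finite B" and "\<forall>x. absF x \<le> 1 \<longrightarrow> (\<exists>b\<in>B. absF (x - b) \<le> absF w ^ k)"
    by (elim exE conjE)
  then have B2: "\<exists>b\<in>B. absF (x - b) \<le> absF w ^ k" if "absF x \<le> 1" for x
    using that by simp
  have "\<exists>R\<subseteq>{x :: 'f. dist x 0 \<le> 1}. finite R \<and>
      (\<lambda>x :: 'f. {y. dist y x < 1}) ` {x. dist x 0 \<le> 1} = (\<lambda>x. {y. dist y x < 1}) ` R"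
    by (rule finite_subset_image[OF fin order_refl])
  then obtain R where R: "finite R" "R \<subseteq> {x. dist x 0 \<le> 1}"
    "(\<lambda>x :: 'f. {y. dist y x < 1}) ` {x. dist x 0 \<le> 1} = (\<lambda>x. {y. dist y x < 1}) ` R"
    by (elim exE conjE)
  show ?case
  proof (rule exI[of _ "(\<lambda>(b, c). b + w ^ k * c) ` (B \<times> R)"], intro conjI allI impI)
    fix x :: 'f assume "absF x \<le> 1"
    then obtain b where b: "b \<in> B" "absF (x - b) \<le> absF (w ^ k)"
      using B2[of x] unfolding absF_power by auto
    then obtain y where y: "absF y \<le> 1" "x - b = w ^ k * y"
      using scaled_integers_iff[of "w ^ k" "x - b"] w(1) by (auto simp: integers_def)
    then have "{z. dist z y < 1} \<in> (\<lambda>x. {y. dist y x < 1}) ` R"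
      unfolding R(3)[symmetric] by (auto simp: absF_def)
    then obtain c where c: "c \<in> R" "{z. dist z y < 1} = {z. dist z c < 1}"
      by blast
    have "y \<in> {z. dist z c < 1}"
      unfolding c(2)[symmetric] by simp
    then obtain z where z: "absF z \<le> 1" "y - c = w * z"
      using w(2)[of "y - c"] by (auto simp: dist_absF)
    have "x - (b + w ^ k * c) = w ^ k * (y - c)"
      using y(2) by (simp add: algebra_simps)
    then have "absF (x - (b + w ^ k * c)) = absF w ^ Suc k * absF z"
      by (simp add: z(2) absF_mult absF_power)
    also have "\<dots> \<le> absF w ^ Suc k"
      using z(1) by (intro mult_left_le) auto
    finally show "\<exists>b\<in>(\<lambda>(b, c). b + w ^ k * c) ` (B \<times> R). absF (x - b) \<le> absF w ^ Suc k"
      using b(1) c(1) by (intro bexI[of _ "b + w ^ k * c"]) auto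
  qed (use B R in auto)
qed

text \<open>Scaling by a power of \<open>w\<close> brings the ball into the ring of integers; the
  precision \<open>l\<close> there is chosen to compensate for scaling back.\<close>

lemma ball_net:
  assumes "e > 0"
  obtains B :: "'f::padic_field set" where "finite B" "\<And>x. absF x \<le> c \<Longrightarrow> \<exists>b\<in>B. dist x b < e"
proof -
  obtain w :: 'f where w: "w \<noteq> 0" "absF w < 1" "\<And>x. absF x < 1 \<Longrightarrow> \<exists>y. absF y \<le> 1 \<and> x = w * y"
    and fin: "finite ((\<lambda>x :: 'f. {y. dist y x < 1}) ` {x. dist x 0 \<le> 1})"
    using prime_element by blast
  have wp: "absF w > 0"
    using w(1) absF_nonneg[of w] absF_eq_0_iff[of w] by linarith
  obtain k where k: "absF w ^ k * c \<le> 1"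
  proof (cases "c \<le> 0")
    case True
    then show ?thesis
      using that[of 0] by simp
  next
    case False
    then obtain k where "absF w ^ k < 1 / c"
      using real_arch_pow_inv[of "1 / c" "absF w"] w(2) by auto
    then show ?thesis
      using that[of k] False by (simp add: field_simps)
  qed
  obtain l where l: "absF w ^ l < e * absF w ^ k"
    using real_arch_pow_inv[of "e * absF w ^ k" "absF w"] w(2) wp assms by auto
  obtain B :: "'f set" where B: "finite B" "\<And>x. absF x \<le> 1 \<Longrightarrow> \<exists>b\<in>B. absF (x - b) \<le> absF w ^ l"
    using integers_net_power[OF w(1,3) fin] by blast
  show ?thesis
  proof (rule that[of "(\<lambda>b. inverse (w ^ k) * b) ` B"])
    fix x :: 'f assume x: "absF x \<le> c"
    have "absF (w ^ k * x) \<le> 1"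
      using k mult_left_mono[OF x, of "absF w ^ k"] by (simp add: absF_mult absF_power)
    then obtain b where b: "b \<in> B" "absF (w ^ k * x - b) \<le> absF w ^ l"
      using B by blast
    have "x - inverse (w ^ k) * b = inverse (w ^ k) * (w ^ k * x - b)"
      using w(1) by (simp add: right_diff_distrib)
    then have "dist x (inverse (w ^ k) * b) = inverse (absF w ^ k) * absF (w ^ k * x - b)"
      by (simp only: dist_absF absF_mult absF_inverse absF_power)
    also have "\<dots> \<le> inverse (absF w ^ k) * absF w ^ l"
      using b wp by (intro mult_left_mono) auto
    also have "\<dots> < inverse (absF w ^ k) * (e * absF w ^ k)"
      using l wp by (intro mult_strict_left_mono) auto
    also have "\<dots> = e"
      using w(1) by simp
    finally show "\<exists>b\<in>(\<lambda>b. inverse (w ^ k) * b) ` B. dist x b < e"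
      using b by blast
  qed (use B in auto)
qed

text \<open>Finite nets give total boundedness, and a closed subset of a complete space is complete.
  Compactness is what makes the Haar measure of balls finite.\<close>

lemma compact_ball: "compact {x :: 'f::padic_field. absF x \<le> c}"
  unfolding compact_eq_totally_bounded
proof (intro conjI allI impI)
  have "{x :: 'f. absF x \<le> c} = cball 0 c"
    by (auto simp: absF_def dist_commute)
  then show "complete {x :: 'f. absF x \<le> c}"
    by (simp add: complete_eq_closed)
  fix e :: real assume "e > 0"
  then obtain B :: "'f set" where B: "finite B" "\<And>x. absF x \<le> c \<Longrightarrow> \<exists>b\<in>B. dist x b < e"
    using ball_net by blast
  then show "\<exists>k. finite k \<and> {x :: 'f. absF x \<le> c} \<subseteq> (\<Union>x\<in>k. ball x e)"
    by (intro exI[of _ B]) (force simp: dist_commute)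
qed

text \<open>The union of finite nets over all integral radii and all precisions. It provides
  countable covers of open sets by balls.\<close>

lemma countable_dense:
  obtains D :: "'f::padic_field set" where "countable D" "\<And>x e. e > 0 \<Longrightarrow> \<exists>d\<in>D. dist x d < e"
proof -
  have "\<exists>B :: 'f set. finite B \<and> (\<forall>x. absF x \<le> real c \<longrightarrow> (\<exists>b\<in>B. dist x b < 1 / Suc k))" for c k :: nat
  proof -
    have "0 < 1 / real (Suc k)"
      by simp
    then obtain B :: "'f set" where "finite B" "\<And>x. absF x \<le> real c \<Longrightarrow> \<exists>b\<in>B. dist x b < 1 / Suc k"
      using ball_net by blast
    then show ?thesis
      by (intro exI[of _ B]) simp
  qed
  then have "\<exists>B. \<forall>c k. finite (B c k) \<and> (\<forall>x :: 'f. absF x \<le> real c \<longrightarrow> (\<exists>b\<in>B c k. dist x b < 1 / Suc k))"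
    by (intro choice allI)
  then obtain B :: "nat \<Rightarrow> nat \<Rightarrow> 'f set" where B: "\<And>c k. finite (B c k)"
    "\<And>c k x. absF x \<le> real c \<Longrightarrow> \<exists>b\<in>B c k. dist x b < 1 / Suc k"
    by blast
  show ?thesis
  proof (rule that[of "\<Union>c k. B c k"])
    show "countable (\<Union>c k. B c k)"
      using B(1) by (intro countable_UN) (auto intro: countable_finite)
    fix x :: 'f and e :: real assume "e > 0"
    then obtain k where "1 / real (Suc k) < e"
      by (metis inverse_eq_divide reals_Archimedean)
    moreover obtain c :: nat where "absF x \<le> real c"
      using real_arch_simple by blast
    ultimately show "\<exists>d\<in>\<Union>c k. B c k. dist x d < e"
      using B(2)[of x c k] by force
  qed
qed


section \<open>Averaging over a compact group\<close>

text \<open>Restricted to the group, so that translates which agree there are equal as functions and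
  the set of all translates can be finite.\<close>

definition right_translate :: "nat \<Rightarrow> ('f::padic_field mat \<Rightarrow> 'w) \<Rightarrow> 'f mat \<Rightarrow> 'f mat \<Rightarrow> 'w" where
  "right_translate r \<xi> k = (\<lambda>h\<in>carrier (SO_even r). \<xi> (h * k))"

text \<open>Integral matrices form a totally bounded set: two of them whose entries have equal
  roundings differ by a factor near 1, and after conjugation this factor still lies in the open
  stabilizer of \<open>\<xi>\<close>. So a translate depends only on the rounding, and there are
  finitely many roundings.\<close>

lemma finite_right_translates:
  fixes \<xi> :: "'f::padic_field mat \<Rightarrow> 'w" and c :: 'f
  assumes c: "c \<noteq> 0" and K: "K \<subseteq> SO_even_int r"
    and smooth: "openin (group_topology (SO_even r))
      {k \<in> carrier (SO_even r). \<forall>h\<in>carrier (SO_even r). \<xi> (h * k) = \<xi> h}"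
      (is "openin _ ?V")
  shows "finite (right_translate r \<xi> ` scale_conj c r ` K)"
proof -
  have "1\<^sub>m (2 * r) \<in> ?V"
    by (auto simp: SO_even_one_mult)
  then obtain e where e: "e > 0" "\<And>x. x \<in> carrier (SO_even r) \<Longrightarrow> mat_close (2 * r) e (1\<^sub>m (2 * r)) x \<Longrightarrow> x \<in> ?V"
    using smooth unfolding openin_SO_even by blast
  \<comment> \<open>Bounds the factors by which conjugation with \<open>c\<close> multiplies the
    entries.\<close>
  define M where "M = max 1 (max (absF c) (absF (inverse c)))"
  have M: "M > 0"
    by (simp add: M_def)
  define e' where "e' = e / M"
  have e': "e' > 0"
    using e M by (simp add: e'_def)
  have e'M: "e' * M = e"
    using M by (simp add: e'_def)
  obtain B :: "'f set" where B: "finite B" "\<And>x. absF x \<le> 1 \<Longrightarrow> \<exists>b\<in>B. dist x b < e'"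
    using ball_net[OF e'] by blast
  then obtain \<beta> where \<beta>: "\<And>x. absF x \<le> 1 \<Longrightarrow> \<beta> x \<in> B \<and> dist x (\<beta> x) < e'"
    by metis
  let ?I = "{..<2 * r} \<times> {..<2 * r}"
  \<comment> \<open>The rounding of all entries to the finite net \<open>B\<close>.\<close>
  define \<rho> where "\<rho> k = (\<lambda>ij\<in>?I. \<beta> (k $$ ij))" for k :: "'f mat"
  have same: "right_translate r \<xi> (scale_conj c r k) = right_translate r \<xi> (scale_conj c r l)"
    if k: "k \<in> K" and l: "l \<in> K" and eq: "\<rho> k = \<rho> l" for k l
  proof -
    have kc: "k \<in> carrier (SO_even r)" "l \<in> carrier (SO_even r)"
      and ki: "\<And>i j. i < 2 * r \<Longrightarrow> j < 2 * r \<Longrightarrow> absF (k $$ (i, j)) \<le> 1"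
        "\<And>i j. i < 2 * r \<Longrightarrow> j < 2 * r \<Longrightarrow> absF (l $$ (i, j)) \<le> 1"
      using k l K by (auto simp: SO_even_int_iff)
    have km: "k \<in> carrier_mat (2 * r) (2 * r)" "l \<in> carrier_mat (2 * r) (2 * r)"
      using kc by (auto simp: carrier_SO_even)
    have close: "mat_close (2 * r) e' k l"
      unfolding mat_close_def
    proof (intro allI impI)
      fix i j assume ij: "i < 2 * r" "j < 2 * r"
      then have "\<beta> (k $$ (i, j)) = \<beta> (l $$ (i, j))"
        using fun_cong[OF eq, of "(i, j)"] by (simp add: \<rho>_def)
      then have "dist (k $$ (i, j)) (\<beta> (k $$ (i, j))) < e'" "dist (l $$ (i, j)) (\<beta> (k $$ (i, j))) < e'"
        using \<beta>[OF ki(1)[OF ij]] \<beta>[OF ki(2)[OF ij]] by auto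
      then show "dist (l $$ (i, j)) (k $$ (i, j)) < e'"
        using absF_diff[of "l $$ (i, j) - \<beta> (k $$ (i, j))" "k $$ (i, j) - \<beta> (k $$ (i, j))"]
        by (auto simp: dist_absF)
    qed
    have ak: "atr k \<in> carrier (SO_even r)" "atr k \<in> SO_even_int r"
      using SO_even_atr(3)[OF kc(1)] SO_even_int_atr[of k r] k K by auto
    define x where "x = atr k * l"
    have xc: "x \<in> carrier (SO_even r)"
      unfolding x_def by (rule SO_even_mult_closed[OF ak(1) kc(2)])
    \<comment> \<open>Multiplication by the integral inverse of \<open>k\<close> does not increase
      distances.\<close>
    have "mat_close (2 * r) e' (atr k * k) (atr k * l)"
      using ak close e' km
      by (intro mat_close_mult_left[where c = 1]) (auto simp: SO_even_int_iff)
    then have x1: "mat_close (2 * r) e' (1\<^sub>m (2 * r)) x"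
      using SO_even_atr(2)[OF kc(1)] by (simp add: x_def)
    have "mat_close (2 * r) e (1\<^sub>m (2 * r)) (scale_conj c r x)"
      unfolding mat_close_def
    proof (intro allI impI)
      fix i j assume ij: "i < 2 * r" "j < 2 * r"
      let ?u = "if i < r then inverse c else 1" and ?v = "if j < r then c else 1"
      have "scale_conj c r x $$ (i, j) - 1\<^sub>m (2 * r) $$ (i, j) = ?u * ?v * (x $$ (i, j) - 1\<^sub>m (2 * r) $$ (i, j))"
        using ij c by (auto simp: scale_conj_def algebra_simps)
      then have "dist (scale_conj c r x $$ (i, j)) (1\<^sub>m (2 * r) $$ (i, j)) =
          absF (?u * ?v) * dist (x $$ (i, j)) (1\<^sub>m (2 * r) $$ (i, j))"
        by (simp only: dist_absF absF_mult)
      also have "\<dots> \<le> M * dist (x $$ (i, j)) (1\<^sub>m (2 * r) $$ (i, j))"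
      proof (rule mult_right_mono)
        have "?u * ?v \<in> {1, c, inverse c}"
          using c by auto
        then show "absF (?u * ?v) \<le> M"
          unfolding M_def by (auto simp: le_max_iff_disj)
      qed simp
      also have "\<dots> < M * e'"
        using x1 ij M unfolding mat_close_def by (intro mult_strict_left_mono) auto
      finally show "dist (scale_conj c r x $$ (i, j)) (1\<^sub>m (2 * r) $$ (i, j)) < e"
        using e'M by (simp add: mult.commute)
    qed
    then have "scale_conj c r x \<in> ?V"
      by (intro e(2) scale_conj_in_SO_even[OF c xc])
    moreover have "scale_conj c r l = scale_conj c r k * scale_conj c r x"
    proof -
      have "k * x = l"
        unfolding x_def using SO_even_atr(1)[OF kc(1)] kc ak by (simp add: SO_even_one_mult flip: SO_even_assoc)
      then show ?thesis
        using scale_conj_mult[OF c km(1) SO_even_carrier_mat[OF xc]] by simp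
    qed
    ultimately have "\<xi> (h * scale_conj c r l) = \<xi> (h * scale_conj c r k)" if "h \<in> carrier (SO_even r)" for h
      using that scale_conj_in_SO_even[OF c kc(1)] by (auto simp: SO_even_mult_closed simp flip: SO_even_assoc)
    then show ?thesis
      unfolding right_translate_def by (intro restrict_ext) simp
  qed
  have "\<rho> k \<in> Pi\<^sub>E ?I (\<lambda>_. B)" if "k \<in> K" for k
    using that K \<beta> unfolding \<rho>_def by (intro restrict_PiE_iff[THEN iffD2]) (auto simp: SO_even_int_iff)
  then have "\<rho> ` K \<subseteq> Pi\<^sub>E ?I (\<lambda>_. B)"
    by blast
  then have "finite (\<rho> ` K)"
    by (rule finite_subset) (intro finite_PiE finite_SigmaI B finite_lessThan)
  moreover have "right_translate r \<xi> ` scale_conj c r ` K \<subseteq>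
      (\<lambda>f. right_translate r \<xi> (scale_conj c r (SOME k. k \<in> K \<and> \<rho> k = f))) ` \<rho> ` K"
  proof
    fix f assume "f \<in> right_translate r \<xi> ` scale_conj c r ` K"
    then obtain k where k: "k \<in> K" "f = right_translate r \<xi> (scale_conj c r k)"
      by blast
    have "(SOME l. l \<in> K \<and> \<rho> l = \<rho> k) \<in> K \<and> \<rho> (SOME l. l \<in> K \<and> \<rho> l = \<rho> k) = \<rho> k"
      by (rule someI[of "\<lambda>l. l \<in> K \<and> \<rho> l = \<rho> k" k]) (use k in simp)
    then have "f = right_translate r \<xi> (scale_conj c r (SOME l. l \<in> K \<and> \<rho> l = \<rho> k))"
      unfolding k(2) using same k(1) by metis
    then show "f \<in> (\<lambda>f. right_translate r \<xi> (scale_conj c r (SOME k. k \<in> K \<and> \<rho> k = f))) ` \<rho> ` K"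
      using k(1) by blast
  qed
  ultimately show ?thesis
    by (meson finite_imageI finite_subset)
qed

text \<open>
  The sum over the translates is invariant under \<open>K\<close>, so its value at the identity is fixed by
  $\mathrm{GL}_r(\mathfrak o)$.
\<close>

lemma sum_right_translates_eq_0:
  fixes \<tau> :: "'f::padic_field mat \<Rightarrow> 'w::ab_group_add \<Rightarrow> 'w"
  assumes rep: "smooth_representation sc (GL r) \<tau>" and \<xi>: "\<xi> \<in> induced_space r sc \<tau> s"
    and ram: "fixed_vectors \<tau> (GL_int r) = {0}"
    and K: "K \<subseteq> carrier (SO_even r)" "\<And>k l. k \<in> K \<Longrightarrow> l \<in> K \<Longrightarrow> k * l \<in> K" "\<And>k. k \<in> K \<Longrightarrow> atr k \<in> K"
    and mK: "\<And>a. a \<in> GL_int r \<Longrightarrow> m_Siegel r a \<in> K"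
    and iw: "\<And>h. h \<in> carrier (SO_even r) \<Longrightarrow>
      \<exists>a\<in>carrier (GL r). \<exists>u\<in>N_Siegel r. \<exists>k\<in>K. h = m_Siegel r a * u * k"
    and fin: "finite (right_translate r \<xi> ` K)"
    and h: "h \<in> carrier (SO_even r)"
  shows "(\<Sum>\<eta>\<in>right_translate r \<xi> ` K. \<eta> h) = 0"
proof -
  interpret smooth_representation sc "GL r" \<tau>
    by (rule rep)
  let ?H = "carrier (SO_even r) :: 'f mat set" and ?X = "right_translate r \<xi> ` K"
  define S where "S g = (\<Sum>\<eta>\<in>?X. \<eta> g)" for g
  have inv: "S (g * k) = S g" if g: "g \<in> ?H" and k: "k \<in> K" for g k
  proof -
    \<comment> \<open>Translation by \<open>k\<close> permutes the finite set of translates. So the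
      sum over this set, in which coinciding translates count once, is invariant.\<close>
    define \<phi> where "\<phi> l \<eta> = (\<lambda>g\<in>?H. \<eta> (g * l) :: 'w)" for l \<eta>
    have \<phi>: "\<phi> l (right_translate r \<xi> x) = right_translate r \<xi> (l * x)" if "l \<in> K" "x \<in> K" for l x
      unfolding \<phi>_def right_translate_def
    proof (rule restrict_ext)
      fix g assume g: "g \<in> ?H"
      have lx: "l \<in> ?H" "x \<in> ?H"
        using that K by auto
      show "(\<lambda>h\<in>?H. \<xi> (h * x)) (g * l) = \<xi> (g * (l * x))"
        using SO_even_mult_closed[OF g lx(1)] by (simp add: SO_even_assoc[OF g lx])
    qed
    have kk: "atr k * (k * x) = x" "k * (atr k * x) = x" if "x \<in> K" for x
    proof -
      have c: "x \<in> ?H" "k \<in> ?H"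
        using that k K by auto
      note a = SO_even_atr[OF c(2)]
      show "atr k * (k * x) = x" "k * (atr k * x) = x"
        using c a by (simp_all add: SO_even_one_mult flip: SO_even_assoc)
    qed
    have "bij_betw (\<phi> k) ?X ?X"
    proof (rule bij_betw_byWitness[where f' = "\<phi> (atr k)"])
      show "\<forall>\<eta>\<in>?X. \<phi> (atr k) (\<phi> k \<eta>) = \<eta>" "\<forall>\<eta>\<in>?X. \<phi> k (\<phi> (atr k) \<eta>) = \<eta>"
        using k K kk by (auto simp: \<phi>)
      show "\<phi> k ` ?X \<subseteq> ?X" "\<phi> (atr k) ` ?X \<subseteq> ?X"
        using k K by (auto simp: \<phi>)
    qed
    then have "S g = (\<Sum>\<eta>\<in>?X. \<phi> k \<eta> g)"
      unfolding S_def by (rule sum.reindex_bij_betw[symmetric])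
    also have "\<dots> = S (g * k)"
      unfolding S_def \<phi>_def using g by simp
    finally show ?thesis
      by simp
  qed
  have equiv: "S (m_Siegel r a * u * g) =
      sc (complex_of_real (sqrt (delta_Siegel r a)) * complex_of_real (nu a) powr (s - 1 / 2)) (\<tau> a (S g))"
    if a: "a \<in> carrier (GL r)" "u \<in> N_Siegel r" and g: "g \<in> ?H" for a u g
  proof -
    let ?c = "complex_of_real (sqrt (delta_Siegel r a)) * complex_of_real (nu a) powr (s - 1 / 2)"
    have lin: "module_hom sc sc (\<tau> a)"
      by (rule module_hom_iff_linear[THEN iffD2, OF rep_linear[OF a(1)]])
    have "\<eta> (m_Siegel r a * u * g) = sc ?c (\<tau> a (\<eta> g))" if "\<eta> \<in> ?X" for \<eta>
    proof -
      obtain k where k: "k \<in> K" "\<eta> = right_translate r \<xi> k"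
        using \<open>\<eta> \<in> ?X\<close> by blast
      have "k \<in> ?H"
        using k K by blast
      then have "\<xi> (m_Siegel r a * u * g * k) = sc ?c (\<tau> a (\<xi> (g * k)))"
        using induced_space_equivariant[OF \<xi> a SO_even_mult_closed[OF g \<open>k \<in> ?H\<close>]] parabolic_in_SO_even[OF a] g
        by (simp add: SO_even_assoc)
      then show ?thesis
        unfolding k(2) right_translate_def using SO_even_mult_closed[OF parabolic_in_SO_even[OF a] g] g by simp
    qed
    then have "S (m_Siegel r a * u * g) = (\<Sum>\<eta>\<in>?X. sc ?c (\<tau> a (\<eta> g)))"
      unfolding S_def by simp
    also have "\<dots> = sc ?c (\<tau> a (S g))"
      unfolding S_def by (simp add: module_hom.sum[OF lin] scale_sum_right)
    finally show ?thesis .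
  qed
  let ?e = "1\<^sub>m (2 * r) :: 'f mat"
  have "\<tau> a (S ?e) = S ?e" if a: "a \<in> GL_int r" for a
  proof -
    have m: "m_Siegel r a \<in> ?H"
      using mK[OF a] K by blast
    have nu: "nu a = 1"
      using a by (simp add: GL_int_def nu_def)
    have "S ?e = S (?e * m_Siegel r a)"
      using inv[OF one_in_SO_even mK[OF a]] by simp
    \<comment> \<open>The same element is read as a right translation by \<open>K\<close> and as a
      left multiplication by the parabolic. Since \<open>nu a = 1\<close>, the latter amounts to
      applying \<open>\<tau> a\<close>.\<close>
    also have "?e * m_Siegel r a = m_Siegel r a * ?e * ?e"
      using m by (simp add: SO_even_one_mult)
    also have "S (m_Siegel r a * ?e * ?e) = \<tau> a (S ?e)"
      using equiv[OF GL_int_carrier[OF a] one_in_N_Siegel one_in_SO_even] by (simp add: nu delta_Siegel_def)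
    finally show ?thesis
      by simp
  qed
  then have "S ?e \<in> fixed_vectors \<tau> (GL_int r)"
    by (simp add: fixed_vectors_def)
  then have e: "S ?e = 0"
    using ram by simp
  obtain a u k where k: "a \<in> carrier (GL r)" "u \<in> N_Siegel r" "k \<in> K" "h = m_Siegel r a * u * k"
    using iw[OF h] by blast
  have "S h = S (m_Siegel r a * u * ?e)"
    using inv[OF parabolic_in_SO_even[OF k(1,2)] k(3)] parabolic_in_SO_even[OF k(1,2)]
    by (simp add: k(4) SO_even_one_mult)
  also have "\<dots> = 0"
    using equiv[OF k(1,2) one_in_SO_even] module_hom.zero[OF module_hom_iff_linear[THEN iffD2, OF rep_linear[OF k(1)]]]
    by (simp add: e)
  finally show ?thesis
    by (simp add: S_def)
qed


section \<open>Haar measures on the group of lower unipotent matrices\<close>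

lemma X_bar_mat_mult:
  fixes x y :: "'f::padic_field mat"
  assumes r: "r \<le> n" and x: "x \<in> carrier_mat (n - r) r" and y: "y \<in> carrier_mat (n - r) r"
  shows "X_bar_mat n r x * X_bar_mat n r y = X_bar_mat n r (x + y)"
proof -
  note g = lower_x_GL(1)[OF r x] lower_x_GL(1)[OF r y]
  have xy: "x + y \<in> carrier_mat (n - r) r"
    using x y by simp
  show ?thesis
    unfolding X_bar_mat_eq[OF r x] X_bar_mat_eq[OF r y] X_bar_mat_eq[OF r xy]
      embed_SO_mult[OF order_refl SO_even_carrier_mat[OF m_Siegel_in_SO_even[OF g(1)]]
        SO_even_carrier_mat[OF m_Siegel_in_SO_even[OF g(2)]], symmetric]
      m_Siegel_mult[OF g] lower_x_mult[OF r x y] ..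
qed

section \<open>The topology of the lower unipotent group in its coordinate x\<close>

lemma X_bar_mat_carrier [simp, intro]: "X_bar_mat n r x \<in> carrier_mat (2 * n + 1) (2 * n + 1)"
  by (simp add: X_bar_mat_def Let_def)

lemma index_X_bar_mat:
  assumes "r \<le> n" "i < n - r" "j < r"
  shows "X_bar_mat n r x $$ (i + r, j) = x $$ (i, j)"
  using assms by (auto simp: X_bar_mat_def Let_def)

definition x_close :: "nat \<Rightarrow> nat \<Rightarrow> real \<Rightarrow> 'f::padic_field mat \<Rightarrow> 'f mat \<Rightarrow> bool" where
  "x_close n r e x y \<longleftrightarrow> (\<forall>i<n - r. \<forall>j<r. dist (y $$ (i, j)) (x $$ (i, j)) < e)"

lemma mat_close_X_bar_mat:
  fixes x y :: "'f::padic_field mat"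
  assumes r: "r \<le> n" and x: "x \<in> carrier_mat (n - r) r" and y: "y \<in> carrier_mat (n - r) r" and e: "e > 0"
  shows "mat_close (2 * n + 1) e (X_bar_mat n r x) (X_bar_mat n r y) \<longleftrightarrow> x_close n r e x y"
proof
  assume *: "mat_close (2 * n + 1) e (X_bar_mat n r x) (X_bar_mat n r y)"
  show "x_close n r e x y"
    unfolding x_close_def
  proof (intro allI impI)
    fix i j assume ij: "i < n - r" "j < r"
    then have "i + r < 2 * n + 1" "j < 2 * n + 1"
      using r by auto
    then show "dist (y $$ (i, j)) (x $$ (i, j)) < e"
      using * index_X_bar_mat[OF r ij, of x] index_X_bar_mat[OF r ij, of y] unfolding mat_close_def by metis
  qed
next
  assume *: "x_close n r e x y"
  show "mat_close (2 * n + 1) e (X_bar_mat n r x) (X_bar_mat n r y)"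
    unfolding mat_close_def
  proof (intro allI impI)
    fix i j assume ij: "i < 2 * n + 1" "j < 2 * n + 1"
    have low: "dist (y $$ (i - r, j)) (x $$ (i - r, j)) < e" if "r \<le> i" "i < n" "j < r"
      using * that unfolding x_close_def by auto
    have up: "dist ((- atr y) $$ (i - (2 * n + 1 - r), j - (n + 1))) ((- atr x) $$ (i - (2 * n + 1 - r), j - (n + 1))) < e"
      if "2 * n + 1 - r \<le> i" "n + 1 \<le> j" "j < 2 * n + 1 - r"
    proof -
      define k l where "k = i - (2 * n + 1 - r)" and "l = j - (n + 1)"
      have l: "k < r" "l < n - r"
        using that ij r by (auto simp: k_def l_def)
      have "dist (y $$ (n - r - 1 - l, r - 1 - k)) (x $$ (n - r - 1 - l, r - 1 - k)) < e"
        using * l unfolding x_close_def by auto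
      moreover have "dist (- a) (- b) = dist a b" for a b :: 'f
        using absF_uminus[of "a - b"] by (simp add: dist_absF)
      ultimately show ?thesis
        unfolding k_def[symmetric] l_def[symmetric]
        using l x y by (simp add: index_atr[OF x l] index_atr[OF y l] del: diff_diff_left)
    qed
    show "dist (X_bar_mat n r y $$ (i, j)) (X_bar_mat n r x $$ (i, j)) < e"
      using low up e ij unfolding X_bar_mat_def antidiag_conj[OF x] antidiag_conj[OF y] Let_def
      by (auto simp del: One_nat_def)
  qed
qed

lemma X_bar_mat_inj:
  assumes r: "r \<le> n" and x: "x \<in> carrier_mat (n - r) r" and y: "y \<in> carrier_mat (n - r) r"
    and eq: "X_bar_mat n r x = X_bar_mat n r y"
  shows "x = y"
  by (rule eq_matI) (use x y index_X_bar_mat[OF r] eq in \<open>auto simp flip: index_X_bar_mat[OF r]\<close>)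

abbreviation X_set :: "nat \<Rightarrow> nat \<Rightarrow> 'f::padic_field mat set" where
  "X_set n r \<equiv> X_bar_mat n r ` carrier_mat (n - r) r"

lemma X_set_subset: "X_set n r \<subseteq> carrier_mat (2 * n + 1) (2 * n + 1)"
  by (intro image_subsetI X_bar_mat_carrier)

lemma openin_X_bar:
  fixes U :: "'f::padic_field mat set"
  assumes r: "r \<le> n"
  shows "openin (group_topology (X_bar n r)) U \<longleftrightarrow> U \<subseteq> X_set n r \<and>
    (\<forall>x\<in>carrier_mat (n - r) r. X_bar_mat n r x \<in> U \<longrightarrow>
      (\<exists>e>0. \<forall>y\<in>carrier_mat (n - r) r. x_close n r e x y \<longrightarrow> X_bar_mat n r y \<in> U))"
proof -
  let ?M = "carrier_mat (n - r) r :: 'f mat set"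
  have "(\<forall>g\<in>U. \<exists>e>0. \<forall>h\<in>X_set n r. mat_close (2 * n + 1) e g h \<longrightarrow> h \<in> U) \<longleftrightarrow>
      (\<forall>x\<in>?M. X_bar_mat n r x \<in> U \<longrightarrow>
        (\<exists>e>0. \<forall>y\<in>?M. mat_close (2 * n + 1) e (X_bar_mat n r x) (X_bar_mat n r y) \<longrightarrow> X_bar_mat n r y \<in> U))"
    if U: "U \<subseteq> X_set n r"
  proof -
    have *: "(\<forall>g\<in>U. Q g) \<longleftrightarrow> (\<forall>x\<in>?M. X_bar_mat n r x \<in> U \<longrightarrow> Q (X_bar_mat n r x))" for Q
    proof (intro iffI ballI impI)
      fix g assume "\<forall>x\<in>?M. X_bar_mat n r x \<in> U \<longrightarrow> Q (X_bar_mat n r x)" "g \<in> U"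
      then show "Q g"
        using subsetD[OF U \<open>g \<in> U\<close>] by (elim imageE) simp
    qed simp
    show ?thesis
      unfolding * by (simp only: ball_simps)
  qed
  moreover have "(\<forall>x\<in>?M. X_bar_mat n r x \<in> U \<longrightarrow>
        (\<exists>e>0. \<forall>y\<in>?M. mat_close (2 * n + 1) e (X_bar_mat n r x) (X_bar_mat n r y) \<longrightarrow> X_bar_mat n r y \<in> U)) \<longleftrightarrow>
      (\<forall>x\<in>?M. X_bar_mat n r x \<in> U \<longrightarrow>
      (\<exists>e>0. \<forall>y\<in>?M. x_close n r e x y \<longrightarrow> X_bar_mat n r y \<in> U))"
    using mat_close_X_bar_mat[OF r] by (intro ball_cong imp_cong ex_cong1 conj_cong refl) auto
  ultimately show ?thesis
    unfolding X_bar_def openin_group_topology[OF X_set_subset] by (intro conj_cong refl) (simp only:)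
qed

lemma topspace_X_bar: "topspace (group_topology (X_bar n r)) = X_set n r"
  unfolding X_bar_def by (rule topspace_group_topology[OF X_set_subset])

text \<open>
  The weights \<open>c ^ j\<close> are there so that right multiplication by a unipotent matrix permutes the balls
  of a given radius, once \<open>c\<close> bounds its entries.
\<close>

definition x_ball :: "nat \<Rightarrow> nat \<Rightarrow> real \<Rightarrow> real \<Rightarrow> 'f::padic_field mat \<Rightarrow> 'f mat set" where
  "x_ball n r c e x = {y \<in> carrier_mat (n - r) r. \<forall>i<n - r. \<forall>j<r. absF (y $$ (i, j) - x $$ (i, j)) \<le> e * c ^ j}"

lemma x_ball_subset: "x_ball n r c e x \<subseteq> carrier_mat (n - r) r"
  by (auto simp: x_ball_def)

text \<open>In an ultrametric every point of a ball is a centre.\<close>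

lemma x_ball_eq:
  assumes y: "y \<in> x_ball n r c e x"
  shows "x_ball n r c e y = x_ball n r c e x"
proof -
  have "absF (z $$ (i, j) - y $$ (i, j)) \<le> e * c ^ j \<longleftrightarrow> absF (z $$ (i, j) - x $$ (i, j)) \<le> e * c ^ j"
    if ij: "i < n - r" "j < r" for z i j
  proof -
    have xy: "absF (y $$ (i, j) - x $$ (i, j)) \<le> e * c ^ j"
      using y ij by (simp add: x_ball_def)
    show ?thesis
      using absF_add[of "z $$ (i, j) - y $$ (i, j)" "y $$ (i, j) - x $$ (i, j)"] xy
        absF_diff[of "z $$ (i, j) - x $$ (i, j)" "y $$ (i, j) - x $$ (i, j)"] by auto
  qed
  then show ?thesis
    unfolding x_ball_def by auto
qed

lemma x_ball_mono:
  assumes "e \<le> e'" "c \<ge> 1"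
  shows "x_ball n r c e x \<subseteq> x_ball n r c e' x"
proof -
  have "e * c ^ j \<le> e' * c ^ j" for j
    using assms by (intro mult_right_mono) auto
  then show ?thesis
    unfolding x_ball_def by (auto intro: order.trans)
qed

text \<open>Recentred at a common point, two balls are nested. Together with the empty set they are
  therefore stable under intersection.\<close>

lemma x_ball_Int:
  assumes "x_ball n r c e x \<inter> x_ball n r c e' x' \<noteq> {}" "c \<ge> 1"
  shows "x_ball n r c e x \<inter> x_ball n r c e' x' \<in> {x_ball n r c e x, x_ball n r c e' x'}"
proof -
  obtain z where z: "z \<in> x_ball n r c e x" "z \<in> x_ball n r c e' x'"
    using assms by blast
  show ?thesis
    unfolding x_ball_eq[OF z(1), symmetric] x_ball_eq[OF z(2), symmetric]
    using x_ball_mono[of e e' c n r z] x_ball_mono[of e' e c n r z] assms(2) by (cases "e \<le> e'") auto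
qed

lemma x_close_imp_x_ball:
  assumes "x_close n r e x y" "y \<in> carrier_mat (n - r) r" "c \<ge> 1" "e > 0"
  shows "y \<in> x_ball n r c e x"
proof -
  have "absF (y $$ (i, j) - x $$ (i, j)) \<le> e * c ^ j" if "i < n - r" "j < r" for i j
  proof -
    have "absF (y $$ (i, j) - x $$ (i, j)) \<le> e"
      using assms(1) that by (auto simp: x_close_def dist_absF less_imp_le)
    also have "\<dots> \<le> e * c ^ j"
      using assms by simp
    finally show ?thesis .
  qed
  then show ?thesis
    using assms(2) by (simp add: x_ball_def)
qed

lemma X_bar_mat_in_image_iff:
  assumes r: "r \<le> n" and x: "x \<in> carrier_mat (n - r) r" and S: "S \<subseteq> carrier_mat (n - r) r"
  shows "X_bar_mat n r x \<in> X_bar_mat n r ` S \<longleftrightarrow> x \<in> S"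
  using X_bar_mat_inj[OF r x] S by blast

lemma openin_x_ball:
  assumes r: "r \<le> n" and c: "c \<ge> 1" and e: "e > 0"
  shows "openin (group_topology (X_bar n r)) (X_bar_mat n r ` x_ball n r c e x)"
  unfolding openin_X_bar[OF r]
proof (intro conjI ballI impI)
  show "X_bar_mat n r ` x_ball n r c e x \<subseteq> X_set n r"
    using x_ball_subset by blast
  fix y :: "'a mat" assume y: "y \<in> carrier_mat (n - r) r" "X_bar_mat n r y \<in> X_bar_mat n r ` x_ball n r c e x"
  then have "y \<in> x_ball n r c e x"
    using X_bar_mat_in_image_iff[OF r y(1) x_ball_subset] by blast
  then have "X_bar_mat n r z \<in> X_bar_mat n r ` x_ball n r c e x"
    if "z \<in> carrier_mat (n - r) r" "x_close n r e y z" for z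
    using x_close_imp_x_ball[OF that(2,1) c e] by (simp add: x_ball_eq)
  then show "\<exists>e'>0. \<forall>z\<in>carrier_mat (n - r) r. x_close n r e' y z \<longrightarrow>
      X_bar_mat n r z \<in> X_bar_mat n r ` x_ball n r c e x"
    using e by blast
qed

text \<open>The coordinates give a continuous map from a finite product of copies of the field, and
  the ball is the image of a product of compact balls.\<close>

lemma compactin_x_ball:
  fixes x :: "'f::padic_field mat"
  assumes r: "r \<le> n" and x: "x \<in> carrier_mat (n - r) r"
  shows "compactin (group_topology (X_bar n r)) (X_bar_mat n r ` x_ball n r c e x)"
proof -
  let ?I = "{..<n - r} \<times> {..<r}"
  let ?T = "product_topology (\<lambda>_. euclidean :: 'f topology) ?I"
  define F where "F p = X_bar_mat n r (mat (n - r) r p)" for p :: "nat \<times> nat \<Rightarrow> 'f"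
  have cont: "continuous_map ?T (group_topology (X_bar n r)) F"
    unfolding continuous_map
  proof (intro conjI allI impI)
    show "F ` topspace ?T \<subseteq> topspace (group_topology (X_bar n r))"
      unfolding topspace_X_bar F_def by auto
    fix U :: "'f mat set" assume U: "openin (group_topology (X_bar n r)) U"
    show "openin ?T {p \<in> topspace ?T. F p \<in> U}"
    proof (subst openin_subopen, intro ballI)
      fix p assume p: "p \<in> {p \<in> topspace ?T. F p \<in> U}"
      have "mat (n - r) r p \<in> carrier_mat (n - r) r" "X_bar_mat n r (mat (n - r) r p) \<in> U"
        using p by (auto simp: F_def)
      then obtain d where d: "d > 0" "\<And>y. y \<in> carrier_mat (n - r) r \<Longrightarrow> x_close n r d (mat (n - r) r p) y \<Longrightarrow> X_bar_mat n r y \<in> U"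
        using U unfolding openin_X_bar[OF r] by blast
      let ?V = "Pi\<^sub>E ?I (\<lambda>ij. ball (p ij) d)"
      have "openin ?T ?V"
        unfolding openin_PiE_gen by (intro disjI2 conjI ballI) (simp_all add: open_openin[symmetric])
      moreover have "p \<in> ?V"
        using p d by auto
      moreover have "?V \<subseteq> {p \<in> topspace ?T. F p \<in> U}"
      proof
        fix p' assume p': "p' \<in> ?V"
        then have "p' \<in> topspace ?T"
          by auto
        moreover have "x_close n r d (mat (n - r) r p) (mat (n - r) r p')"
          unfolding x_close_def
        proof (intro allI impI)
          fix i j assume ij: "i < n - r" "j < r"
          then show "dist (mat (n - r) r p' $$ (i, j)) (mat (n - r) r p $$ (i, j)) < d"
            using PiE_mem[OF p', of "(i, j)"] by (simp add: dist_commute)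
        qed
        ultimately show "p' \<in> {p \<in> topspace ?T. F p \<in> U}"
          using d(2) by (simp add: F_def)
      qed
      ultimately show "\<exists>V. openin ?T V \<and> p \<in> V \<and> V \<subseteq> {p \<in> topspace ?T. F p \<in> U}"
        by blast
    qed
  qed
  define S where "S ij = (\<lambda>t. x $$ ij + t) ` {t. absF t \<le> e * c ^ snd ij}" for ij
  have "compact (S ij)" for ij
  proof -
    have "continuous_on UNIV (\<lambda>t. x $$ ij + t)"
      unfolding continuous_on_iff by (auto simp: dist_absF)
    then show ?thesis
      unfolding S_def by (intro compact_continuous_image compact_ball) (auto intro: continuous_on_subset)
  qed
  then have "compactin ?T (Pi\<^sub>E ?I S)"
    by (simp add: compactin_PiE)
  then have "compactin (group_topology (X_bar n r)) (F ` Pi\<^sub>E ?I S)"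
    by (rule image_compactin[OF _ cont])
  moreover have "F ` Pi\<^sub>E ?I S = X_bar_mat n r ` x_ball n r c e x"
  proof (intro equalityI subsetI)
    fix g assume "g \<in> F ` Pi\<^sub>E ?I S"
    then obtain p where p: "p \<in> Pi\<^sub>E ?I S" "g = F p"
      by blast
    have "mat (n - r) r p \<in> x_ball n r c e x"
      unfolding x_ball_def
    proof (intro CollectI conjI allI impI)
      fix i j assume "i < n - r" "j < r"
      then show "absF (mat (n - r) r p $$ (i, j) - x $$ (i, j)) \<le> e * c ^ j"
        using PiE_mem[OF p(1), of "(i, j)"] by (auto simp: S_def)
    qed simp
    then show "g \<in> X_bar_mat n r ` x_ball n r c e x"
      by (simp add: p F_def)
  next
    fix g assume "g \<in> X_bar_mat n r ` x_ball n r c e x"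
    then obtain y where y: "y \<in> x_ball n r c e x" "g = X_bar_mat n r y"
      by blast
    define p where "p = (\<lambda>ij\<in>?I. y $$ ij)"
    have "p ij \<in> S ij" if "ij \<in> ?I" for ij
      using that y unfolding S_def p_def x_ball_def
      by (auto intro!: image_eqI[of _ _ "y $$ ij - x $$ ij"])
    then have "p \<in> Pi\<^sub>E ?I S"
      by (auto simp: p_def)
    moreover have "mat (n - r) r p = y"
      using y by (intro eq_matI) (auto simp: p_def x_ball_def)
    ultimately show "g \<in> F ` Pi\<^sub>E ?I S"
      using y(2) unfolding F_def by blast
  qed
  ultimately show ?thesis
    by simp
qed

definition x_balls :: "nat \<Rightarrow> nat \<Rightarrow> real \<Rightarrow> 'f::padic_field mat set set" where
  "x_balls n r c = insert {} {X_bar_mat n r ` x_ball n r c e x |e x. e > 0 \<and> x \<in> carrier_mat (n - r) r}"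

text \<open>Every open set is the union of those balls inside it that have radius parameter 1 / (k +
  1) and a centre from a countable dense set. Hence the balls of any fixed weight \<open>c\<close>
  generate the Borel sets.\<close>

lemma sets_borel_X_bar:
  fixes c :: real
  assumes r: "r \<le> n" and c: "c \<ge> 1"
  shows "sets (borel_of (group_topology (X_bar n r))) = sigma_sets (X_set n r) (x_balls n r c :: 'f::padic_field mat set set)"
proof -
  let ?T = "group_topology (X_bar n r :: 'f mat monoid)" and ?M = "carrier_mat (n - r) r :: 'f mat set"
  have "sets (borel_of ?T) = sigma_sets (X_set n r) {U. openin ?T U}"
    unfolding borel_of_def topspace_X_bar
    by (rule sets_measure_of) (use openin_subset[of ?T] in \<open>auto simp: topspace_X_bar\<close>)
  also have "\<dots> = sigma_sets (X_set n r) (x_balls n r c)"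
  proof (rule sigma_sets_eqI)
    fix U :: "'f mat set" assume "U \<in> {U. openin ?T U}"
    then have U: "openin ?T U"
      by simp
    obtain D :: "'f set" where D: "countable D" "\<And>x e. e > 0 \<Longrightarrow> \<exists>d\<in>D. dist x d < e"
      using countable_dense by blast
    define N where "N = mat (n - r) r ` Pi\<^sub>E ({..<n - r} \<times> {..<r}) (\<lambda>_. D)"
    have N: "countable N" "N \<subseteq> ?M"
      unfolding N_def using D(1) by (auto intro!: countable_image countable_PiE)
    define \<B> where "\<B> = {B \<in> (\<lambda>(k, x). X_bar_mat n r ` x_ball n r c (1 / Suc k) x) ` (UNIV \<times> N). B \<subseteq> U}"
    have "countable \<B>"
      unfolding \<B>_def
      by (rule countable_subset[OF Collect_restrict]) (intro countable_image countable_SIGMA N countableI_type)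
    moreover have "\<B> \<subseteq> x_balls n r c"
    proof
      fix B assume "B \<in> \<B>"
      then obtain k x where "x \<in> N" "B = X_bar_mat n r ` x_ball n r c (1 / Suc k) x"
        unfolding \<B>_def by auto
      moreover have "1 / real (Suc k) > 0"
        by simp
      ultimately show "B \<in> x_balls n r c"
        unfolding x_balls_def using N(2) by blast
    qed
    moreover have "\<Union>\<B> = U"
    proof (intro equalityI subsetI)
      fix g assume g: "g \<in> U"
      note U' = U[unfolded openin_X_bar[OF r]]
      obtain y where y: "y \<in> ?M" "g = X_bar_mat n r y"
        using subsetD[OF conjunct1[OF U'] g] by (elim imageE)
      have "\<exists>e>0. \<forall>z\<in>?M. x_close n r e y z \<longrightarrow> X_bar_mat n r z \<in> U"
        by (rule bspec[OF conjunct2[OF U'] y(1), THEN mp]) (use g y(2) in simp)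
      then obtain e where e: "e > 0" "\<And>z. z \<in> ?M \<Longrightarrow> x_close n r e y z \<Longrightarrow> X_bar_mat n r z \<in> U"
        by blast
      \<comment> \<open>The weights multiply a radius by at most \<open>c ^ r\<close>, which is
        divided out in advance.\<close>
      have "e / c ^ r > 0"
        using e c by simp
      then obtain k where "1 / real (Suc k) < e / c ^ r"
        by (metis inverse_eq_divide reals_Archimedean)
      then have k: "1 / real (Suc k) * c ^ r < e"
        using c by (simp add: field_simps)
      have "\<exists>d\<in>D. dist (y $$ ij) d < 1 / Suc k" for ij
        by (rule D(2)) simp
      then have "\<exists>f. \<forall>ij. f ij \<in> D \<and> dist (y $$ ij) (f ij) < 1 / Suc k"
        by (intro choice allI) blast
      then obtain f where "\<forall>ij. f ij \<in> D \<and> dist (y $$ ij) (f ij) < 1 / Suc k" ..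
      then have f: "f ij \<in> D" "dist (y $$ ij) (f ij) < 1 / Suc k" for ij
        by (simp_all only:)
      define x where "x = mat (n - r) r (\<lambda>ij\<in>{..<n - r} \<times> {..<r}. f ij)"
      have x: "x \<in> N"
        unfolding x_def N_def by (rule imageI, rule PiE_I) (simp_all add: f(1))
      have "x_close n r (1 / Suc k) x y"
        unfolding x_close_def x_def using f(2) by simp
      then have yx: "y \<in> x_ball n r c (1 / Suc k) x"
        using y c by (intro x_close_imp_x_ball) auto
      have "X_bar_mat n r z \<in> U" if z: "z \<in> x_ball n r c (1 / Suc k) x" for z
      proof (rule e(2))
        show "z \<in> ?M"
          using z by (simp add: x_ball_def)
        have z': "z \<in> x_ball n r c (1 / Suc k) y"
          using z x_ball_eq[OF yx] by simp
        show "x_close n r e y z"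
          unfolding x_close_def dist_absF
        proof (intro allI impI)
          fix i j assume ij: "i < n - r" "j < r"
          have "absF (z $$ (i, j) - y $$ (i, j)) \<le> 1 / Suc k * c ^ j"
            using z' ij by (simp add: x_ball_def)
          also have "\<dots> \<le> 1 / Suc k * c ^ r"
            using c ij by (intro mult_left_mono power_increasing) auto
          finally show "absF (z $$ (i, j) - y $$ (i, j)) < e"
            using k by simp
        qed
      qed
      then have "X_bar_mat n r ` x_ball n r c (1 / Suc k) x \<subseteq> U"
        by (rule image_subsetI)
      then have "X_bar_mat n r ` x_ball n r c (1 / Suc k) x \<in> \<B>"
        unfolding \<B>_def by (intro CollectI conjI image_eqI[of _ _ "(k, x)"]) (use x in simp_all)
      then show "g \<in> \<Union>\<B>"
        using yx y(2) by blast
    next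
      fix g assume "g \<in> \<Union>\<B>"
      then obtain B where "g \<in> B" "B \<in> \<B>"
        by blast
      then show "g \<in> U"
        unfolding \<B>_def by blast
    qed
    ultimately show "U \<in> sigma_sets (X_set n r) (x_balls n r c)"
      using sigma_sets_UNION[of \<B> "X_set n r" "x_balls n r c"] sigma_sets.Basic[of _ "x_balls n r c" "X_set n r"]
      by (simp add: subset_iff)
  next
    fix B :: "'f mat set" assume "B \<in> x_balls n r c"
    then have "openin ?T B"
      unfolding x_balls_def using openin_x_ball[OF r c] by auto
    then show "B \<in> sigma_sets (X_set n r) {U. openin ?T U}"
      by (intro sigma_sets.Basic) simp
  qed
  finally show ?thesis .
qed

lemma Int_stable_x_balls:
  assumes r: "r \<le> n" and c: "c \<ge> 1"
  shows "Int_stable (x_balls n r c)"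
proof (rule Int_stableI)
  fix A B :: "'a mat set" assume AB: "A \<in> x_balls n r c" "B \<in> x_balls n r c"
  show "A \<inter> B \<in> x_balls n r c"
  proof (cases "A \<inter> B = {}")
    case True
    then show ?thesis
      by (simp add: x_balls_def)
  next
    case False
    then obtain e x e' x' where A: "A = X_bar_mat n r ` x_ball n r c e x" and B: "B = X_bar_mat n r ` x_ball n r c e' x'"
      using AB unfolding x_balls_def by blast
    have "inj_on (X_bar_mat n r) (carrier_mat (n - r) r :: 'a mat set)"
      using X_bar_mat_inj[OF r] by (intro inj_onI)
    then have I: "A \<inter> B = X_bar_mat n r ` (x_ball n r c e x \<inter> x_ball n r c e' x')"
      unfolding A B by (rule inj_on_image_Int[OF _ x_ball_subset x_ball_subset, symmetric])
    then have "x_ball n r c e x \<inter> x_ball n r c e' x' \<noteq> {}"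
      using False by auto
    from x_ball_Int[OF this c] have "A \<inter> B = A \<or> A \<inter> B = B"
      unfolding I unfolding A B by auto
    then show ?thesis
      using AB by metis
  qed
qed

text \<open>Column \<open>l\<close> of the difference enters column \<open>j\<close> only for
  \<open>l \<le> j\<close>: with factor 1 for \<open>l = j\<close>, and for \<open>l < j\<close>
  with a factor of size at most \<open>c\<close>, which the growth of the weight from
  \<open>l\<close> to \<open>j\<close> absorbs.\<close>

lemma x_ball_mult_unipotent:
  fixes z :: "'f::padic_field mat"
  assumes z: "z \<in> carrier_mat r r" "upper_triangular z" "\<And>i. i < r \<Longrightarrow> z $$ (i, i) = 1"
    and c: "c \<ge> 1" "\<And>i j. i < r \<Longrightarrow> j < r \<Longrightarrow> absF (z $$ (i, j)) \<le> c"
    and x: "x \<in> carrier_mat (n - r) r" and y: "y \<in> x_ball n r c e x" and e: "e > 0"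
  shows "y * z \<in> x_ball n r c e (x * z)"
  unfolding x_ball_def
proof (intro CollectI conjI allI impI)
  have yc: "y \<in> carrier_mat (n - r) r"
    using y by (simp add: x_ball_def)
  then show "y * z \<in> carrier_mat (n - r) r"
    using z by simp
  fix i j assume ij: "i < n - r" "j < r"
  have "(y * z) $$ (i, j) - (x * z) $$ (i, j) = (\<Sum>l<r. (y $$ (i, l) - x $$ (i, l)) * z $$ (l, j))"
    unfolding index_mult_sum[OF yc z(1) ij] index_mult_sum[OF x z(1) ij]
    by (simp add: sum_subtractf left_diff_distrib)
  also have "absF \<dots> \<le> e * c ^ j"
  proof (rule absF_sum_le)
    fix l assume "l \<in> {..<r}"
    then have l: "l < r"
      by simp
    have d: "absF (y $$ (i, l) - x $$ (i, l)) \<le> e * c ^ l"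
      using y ij l by (simp add: x_ball_def)
    consider "l < j" | "l = j" | "j < l"
      by linarith
    then show "absF ((y $$ (i, l) - x $$ (i, l)) * z $$ (l, j)) \<le> e * c ^ j"
    proof cases
      case 1
      have "absF ((y $$ (i, l) - x $$ (i, l)) * z $$ (l, j)) \<le> (e * c ^ l) * c"
        unfolding absF_mult using d c(2)[OF l ij(2)] e c by (intro mult_mono) auto
      also have "\<dots> = e * c ^ Suc l"
        by simp
      also have "\<dots> \<le> e * c ^ j"
        using 1 e c by (intro mult_left_mono power_increasing) auto
      finally show ?thesis .
    next
      case 2
      then show ?thesis
        using d z(3)[OF l] by simp
    next
      case 3
      then have "z $$ (l, j) = 0"
        using z(1,2) l by auto
      then show ?thesis
        using e c by simp
    qed
  qed (use e c in simp)
  finally show "absF ((y * z) $$ (i, j) - (x * z) $$ (i, j)) \<le> e * c ^ j" .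
qed

definition X_bar_act :: "nat \<Rightarrow> nat \<Rightarrow> 'f::padic_field mat \<Rightarrow> 'f mat \<Rightarrow> 'f mat" where
  "X_bar_act n r z g = X_bar_mat n r (mat (n - r) r (\<lambda>(i, j). g $$ (i + r, j)) * z)"

lemma X_bar_act_eq:
  assumes r: "r \<le> n" and x: "x \<in> carrier_mat (n - r) r"
  shows "X_bar_act n r z (X_bar_mat n r x) = X_bar_mat n r (x * z)"
proof -
  have "mat (n - r) r (\<lambda>(i, j). X_bar_mat n r x $$ (i + r, j)) = x"
    using x r by (intro eq_matI) (auto simp: index_X_bar_mat)
  then show ?thesis
    by (simp add: X_bar_act_def)
qed

text \<open>The preimage of a weighted ball is a ball of the same radius, and translation invariance
  gives all balls of one radius the same measure. So the image measure agrees with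
  \<open>\<mu>\<close> on a generating family stable under intersection, and no Jacobian is
  computed.\<close>

lemma haar_measure_X_bar_act:
  fixes z z' :: "'f::padic_field mat"
  assumes r: "r \<le> n" and \<mu>: "haar_measure (X_bar n r) \<mu>"
    and z: "z \<in> carrier_mat r r" "upper_triangular z" "\<And>i. i < r \<Longrightarrow> z $$ (i, i) = 1"
    and z': "z' \<in> carrier_mat r r" "upper_triangular z'" "\<And>i. i < r \<Longrightarrow> z' $$ (i, i) = 1"
    and zz: "z * z' = 1\<^sub>m r"
  shows "X_bar_act n r z \<in> measurable \<mu> \<mu>" "distr \<mu> \<mu> (X_bar_act n r z) = \<mu>"
proof -
  let ?M = "carrier_mat (n - r) r :: 'f mat set" and ?X = "X_set n r :: 'f mat set"
  have z'z: "z' * z = 1\<^sub>m r"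
    by (rule mat_mult_left_right_inverse[OF z(1) z'(1) zz])
  obtain c1 where c1: "c1 > 0" "\<And>i j. i < r \<Longrightarrow> j < r \<Longrightarrow> absF (z $$ (i, j)) \<le> c1"
    using entries_bounded[of r z] by blast
  obtain c2 where c2: "c2 > 0" "\<And>i j. i < r \<Longrightarrow> j < r \<Longrightarrow> absF (z' $$ (i, j)) \<le> c2"
    using entries_bounded[of r z'] by blast
  \<comment> \<open>One weight serves for both \<open>z\<close> and its inverse, since the two
    inclusions of the preimage computation multiply by one of them each.\<close>
  define c where "c = max 1 (max c1 c2)"
  have c: "c \<ge> 1" "\<And>i j. i < r \<Longrightarrow> j < r \<Longrightarrow> absF (z $$ (i, j)) \<le> c"
    "\<And>i j. i < r \<Longrightarrow> j < r \<Longrightarrow> absF (z' $$ (i, j)) \<le> c"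
    using c1 c2 by (auto simp: c_def le_max_iff_disj)
  let ?E = "x_balls n r c :: 'f mat set set"
  have sets: "sets \<mu> = sigma_sets ?X ?E"
    using \<mu> sets_borel_X_bar[OF r c(1)] by (simp add: haar_measure_def)
  have E_X: "?E \<subseteq> Pow ?X"
    unfolding x_balls_def using x_ball_subset by auto blast
  have space: "space \<mu> = ?X"
    using sets E_X by (metis sets_measure_of sets_eq_imp_space_eq space_measure_of)
  have act: "X_bar_act n r z g \<in> ?X" if "g \<in> ?X" for g
    using that z by (auto simp: X_bar_act_eq[OF r])
  have pre: "X_bar_act n r z -` (X_bar_mat n r ` x_ball n r c e x) \<inter> ?X = X_bar_mat n r ` x_ball n r c e (x * z')"
    if e: "e > 0" and x: "x \<in> ?M" for e x
  proof (intro equalityI subsetI)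
    fix g assume "g \<in> X_bar_act n r z -` (X_bar_mat n r ` x_ball n r c e x) \<inter> ?X"
    then obtain y where y: "y \<in> ?M" "g = X_bar_mat n r y" "X_bar_mat n r (y * z) \<in> X_bar_mat n r ` x_ball n r c e x"
      by (auto simp: X_bar_act_eq[OF r])
    have "y * z \<in> x_ball n r c e x"
      using X_bar_mat_in_image_iff[OF r _ x_ball_subset, of "y * z"] y z by auto
    then have "y * z * z' \<in> x_ball n r c e (x * z')"
      by (intro x_ball_mult_unipotent z' c x e)
    moreover have "y * z * z' = y"
      using y z z' zz by simp
    ultimately show "g \<in> X_bar_mat n r ` x_ball n r c e (x * z')"
      using y by simp
  next
    fix g assume "g \<in> X_bar_mat n r ` x_ball n r c e (x * z')"
    then obtain y where y: "y \<in> x_ball n r c e (x * z')" "g = X_bar_mat n r y"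
      by blast
    have yM: "y \<in> ?M"
      using y x_ball_subset by blast
    have "y * z \<in> x_ball n r c e (x * z' * z)"
      by (rule x_ball_mult_unipotent[OF z c(1,2) _ y(1) e]) (use x z' in auto)
    moreover have "x * z' * z = x"
      using x z z' z'z by simp
    ultimately show "g \<in> X_bar_act n r z -` (X_bar_mat n r ` x_ball n r c e x) \<inter> ?X"
      using y yM by (auto simp: X_bar_act_eq[OF r])
  qed
  have ball_in: "X_bar_mat n r ` x_ball n r c e x \<in> sets \<mu>" if "e > 0" "x \<in> ?M" for e x
    unfolding sets by (rule sigma_sets.Basic) (use that in \<open>auto simp: x_balls_def\<close>)
  show meas: "X_bar_act n r z \<in> measurable \<mu> \<mu>"
  proof (rule measurable_sigma_sets[OF sets E_X])
    show "X_bar_act n r z \<in> space \<mu> \<rightarrow> ?X"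
      using act space by auto
    fix A assume "A \<in> ?E"
    then show "X_bar_act n r z -` A \<inter> space \<mu> \<in> sets \<mu>"
      unfolding x_balls_def using pre ball_in z' by (auto simp: space)
  qed
  have translate: "emeasure \<mu> (X_bar_mat n r ` x_ball n r c e x) = emeasure \<mu> (X_bar_mat n r ` x_ball n r c e (0\<^sub>m (n - r) r))"
    if e: "e > 0" and x: "x \<in> ?M" for e x
  proof -
    let ?z = "0\<^sub>m (n - r) r :: 'f mat"
    have g: "X_bar_mat n r x \<in> carrier (X_bar n r)"
      using x by (auto simp: X_bar_def)
    have "X_bar_mat n r x <#\<^bsub>X_bar n r\<^esub> (X_bar_mat n r ` x_ball n r c e ?z) = X_bar_mat n r ` ((\<lambda>y. x + y) ` x_ball n r c e ?z)"
    proof -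
      have "X_bar_mat n r x <#\<^bsub>X_bar n r\<^esub> (X_bar_mat n r ` x_ball n r c e ?z) =
          (\<lambda>y. X_bar_mat n r x * X_bar_mat n r y) ` x_ball n r c e ?z"
        unfolding l_coset_def X_bar_def mat_group_simps by auto
      also have "\<dots> = (\<lambda>y. X_bar_mat n r (x + y)) ` x_ball n r c e ?z"
        by (rule image_cong[OF refl]) (simp add: X_bar_mat_mult[OF r x] x_ball_def)
      finally show ?thesis
        by (simp only: image_image)
    qed
    also have "(\<lambda>y. x + y) ` x_ball n r c e ?z = x_ball n r c e x"
    proof (intro equalityI subsetI)
      fix y assume y: "y \<in> x_ball n r c e x"
      then have yM: "y \<in> ?M"
        using x_ball_subset by blast
      have "y - x \<in> x_ball n r c e ?z" "y = x + (y - x)"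
        using y yM x by (auto simp: x_ball_def intro!: eq_matI)
      then show "y \<in> (\<lambda>y. x + y) ` x_ball n r c e ?z"
        by blast
    qed (use x in \<open>auto simp: x_ball_def\<close>)
    finally show ?thesis
      using \<mu> g ball_in[OF e, of ?z] unfolding haar_measure_def by (metis zero_carrier_mat)
  qed
  show "distr \<mu> \<mu> (X_bar_act n r z) = \<mu>"
  \<comment> \<open>Sigma-finiteness comes from the balls around 0 with integral radii: they exhaust
    the group, and compactness gives them finite measure.\<close>
  proof (rule measure_eqI_generator_eq[where \<Omega> = ?X and E = ?E and A = "\<lambda>i. X_bar_mat n r ` x_ball n r c (Suc i) (0\<^sub>m (n - r) r)"])
    show "Int_stable ?E"
      by (rule Int_stable_x_balls[OF r c(1)])
    show "?E \<subseteq> Pow ?X"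
      by (rule E_X)
    show "sets (distr \<mu> \<mu> (X_bar_act n r z)) = sigma_sets ?X ?E" "sets \<mu> = sigma_sets ?X ?E"
      using sets by simp_all
    show "emeasure (distr \<mu> \<mu> (X_bar_act n r z)) A = emeasure \<mu> A" if "A \<in> ?E" for A
    proof (cases "A = {}")
      case False
      then obtain e x where A: "A = X_bar_mat n r ` x_ball n r c e x" and e: "e > 0" and x: "x \<in> ?M"
        using \<open>A \<in> ?E\<close> unfolding x_balls_def by blast
      have "emeasure (distr \<mu> \<mu> (X_bar_act n r z)) A = emeasure \<mu> (X_bar_mat n r ` x_ball n r c e (x * z'))"
        unfolding A using ball_in[OF e x] by (subst emeasure_distr[OF meas]) (simp_all add: space pre[OF e x])
      also have "\<dots> = emeasure \<mu> A"
        unfolding A using translate[OF e x] translate[OF e, of "x * z'"] x z' by simp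
      finally show ?thesis .
    qed simp
    show "range (\<lambda>i. X_bar_mat n r ` x_ball n r c (Suc i) (0\<^sub>m (n - r) r)) \<subseteq> ?E"
      unfolding x_balls_def by (auto intro!: exI[of _ "real (Suc _)"] exI[of _ "0\<^sub>m (n - r) r"])
    show "(\<Union>i. X_bar_mat n r ` x_ball n r c (Suc i) (0\<^sub>m (n - r) r)) = ?X"
    proof (intro equalityI subsetI)
      fix g assume "g \<in> ?X"
      then obtain y where y: "y \<in> ?M" "g = X_bar_mat n r y"
        by blast
      obtain b where b: "b > 0" "\<And>i j. i < n \<Longrightarrow> j < n \<Longrightarrow> absF (y $$ (i, j)) \<le> b"
        using entries_bounded[of n y] by blast
      obtain k :: nat where k: "b \<le> real k"
        using real_arch_simple by blast
      have "absF (y $$ (i, j)) \<le> real (Suc k) * c ^ j" if "i < n - r" "j < r" for i j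
      proof -
        have "absF (y $$ (i, j)) \<le> real (Suc k) * 1"
        proof -
          have "i < n" "j < n"
            using that r by auto
          then show ?thesis
            using b(2)[of i j] k by simp
        qed
        also have "\<dots> \<le> real (Suc k) * c ^ j"
          using c by (intro mult_left_mono) auto
        finally show ?thesis .
      qed
      then have "y \<in> x_ball n r c (Suc k) (0\<^sub>m (n - r) r)"
        using y by (auto simp: x_ball_def)
      then show "g \<in> (\<Union>i. X_bar_mat n r ` x_ball n r c (Suc i) (0\<^sub>m (n - r) r))"
        using y by blast
    qed (use x_ball_subset in blast)
    show "emeasure (distr \<mu> \<mu> (X_bar_act n r z)) (X_bar_mat n r ` x_ball n r c (Suc i) (0\<^sub>m (n - r) r)) \<noteq> \<infinity>" for i
    proof -
      have "emeasure (distr \<mu> \<mu> (X_bar_act n r z)) (X_bar_mat n r ` x_ball n r c (Suc i) (0\<^sub>m (n - r) r))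
          = emeasure \<mu> (X_bar_mat n r ` x_ball n r c (Suc i) (0\<^sub>m (n - r) r * z'))"
        by (subst emeasure_distr[OF meas]) (simp_all add: space pre ball_in)
      also have "\<dots> < \<infinity>"
        using \<mu> compactin_x_ball[OF r, of "0\<^sub>m (n - r) r * z'" c "real (Suc i)"] z' unfolding haar_measure_def by auto
      finally show ?thesis
        by simp
    qed
  qed
qed

text \<open>The equality is wanted for every \<open>f\<close>. If \<open>f\<close> is not
  measurable, neither is its composition with \<open>T\<close>, because composing with the right
  inverse \<open>T'\<close> returns \<open>f\<close>; both integrals then have the default value
  0.\<close>

lemma integral_measure_preserving:
  fixes f :: "'a \<Rightarrow> complex"
  assumes T: "T \<in> measurable M M" "distr M M T = M" and T': "T' \<in> measurable M M" "\<And>x. x \<in> space M \<Longrightarrow> T (T' x) = x"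
  shows "(LINT x|M. f (T x)) = (LINT x|M. f x)" "integrable M f \<Longrightarrow> integrable M (\<lambda>x. f (T x))"
proof -
  show "integrable M (\<lambda>x. f (T x))" if "integrable M f"
    using that T by (metis integrable_distr)
  show "(LINT x|M. f (T x)) = (LINT x|M. f x)"
  proof (cases "f \<in> borel_measurable M")
    case True
    then show ?thesis
      using integral_distr[OF T(1) True] T(2) by simp
  next
    case False
    have "(\<lambda>x. f (T x)) \<notin> borel_measurable M"
    proof
      assume "(\<lambda>x. f (T x)) \<in> borel_measurable M"
      then have "(\<lambda>x. f (T (T' x))) \<in> borel_measurable M"
        by (rule measurable_compose[OF T'(1)])
      then have "f \<in> borel_measurable M"
        using T'(2) by (subst measurable_cong[of M f "\<lambda>x. f (T (T' x))"]) auto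
      with False show False
        by simp
    qed
    then show ?thesis
      using False by (metis borel_measurable_integrable not_integrable_integral_eq)
  qed
qed


section \<open>The inner integral\<close>

lemma additive_character_zero: "additive_character \<psi> \<Longrightarrow> \<psi> 0 = 1"
  unfolding additive_character_def
  by (metis add.right_neutral mult_cancel_left1 norm_zero zero_neq_one)

text \<open>A superdiagonal entry in the first \<open>n\<close> rows is zero unless both of its
  indices are below \<open>r\<close>: it either links an outer with an inner coordinate or lies in
  the inner identity block. This includes the entry in the middle column.\<close>

lemma psi_U_embed_SO:
  fixes u :: "'f::padic_field mat"
  assumes r: "r \<le> n" and n: "1 \<le> n"
  shows "psi_U \<psi> n (embed_SO n r u) = \<psi> (\<Sum>i<r - 1. u $$ (i, Suc i))"
proof -
  let ?E = "embed_SO n r u"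
  let ?o = "outer_idx (2 * n + 1) r" and ?b = "blk_idx (2 * n + 1) r"
  have o: "?o i \<longleftrightarrow> i < r" "i < r \<Longrightarrow> ?b i = i" if "i \<le> n" for i
    using that r by (auto simp: outer_idx_def blk_idx_def)
  have E: "?E $$ (i, Suc i) = (if Suc i < r then u $$ (i, Suc i) else 0)" if i: "i < n" for i
  proof -
    have l: "i < 2 * n + 1" "Suc i < 2 * n + 1" "i \<le> n" "Suc i \<le> n"
      using i by auto
    show ?thesis
      unfolding embed_SO_eq_blk[OF r] index_blk[OF l(1,2)] o(1)[OF l(3)] o(1)[OF l(4)]
      using i o(2)[OF l(3)] o(2)[OF l(4)] by auto
  qed
  have "(\<Sum>i<n - 1. ?E $$ (i, Suc i)) = (\<Sum>i<n - 1. if i < r - 1 then u $$ (i, Suc i) else 0)"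
    by (rule sum.cong) (use E in auto)
  also have "\<dots> = (\<Sum>i<r - 1. u $$ (i, Suc i))"
  proof -
    have "{..<n - 1} \<inter> {i. i < r - 1} = {..<r - 1}"
      using r by auto
    then show ?thesis
      by (simp add: sum.If_cases)
  qed
  finally have 1: "(\<Sum>i<n - 1. ?E $$ (i, Suc i)) = (\<Sum>i<r - 1. u $$ (i, Suc i))" .
  have "?E $$ (n - 1, n) = 0"
    using E[of "n - 1"] n r by simp
  then show ?thesis
    unfolding psi_U_def 1 by simp
qed

lemma embed_SO_in_U_unip:
  fixes u :: "'f::padic_field mat"
  assumes r: "r \<le> n" and u: "u \<in> V_unip r"
  shows "embed_SO n r u \<in> U_unip n"
proof -
  have uc: "u \<in> carrier (SO_even r)" "u \<in> carrier_mat (2 * r) (2 * r)"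
    and ut: "\<And>i j. i < 2 * r \<Longrightarrow> j < i \<Longrightarrow> u $$ (i, j) = 0" "\<And>i. i < 2 * r \<Longrightarrow> u $$ (i, i) = 1"
    using u by (auto simp: V_unip_def unipotent_upper_def upper_triangular_def carrier_SO_even)
  have rN: "2 * r \<le> 2 * n + 1"
    using r by simp
  let ?o = "outer_idx (2 * n + 1) r" and ?b = "blk_idx (2 * n + 1) r"
  have il: "x - r < 2 * (n - r) + 1" if "\<not> ?o x" for x
    using inner_idx_less[OF rN that] r by simp
  have mono: "?b j < ?b i" if "j < i" "?o i" "?o j" for i j
    using that r by (auto simp: outer_idx_def blk_idx_def)
  have mono': "j - r < i - r" if "j < i" "\<not> ?o i" "\<not> ?o j" for i j
    using that by (auto simp: outer_idx_def)
  have "embed_SO n r u $$ (i, j) = 0" if "j < i" "i < 2 * n + 1" for i j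
  proof -
    have j: "j < 2 * n + 1"
      using that by simp
    show ?thesis
    proof (cases "?o i"; cases "?o j")
      assume "?o i" "?o j"
      then show ?thesis
        unfolding embed_SO_eq_blk[OF r] index_blk[OF that(2) j]
        using ut(1)[OF blk_idx_less[OF rN that(2)] mono[OF that(1)]] by simp
    next
      assume "\<not> ?o i" "\<not> ?o j"
      then show ?thesis
        unfolding embed_SO_eq_blk[OF r] index_blk[OF that(2) j]
        using mono'[OF that(1)] il[of i] il[of j] by (simp del: One_nat_def)
    qed (simp_all add: embed_SO_eq_blk[OF r] index_blk[OF that(2) j] del: One_nat_def)
  qed
  moreover have "embed_SO n r u $$ (i, i) = 1" if "i < 2 * n + 1" for i
    unfolding embed_SO_eq_blk[OF r] index_blk[OF that that]
    using ut(2)[OF blk_idx_less[OF rN that]] il[of i] by auto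
  ultimately show ?thesis
    unfolding U_unip_def unipotent_upper_def upper_triangular_def
    using embed_SO_in_SO_odd[OF r uc(1)] by (simp add: carrier_matD(1)[OF embed_SO_carrier] del: One_nat_def)
qed

section \<open>The unipotent group V_r and its commutation with the lower unipotent group\<close>

lemma N_Siegel_subset_V_unip: "N_Siegel r \<subseteq> V_unip r"
proof
  fix u :: "'a mat" assume u: "u \<in> N_Siegel r"
  then obtain b where "b \<in> carrier_mat r r" "u = four_block_mat (1\<^sub>m r) b (0\<^sub>m r r) (1\<^sub>m r)"
    by (auto simp: N_Siegel_iff)
  then show "u \<in> V_unip r"
    using N_Siegel_in_SO_even[OF u] by (auto simp: V_unip_def unipotent_upper_def upper_triangular_def)
qed

lemma psi_U_N_Siegel:
  fixes u :: "'f::padic_field mat"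
  assumes \<psi>: "additive_character \<psi>" and n: "1 \<le> n" and u: "u \<in> N_Siegel n"
  shows "psi_U \<psi> n (embed_SO n n u) = 1"
proof -
  obtain b where b: "b \<in> carrier_mat n n" "u = four_block_mat (1\<^sub>m n) b (0\<^sub>m n n) (1\<^sub>m n)"
    using u by (auto simp: N_Siegel_iff)
  have "(\<Sum>i<n - 1. u $$ (i, Suc i)) = 0"
    by (rule sum.neutral) (use b in auto)
  then show ?thesis
    using additive_character_zero[OF \<psi>] by (simp add: psi_U_embed_SO[OF order_refl n])
qed

text \<open>An upper triangular matrix has zero lower left quadrant, so the parabolic decomposition
  applies. That the inverse of \<open>z\<close> is unipotent upper triangular is seen from the other
  end of \<open>u\<close>: it is \<open>atr\<close> of the lower right quadrant.\<close>

lemma V_unip_decomposition: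
  fixes u :: "'f::padic_field mat"
  assumes u: "u \<in> V_unip r"
  obtains z z' v where "z \<in> Z_unip r" "v \<in> N_Siegel r" "u = m_Siegel r z * v" "m_Siegel r z \<in> V_unip r"
    "nu z = 1" "z * z' = 1\<^sub>m r" "z' \<in> Z_unip r"
proof -
  have uc: "u \<in> carrier_mat (2 * r) (2 * r)" "atr u * u = 1\<^sub>m (2 * r)"
    and ut: "\<And>i j. i < 2 * r \<Longrightarrow> j < i \<Longrightarrow> u $$ (i, j) = 0" "\<And>i. i < 2 * r \<Longrightarrow> u $$ (i, i) = 1"
    using u by (auto simp: V_unip_def unipotent_upper_def upper_triangular_def carrier_SO_even)
  have ll: "ll r u = 0\<^sub>m r r"
    using ut by (intro eq_matI) (auto simp: ll_def)
  define z where "z = ul r u"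
  have z: "z \<in> carrier (GL r)"
    unfolding z_def by (rule parabolic_decomposition(1)[OF uc ll])
  obtain v where v: "v \<in> N_Siegel r" "u = m_Siegel r z * v"
    using parabolic_decomposition(2)[OF uc ll] unfolding z_def by blast
  have zt: "unipotent_upper z"
    using ut by (auto simp: z_def ul_def unipotent_upper_def upper_triangular_def)
  have zZ: "z \<in> Z_unip r"
    using z zt by (simp add: Z_unip_def)
  have lr: "atr (inv\<^bsub>GL r\<^esub> z) = lr r u"
    using parabolic_quadrants(3)[OF z v(1)] v(2) by simp
  have zc: "z \<in> carrier_mat r r" "inv\<^bsub>GL r\<^esub> z \<in> carrier_mat r r"
    using z inv_GL(1)[OF z] by (auto simp: carrier_GL)
  have lrt: "unipotent_upper (lr r u)"
    using ut by (auto simp: lr_def unipotent_upper_def upper_triangular_def)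
  have inv: "inv\<^bsub>GL r\<^esub> z = atr (lr r u)"
    by (simp flip: lr)
  have "atr (lr r u) $$ (i, j) = (if i = j then 1 else 0)" if "j \<le> i" "i < r" for i j
  proof -
    have "j < r" "r - 1 - j < r" "r - 1 - i < r" "r - 1 - i = r - 1 - j \<longleftrightarrow> i = j" "i \<noteq> j \<Longrightarrow> r - 1 - i < r - 1 - j"
      using that by auto
    moreover have "lr r u $$ (x, y) = (if x = y then 1 else 0)" if "y \<le> x" "x < r" for x y
      using that ut by (auto simp: lr_def le_less)
    ultimately show ?thesis
      unfolding index_atr[OF quadrant_carrier(4) \<open>i < r\<close> \<open>j < r\<close>]
      using that by (metis diff_le_mono2)
  qed
  then have "unipotent_upper (inv\<^bsub>GL r\<^esub> z)"
    unfolding inv unipotent_upper_def upper_triangular_def by (auto simp: lr_def)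
  then have z'Z: "inv\<^bsub>GL r\<^esub> z \<in> Z_unip r"
    using inv_GL(1)[OF z] by (simp add: Z_unip_def)
  have m: "m_Siegel r z = four_block_mat z (0\<^sub>m r r) (0\<^sub>m r r) (lr r u)"
    using m_Siegel_eq[OF z] lr by simp
  have "unipotent_upper (m_Siegel r z)"
    unfolding m using zt lrt zc ut by (auto simp: unipotent_upper_def upper_triangular_def lr_def mult_2)
  then have mV: "m_Siegel r z \<in> V_unip r"
    using m_Siegel_in_SO_even[OF z] by (simp add: V_unip_def)
  have "det z = prod_list (diag_mat z)"
    by (rule det_upper_triangular[OF _ zc(1)]) (use zt in \<open>simp add: unipotent_upper_def\<close>)
  also have "\<dots> = 1"
    unfolding prod_list_diag_prod by (rule prod.neutral) (use zt in \<open>auto simp: unipotent_upper_def\<close>)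
  finally have "nu z = 1"
    by (simp add: nu_def)
  then show ?thesis
    using that[OF zZ v mV _ inv_GL(3)[OF z] z'Z] by blast
qed

lemma embed_SO_m_Siegel:
  assumes r: "r \<le> n" and a: "a \<in> carrier (GL r)"
  shows "embed_SO n r (m_Siegel r a) = embed_SO n n (m_Siegel n (diag_one n r a))"
  by (simp only: embed_SO_trans[OF r, symmetric] blk_m_Siegel[OF r a])

lemma X_bar_mat_m_Siegel:
  fixes x z :: "'f::padic_field mat"
  assumes r: "r \<le> n" and x: "x \<in> carrier_mat (n - r) r" and z: "z \<in> carrier (GL r)"
  shows "X_bar_mat n r x * embed_SO n r (m_Siegel r z) = embed_SO n r (m_Siegel r z) * X_bar_mat n r (x * z)"
proof -
  have zc: "z \<in> carrier_mat r r"
    using z by (simp add: carrier_GL)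
  have xz: "x * z \<in> carrier_mat (n - r) r"
    using x zc by simp
  note g = lower_x_GL(1)[OF r x] diag_one_GL(1)[OF r z] lower_x_GL(1)[OF r xz]
  note m = SO_even_carrier_mat[OF m_Siegel_in_SO_even[OF g(1)]] SO_even_carrier_mat[OF m_Siegel_in_SO_even[OF g(2)]]
    SO_even_carrier_mat[OF m_Siegel_in_SO_even[OF g(3)]]
  show ?thesis
    unfolding X_bar_mat_eq[OF r x] X_bar_mat_eq[OF r xz] embed_SO_m_Siegel[OF r z]
      embed_SO_mult[OF order_refl m(1,2), symmetric] embed_SO_mult[OF order_refl m(2,3), symmetric]
      m_Siegel_mult[OF g(1,2)] m_Siegel_mult[OF g(2,3)] lower_x_diag_one[OF r x zc] ..
qed

lemma m_Siegel_N_Siegel_commute: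
  fixes a :: "'f::padic_field mat"
  assumes a: "a \<in> carrier (GL r)" and v: "v \<in> N_Siegel r"
  obtains w where "w \<in> N_Siegel r" "m_Siegel r a * v = w * m_Siegel r a"
proof -
  let ?i = "inv\<^bsub>GL r\<^esub> a"
  note i = inv_GL(1)[OF a]
  have c: "m_Siegel r a \<in> carrier (SO_even r)" "m_Siegel r ?i \<in> carrier (SO_even r)" "v \<in> carrier (SO_even r)"
    using a i v by (auto intro: m_Siegel_in_SO_even N_Siegel_in_SO_even)
  obtain w where w: "w \<in> N_Siegel r"
    "m_Siegel r a * v * (m_Siegel r ?i * 1\<^sub>m (2 * r)) = m_Siegel r (a * ?i) * w"
    using parabolic_mult[OF a v i one_in_N_Siegel] by blast
  have wc: "w \<in> carrier (SO_even r)"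
    by (rule N_Siegel_in_SO_even[OF w(1)])
  have ii: "m_Siegel r ?i * m_Siegel r a = 1\<^sub>m (2 * r)"
    by (simp add: m_Siegel_mult[OF i a] inv_GL[OF a] m_Siegel_one)
  have w2: "m_Siegel r a * v * m_Siegel r ?i = w"
    using w(2) c wc by (simp add: inv_GL[OF a] m_Siegel_one SO_even_one_mult)
  have "w * m_Siegel r a = m_Siegel r a * v * (m_Siegel r ?i * m_Siegel r a)"
    unfolding w2[symmetric] using c by (intro SO_even_assoc SO_even_mult_closed)
  also have "\<dots> = m_Siegel r a * v"
    unfolding ii using c by (intro SO_even_one_mult SO_even_mult_closed)
  finally show ?thesis
    using that w(1) by metis
qed

text \<open>Inside H_n the elements \<open>X_bar_mat n r x\<close> lie in the Siegel Levi subgroup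
  and so normalize the unipotent radical, on which the character of U_n is trivial.\<close>

lemma X_bar_mat_N_Siegel:
  fixes x v :: "'f::padic_field mat"
  assumes r: "r \<le> n" and x: "x \<in> carrier_mat (n - r) r" and v: "v \<in> N_Siegel r"
  obtains w where "w \<in> N_Siegel n" "X_bar_mat n r x * embed_SO n r v = embed_SO n n w * X_bar_mat n r x"
proof -
  note g = lower_x_GL(1)[OF r x]
  let ?v = "blk (2 * n) r v (1\<^sub>m (2 * (n - r)))"
  have v': "?v \<in> N_Siegel n"
    by (rule blk_N_Siegel[OF r v])
  obtain w where w: "w \<in> N_Siegel n" "m_Siegel n (lower_x n r x) * ?v = w * m_Siegel n (lower_x n r x)"
    using m_Siegel_N_Siegel_commute[OF g v'] by blast
  note m = SO_even_carrier_mat[OF m_Siegel_in_SO_even[OF g]] SO_even_carrier_mat[OF N_Siegel_in_SO_even[OF v']]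
    SO_even_carrier_mat[OF N_Siegel_in_SO_even[OF w(1)]]
  have "X_bar_mat n r x * embed_SO n r v = embed_SO n n w * X_bar_mat n r x"
    unfolding X_bar_mat_eq[OF r x] embed_SO_trans[OF r, symmetric, of v]
      embed_SO_mult[OF order_refl m(1,2), symmetric] embed_SO_mult[OF order_refl m(3,1), symmetric] w(2) ..
  with w(1) show ?thesis
    by (rule that)
qed

lemma X_bar_mat_in_SO_odd:
  fixes x :: "'f::padic_field mat"
  assumes "r \<le> n" "x \<in> carrier_mat (n - r) r"
  shows "X_bar_mat n r x \<in> carrier (SO_odd n)"
  unfolding X_bar_mat_eq[OF assms]
  by (intro embed_SO_in_SO_odd m_Siegel_in_SO_even lower_x_GL assms order_refl)

lemma SO_odd_mult_closed:
  assumes "g \<in> carrier (SO_odd n)" "h \<in> carrier (SO_odd n)"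
  shows "g * h \<in> carrier (SO_odd n)"
proof -
  let ?N = "2 * n + 1"
  have c: "g \<in> carrier_mat ?N ?N" "h \<in> carrier_mat ?N ?N"
    and d: "det g = 1" "det h = 1" and S: "transpose_mat g * S_form n * g = S_form n" "transpose_mat h * S_form n * h = S_form n"
    using assms by (simp_all only: carrier_SO_odd)
  have tc: "transpose_mat g \<in> carrier_mat ?N ?N" "transpose_mat h \<in> carrier_mat ?N ?N"
    using c by auto
  note Sc = S_form_carrier[of n]
  have "transpose_mat (g * h) * S_form n * (g * h) = transpose_mat h * (transpose_mat g * S_form n * g) * h"
    unfolding transpose_mult[OF c]
    by (simp only: assoc_mult_mat[OF tc(2) tc(1) Sc]
      assoc_mult_mat[OF tc(2) mult_carrier_mat[OF tc(1) Sc] mult_carrier_mat[OF c]]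
      assoc_mult_mat[OF mult_carrier_mat[OF tc(1) Sc] c, symmetric]
      assoc_mult_mat[OF tc(2) mult_carrier_mat[OF mult_carrier_mat[OF tc(1) Sc] c(1)] c(2)])
  then show ?thesis
    unfolding carrier_SO_odd S det_mult[OF c] d using mult_carrier_mat[OF c] by simp
qed

lemma SO_odd_assoc:
  "a \<in> carrier (SO_odd n) \<Longrightarrow> b \<in> carrier (SO_odd n) \<Longrightarrow> c \<in> carrier (SO_odd n) \<Longrightarrow> a * b * c = a * (b * c)"
  unfolding carrier_SO_odd by (elim conjE) (rule assoc_mult_mat)

text \<open>The equivariance of the two functionals and the invariance of the two measures.
  Ramification of \<tau> and the group that fixes \<open>v\<close> enter later, as assumptions of
  single lemmas.\<close>

locale rankin_selberg =
  fixes \<psi> :: "'f::padic_field \<Rightarrow> complex" and n r :: nat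
    and sc\<^sub>\<pi> :: "complex \<Rightarrow> 'v::ab_group_add \<Rightarrow> 'v" and \<pi> :: "'f mat \<Rightarrow> 'v \<Rightarrow> 'v" and \<Lambda>\<^sub>\<pi> :: "'v \<Rightarrow> complex" and v :: 'v
    and sc\<^sub>\<tau> :: "complex \<Rightarrow> 'w::ab_group_add \<Rightarrow> 'w" and \<tau> :: "'f mat \<Rightarrow> 'w \<Rightarrow> 'w" and \<Lambda>\<^sub>\<tau> :: "'w \<Rightarrow> complex"
    and \<mu>\<^sub>X :: "'f mat measure" and \<mu> :: "'f mat set measure"
  assumes \<psi>: "additive_character \<psi>"
    and rn: "1 \<le> r" "r \<le> n"
    and \<pi>: "smooth_representation sc\<^sub>\<pi> (SO_odd n) \<pi>"
    and \<Lambda>\<^sub>\<pi>: "\<Lambda>\<^sub>\<pi> \<in> Hom_char sc\<^sub>\<pi> \<pi> (U_unip n) (psi_U \<psi> n)"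
    and \<tau>: "smooth_representation sc\<^sub>\<tau> (GL r) \<tau>"
    and \<Lambda>\<^sub>\<tau>: "\<Lambda>\<^sub>\<tau> \<in> Hom_char sc\<^sub>\<tau> \<tau> (Z_unip r) (psi_bar_Z \<psi> r)"
    and \<mu>\<^sub>X: "haar_measure (X_bar n r) \<mu>\<^sub>X"
    and \<mu>: "invariant_coset_measure (SO_even r) (V_unip r) \<mu>"
begin

lemma space_X: "space \<mu>\<^sub>X = X_set n r"
proof -
  have "sets \<mu>\<^sub>X = sets (borel_of (group_topology (X_bar n r)))"
    using \<mu>\<^sub>X by (simp add: haar_measure_def)
  then have "space \<mu>\<^sub>X = space (borel_of (group_topology (X_bar n r)))"
    by (rule sets_eq_imp_space_eq)
  also have "\<dots> = X_set n r"
    unfolding borel_of_def topspace_X_bar by (rule space_measure_of) (use openin_subset topspace_X_bar in blast)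
  finally show ?thesis .
qed

lemma space_XE:
  assumes "x \<in> space \<mu>\<^sub>X"
  obtains y where "y \<in> carrier_mat (n - r) r" "x = X_bar_mat n r y"
  using assms unfolding space_X by (elim imageE)

lemma rep_\<pi>_mult:
  "g \<in> carrier (SO_odd n) \<Longrightarrow> h \<in> carrier (SO_odd n) \<Longrightarrow> \<pi> (g * h) x = \<pi> g (\<pi> h x)"
  using smooth_representation.rep_mult[OF \<pi>] by simp

lemma \<Lambda>\<^sub>\<pi>_U: "u \<in> U_unip n \<Longrightarrow> \<Lambda>\<^sub>\<pi> (\<pi> u x) = psi_U \<psi> n u * \<Lambda>\<^sub>\<pi> x"
  using \<Lambda>\<^sub>\<pi> by (simp add: Hom_char_def)

lemma \<Lambda>\<^sub>\<tau>_Z: "z \<in> Z_unip r \<Longrightarrow> \<Lambda>\<^sub>\<tau> (\<tau> z x) = psi_bar_Z \<psi> r z * \<Lambda>\<^sub>\<tau> x"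
  using \<Lambda>\<^sub>\<tau> by (simp add: Hom_char_def)

text \<open>The unipotent factors are moved to the far left. Passing the Levi factor replaces
  \<open>x\<close> by \<open>x * z\<close>; the factor \<open>u\<close> becomes an element of N_n,
  which the character does not see; the Levi factor itself then produces the value of the
  character.\<close>

lemma Whittaker_V_translate:
  fixes x :: "'f mat"
  assumes x: "x \<in> carrier_mat (n - r) r" and z: "z \<in> Z_unip r" "m_Siegel r z \<in> V_unip r"
    and u: "u \<in> N_Siegel r" and h: "h \<in> carrier (SO_even r)"
  shows "Whittaker \<Lambda>\<^sub>\<pi> \<pi> v (X_bar_mat n r x * embed_SO n r (m_Siegel r z * u * h)) =
    \<psi> (\<Sum>i<r - 1. z $$ (i, Suc i)) * Whittaker \<Lambda>\<^sub>\<pi> \<pi> v (X_bar_mat n r (x * z) * embed_SO n r h)"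
proof -
  have zG: "z \<in> carrier (GL r)" and zc: "z \<in> carrier_mat r r"
    using z by (auto simp: Z_unip_def carrier_GL)
  have n: "1 \<le> n"
    using rn by simp
  have xz: "x * z \<in> carrier_mat (n - r) r"
    using x zc by simp
  obtain w where w: "w \<in> N_Siegel n"
    "X_bar_mat n r (x * z) * embed_SO n r u = embed_SO n n w * X_bar_mat n r (x * z)"
    using X_bar_mat_N_Siegel[OF rn(2) xz u] by blast
  let ?m = "m_Siegel r z"
  define M U H W X Y where "M = embed_SO n r ?m" and "U = embed_SO n r u" and "H = embed_SO n r h"
    and "W = embed_SO n n w" and "X = X_bar_mat n r x" and "Y = X_bar_mat n r (x * z)"
  have c: "?m \<in> carrier (SO_even r)" "u \<in> carrier (SO_even r)"
    using m_Siegel_in_SO_even[OF zG] N_Siegel_in_SO_even[OF u] by auto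
  have so: "M \<in> carrier (SO_odd n)" "U \<in> carrier (SO_odd n)" "H \<in> carrier (SO_odd n)"
    "W \<in> carrier (SO_odd n)" "X \<in> carrier (SO_odd n)" "Y \<in> carrier (SO_odd n)"
    unfolding M_def U_def H_def W_def X_def Y_def
    using embed_SO_in_SO_odd[OF rn(2)] embed_SO_in_SO_odd[OF order_refl N_Siegel_in_SO_even[OF w(1)]]
      X_bar_mat_in_SO_odd[OF rn(2)] c h x xz by auto
  have "X * embed_SO n r (?m * u * h) = X * (M * U * H)"
    unfolding M_def U_def H_def
    using c h by (simp add: embed_SO_mult[OF rn(2)] SO_even_carrier_mat SO_even_mult_closed)
  also have "\<dots> = (X * M) * (U * H)"
    using so by (simp add: SO_odd_assoc SO_odd_mult_closed)
  also have "X * M = M * Y"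
    unfolding X_def M_def Y_def by (rule X_bar_mat_m_Siegel[OF rn(2) x zG])
  also have "M * Y * (U * H) = M * (Y * U * H)"
    using so by (simp add: SO_odd_assoc SO_odd_mult_closed)
  also have "Y * U = W * Y"
    using w(2) by (simp add: Y_def U_def W_def)
  also have "M * (W * Y * H) = M * (W * (Y * H))"
    using so by (simp add: SO_odd_assoc SO_odd_mult_closed)
  finally have eq: "X * embed_SO n r (?m * u * h) = M * (W * (Y * H))" .
  have "\<Lambda>\<^sub>\<pi> (\<pi> (M * (W * (Y * H))) v) = \<Lambda>\<^sub>\<pi> (\<pi> M (\<pi> W (\<pi> (Y * H) v)))"
    using so by (simp add: rep_\<pi>_mult SO_odd_mult_closed)
  also have "\<dots> = psi_U \<psi> n M * (psi_U \<psi> n W * \<Lambda>\<^sub>\<pi> (\<pi> (Y * H) v))"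
  proof -
    have "M \<in> U_unip n" "W \<in> U_unip n"
      unfolding M_def W_def using embed_SO_in_U_unip[OF rn(2) z(2)]
        embed_SO_in_U_unip[OF order_refl subsetD[OF N_Siegel_subset_V_unip w(1)]] by auto
    then show ?thesis
      by (simp add: \<Lambda>\<^sub>\<pi>_U)
  qed
  also have "psi_U \<psi> n W = 1"
    unfolding W_def by (rule psi_U_N_Siegel[OF \<psi> n w(1)])
  also have "psi_U \<psi> n M = \<psi> (\<Sum>i<r - 1. ?m $$ (i, Suc i))"
    unfolding M_def by (rule psi_U_embed_SO[OF rn(2) n])
  also have "(\<Sum>i<r - 1. ?m $$ (i, Suc i)) = (\<Sum>i<r - 1. z $$ (i, Suc i))"
    by (rule sum.cong) (use zc in \<open>auto simp: m_Siegel_eq[OF zG]\<close>)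
  finally show ?thesis
    unfolding Whittaker_def by (simp add: eq[unfolded X_def] Y_def H_def)
qed

definition inner_integral :: "('f mat \<Rightarrow> 'w) \<Rightarrow> 'f mat \<Rightarrow> complex" where
  "inner_integral \<xi> h = (LINT x|\<mu>\<^sub>X. Whittaker \<Lambda>\<^sub>\<pi> \<pi> v (x * embed_SO n r h) * \<Lambda>\<^sub>\<tau> (\<xi> h))"

text \<open>The character value from the Whittaker function and the conjugate one from the
  functional on \<tau> multiply to 1. What is left is the substitution x \<mapsto> x z, which
  preserves the Haar measure because z is unipotent.\<close>

lemma inner_integral_V_invariant:
  assumes \<xi>: "\<xi> \<in> induced_space r sc\<^sub>\<tau> \<tau> s" and u: "u \<in> V_unip r" and h: "h \<in> carrier (SO_even r)"
  shows "inner_integral \<xi> (u * h) = inner_integral \<xi> h"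
proof -
  interpret t: smooth_representation sc\<^sub>\<tau> "GL r" \<tau>
    by (rule \<tau>)
  obtain z z' u' where z: "z \<in> Z_unip r" "u' \<in> N_Siegel r" "u = m_Siegel r z * u'" "m_Siegel r z \<in> V_unip r"
    "nu z = 1" "z * z' = 1\<^sub>m r" "z' \<in> Z_unip r"
    by (rule V_unip_decomposition[OF u])
  have Z: "y \<in> carrier (GL r)" "y \<in> carrier_mat r r" "upper_triangular y" "i < r \<Longrightarrow> y $$ (i, i) = 1"
    if "y \<in> Z_unip r" for y :: "'f mat" and i
    using that by (auto simp: Z_unip_def unipotent_upper_def carrier_GL)
  have zz': "z' * z = 1\<^sub>m r"
    by (rule mat_mult_left_right_inverse[OF Z(2)[OF z(1)] Z(2)[OF z(7)] z(6)])
  let ?T = "X_bar_act n r z" and ?T' = "X_bar_act n r z'"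
  note act = haar_measure_X_bar_act[OF rn(2) \<mu>\<^sub>X]
  have T: "?T \<in> measurable \<mu>\<^sub>X \<mu>\<^sub>X" "distr \<mu>\<^sub>X \<mu>\<^sub>X ?T = \<mu>\<^sub>X"
    by (rule act[OF Z(2-4)[OF z(1)] Z(2-4)[OF z(7)] z(6)]; assumption)+
  have T': "?T' \<in> measurable \<mu>\<^sub>X \<mu>\<^sub>X"
    by (rule act(1)[OF Z(2-4)[OF z(7)] Z(2-4)[OF z(1)] zz']; assumption)
  have TT: "?T (?T' x) = x" if x: "x \<in> space \<mu>\<^sub>X" for x
  proof -
    obtain y where y: "y \<in> carrier_mat (n - r) r" "x = X_bar_mat n r y"
      using x by (rule space_XE)
    then show ?thesis
      using Z(2)[OF z(7)] Z(2)[OF z(1)] zz' by (simp add: X_bar_act_eq[OF rn(2)])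
  qed
  \<comment> \<open>No scalar appears, since \<open>nu z = 1\<close>.\<close>
  have \<xi>u: "\<xi> (u * h) = \<tau> z (\<xi> h)"
    using induced_space_equivariant[OF \<xi> Z(1)[OF z(1)] z(2) h] by (simp add: z(3,5) delta_Siegel_def)
  define t where "t = (\<Sum>i<r - 1. z $$ (i, Suc i))"
  have \<psi>1: "\<psi> t * cnj (\<psi> t) = 1"
    using \<psi> complex_norm_square[of "\<psi> t"] by (simp add: additive_character_def)
  define f where "f x = Whittaker \<Lambda>\<^sub>\<pi> \<pi> v (x * embed_SO n r h) * \<Lambda>\<^sub>\<tau> (\<xi> h)" for x
  have "inner_integral \<xi> (u * h) = (LINT x|\<mu>\<^sub>X. f (?T x))"
    unfolding inner_integral_def
  proof (rule Bochner_Integration.integral_cong[OF refl])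
    fix x assume "x \<in> space \<mu>\<^sub>X"
    then obtain y where y: "y \<in> carrier_mat (n - r) r" "x = X_bar_mat n r y"
      by (rule space_XE)
    have "Whittaker \<Lambda>\<^sub>\<pi> \<pi> v (x * embed_SO n r (u * h)) * \<Lambda>\<^sub>\<tau> (\<xi> (u * h)) =
        \<psi> t * Whittaker \<Lambda>\<^sub>\<pi> \<pi> v (X_bar_mat n r (y * z) * embed_SO n r h) * (cnj (\<psi> t) * \<Lambda>\<^sub>\<tau> (\<xi> h))"
      unfolding \<xi>u \<Lambda>\<^sub>\<tau>_Z[OF z(1)] unfolding z(3) y(2) Whittaker_V_translate[OF y(1) z(1,4,2) h]
      by (simp add: t_def psi_bar_Z_def)
    also have "\<dots> = (\<psi> t * cnj (\<psi> t)) * f (?T x)"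
      unfolding f_def y(2) X_bar_act_eq[OF rn(2) y(1)] by (simp only: mult_ac)
    finally show "Whittaker \<Lambda>\<^sub>\<pi> \<pi> v (x * embed_SO n r (u * h)) * \<Lambda>\<^sub>\<tau> (\<xi> (u * h)) = f (?T x)"
      by (simp add: \<psi>1)
  qed
  also have "\<dots> = (LINT x|\<mu>\<^sub>X. f x)"
    by (rule integral_measure_preserving(1)[OF T T' TT])
  finally show ?thesis
    by (simp add: inner_integral_def f_def)
qed


section \<open>The outer integral\<close>

lemma V_unip_subset: "V_unip r \<subseteq> carrier (SO_even r)"
  by (auto simp: V_unip_def)

lemma one_in_V_unip: "1\<^sub>m (2 * r) \<in> V_unip r"
  using subsetD[OF N_Siegel_subset_V_unip one_in_N_Siegel] .

lemma coset_translate: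
  assumes "g \<in> carrier (SO_even r)" "k \<in> carrier (SO_even r)"
  shows "(V_unip r #>\<^bsub>SO_even r\<^esub> g) #>\<^bsub>SO_even r\<^esub> k = V_unip r #>\<^bsub>SO_even r\<^esub> (g * k)"
  using group.coset_mult_assoc[OF group_SO_even V_unip_subset assms] by simp

lemma rcosetsE:
  assumes "c \<in> rcosets\<^bsub>SO_even r\<^esub> (V_unip r)"
  obtains g where "g \<in> carrier (SO_even r)" "c = V_unip r #>\<^bsub>SO_even r\<^esub> g"
  using assms by (auto simp: RCOSETS_def)

lemma rcosets_in: "g \<in> carrier (SO_even r) \<Longrightarrow> V_unip r #>\<^bsub>SO_even r\<^esub> g \<in> rcosets\<^bsub>SO_even r\<^esub> (V_unip r)"
  by (auto simp: RCOSETS_def)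

lemma sets_\<mu>: "sets \<mu> = sigma_sets (rcosets\<^bsub>SO_even r\<^esub> (V_unip r)) {U. openin (coset_topology (SO_even r) (V_unip r)) U}"
  and space_\<mu>: "space \<mu> = rcosets\<^bsub>SO_even r\<^esub> (V_unip r)"
  and topspace_coset: "topspace (coset_topology (SO_even r) (V_unip r)) = (rcosets\<^bsub>SO_even r\<^esub> (V_unip r) :: 'f mat set set)"
proof -
  let ?C = "coset_topology (SO_even r) (V_unip r) :: 'f mat set topology" and ?R = "rcosets\<^bsub>SO_even r\<^esub> (V_unip r) :: 'f mat set set"
  have "{g \<in> carrier (SO_even r). V_unip r #>\<^bsub>SO_even r\<^esub> g \<in> ?R} = carrier (SO_even r)"
    using rcosets_in by blast
  then have "openin ?C ?R"
    unfolding openin_coset_topology by (simp add: openin_SO_even) (auto intro: exI[of _ 1])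
  moreover have "openin ?C (topspace ?C)"
    by simp
  then have "topspace ?C \<subseteq> ?R"
    unfolding openin_coset_topology by blast
  ultimately show top: "topspace ?C = ?R"
    using openin_subset by blast
  have P: "{U. openin ?C U} \<subseteq> Pow ?R"
    using openin_subset[of ?C] unfolding top by blast
  have s: "sets \<mu> = sets (borel_of ?C)"
    using \<mu> by (simp add: invariant_coset_measure_def)
  then show "sets \<mu> = sigma_sets ?R {U. openin ?C U}"
    unfolding borel_of_def top using sets_measure_of[OF P] by simp
  show "space \<mu> = ?R"
    using sets_eq_imp_space_eq[OF s] space_measure_of[OF P] by (simp add: borel_of_def top)
qed

lemma coset_translate_measurable:
  assumes k: "k \<in> carrier (SO_even r)"
  shows "(\<lambda>c. c #>\<^bsub>SO_even r\<^esub> k) \<in> measurable \<mu> \<mu>"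
proof (rule measurable_sigma_sets[OF sets_\<mu>])
  let ?C = "coset_topology (SO_even r) (V_unip r) :: 'f mat set topology"
  show "{U. openin ?C U} \<subseteq> Pow (rcosets\<^bsub>SO_even r\<^esub> (V_unip r))"
    using openin_subset[of ?C] unfolding topspace_coset by blast
  show "(\<lambda>c. c #>\<^bsub>SO_even r\<^esub> k) \<in> space \<mu> \<rightarrow> rcosets\<^bsub>SO_even r\<^esub> (V_unip r)"
    unfolding space_\<mu> using k by (auto elim!: rcosetsE simp: coset_translate intro!: rcosets_in SO_even_mult_closed)
  fix U assume "U \<in> {U. openin ?C U}"
  then have U: "U \<subseteq> rcosets\<^bsub>SO_even r\<^esub> (V_unip r)"
    "openin (group_topology (SO_even r)) {g \<in> carrier (SO_even r). V_unip r #>\<^bsub>SO_even r\<^esub> g \<in> U}"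
    unfolding openin_coset_topology by auto
  let ?P = "(\<lambda>c. c #>\<^bsub>SO_even r\<^esub> k) -` U \<inter> space \<mu>"
  have "{g \<in> carrier (SO_even r). V_unip r #>\<^bsub>SO_even r\<^esub> g \<in> ?P} =
      {g \<in> carrier (SO_even r). g * k \<in> {g \<in> carrier (SO_even r). V_unip r #>\<^bsub>SO_even r\<^esub> g \<in> U}}"
    using k by (auto simp: space_\<mu> coset_translate SO_even_mult_closed rcosets_in)
  moreover have "openin (group_topology (SO_even r)) \<dots>"
    by (rule openin_SO_even_translate(2)[OF SO_even_carrier_mat[OF k] U(2)]) (rule SO_even_mult_closed[OF _ k])
  ultimately have "openin ?C ?P"
    unfolding openin_coset_topology by (auto simp: space_\<mu>)
  then show "?P \<in> sets \<mu>"
    unfolding sets_\<mu> by (intro sigma_sets.Basic) simp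
qed

lemma coset_translate_inverse:
  assumes k: "k \<in> carrier (SO_even r)" and c: "c \<in> space \<mu>"
  shows "(c #>\<^bsub>SO_even r\<^esub> k) #>\<^bsub>SO_even r\<^esub> atr k = c" "(c #>\<^bsub>SO_even r\<^esub> atr k) #>\<^bsub>SO_even r\<^esub> k = c"
proof -
  obtain g where g: "g \<in> carrier (SO_even r)" "c = V_unip r #>\<^bsub>SO_even r\<^esub> g"
    using c unfolding space_\<mu> by (rule rcosetsE)
  note a = SO_even_atr[OF k]
  have "g * k * atr k = g" "g * atr k * k = g"
    using g k a by (simp_all add: SO_even_assoc SO_even_one_mult)
  then show "(c #>\<^bsub>SO_even r\<^esub> k) #>\<^bsub>SO_even r\<^esub> atr k = c" "(c #>\<^bsub>SO_even r\<^esub> atr k) #>\<^bsub>SO_even r\<^esub> k = c"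
    using g k a by (simp_all add: coset_translate SO_even_mult_closed)
qed

lemma distr_coset_translate:
  assumes k: "k \<in> carrier (SO_even r)"
  shows "distr \<mu> \<mu> (\<lambda>c. c #>\<^bsub>SO_even r\<^esub> k) = \<mu>"
proof (rule measure_eqI)
  fix A assume "A \<in> sets (distr \<mu> \<mu> (\<lambda>c. c #>\<^bsub>SO_even r\<^esub> k))"
  then have A: "A \<in> sets \<mu>"
    by simp
  have A': "A \<subseteq> space \<mu>"
    by (rule sets.sets_into_space[OF A])
  note ak = SO_even_atr(3)[OF k]
  have "(\<lambda>c. c #>\<^bsub>SO_even r\<^esub> k) -` A \<inter> space \<mu> = (\<lambda>c. c #>\<^bsub>SO_even r\<^esub> atr k) ` A"
  proof (intro equalityI subsetI)
    fix c assume "c \<in> (\<lambda>c. c #>\<^bsub>SO_even r\<^esub> k) -` A \<inter> space \<mu>"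
    then show "c \<in> (\<lambda>c. c #>\<^bsub>SO_even r\<^esub> atr k) ` A"
      using coset_translate_inverse(1)[OF k, of c] by (intro image_eqI[of _ _ "c #>\<^bsub>SO_even r\<^esub> k"]) auto
  next
    fix c assume "c \<in> (\<lambda>c. c #>\<^bsub>SO_even r\<^esub> atr k) ` A"
    then obtain d where d: "d \<in> A" "c = d #>\<^bsub>SO_even r\<^esub> atr k"
      by blast
    have "c \<in> space \<mu>"
      using measurable_space[OF coset_translate_measurable[OF ak]] d A' by blast
    then show "c \<in> (\<lambda>c. c #>\<^bsub>SO_even r\<^esub> k) -` A \<inter> space \<mu>"
      using d A' coset_translate_inverse(2)[OF k] by auto
  qed
  then show "emeasure (distr \<mu> \<mu> (\<lambda>c. c #>\<^bsub>SO_even r\<^esub> k)) A = emeasure \<mu> A"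
    using \<mu> ak A by (simp add: emeasure_distr[OF coset_translate_measurable[OF k] A] invariant_coset_measure_def)
qed simp

text \<open>
  The integrals of the translates of the section by \<open>K\<close> all agree, because \<open>v\<close> is fixed by \<open>K\<close>,
  and the sum of the translates vanishes.
\<close>

lemma Psi_integral_eq_0:
  assumes \<xi>: "\<xi> \<in> induced_space r sc\<^sub>\<tau> \<tau> s"
    and ram: "fixed_vectors \<tau> (GL_int r) = {0}"
    and K: "K \<subseteq> carrier (SO_even r)" "\<And>k l. k \<in> K \<Longrightarrow> l \<in> K \<Longrightarrow> k * l \<in> K" "\<And>k. k \<in> K \<Longrightarrow> atr k \<in> K"
    and mK: "\<And>a. a \<in> GL_int r \<Longrightarrow> m_Siegel r a \<in> K"
    and iw: "\<And>h. h \<in> carrier (SO_even r) \<Longrightarrow>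
      \<exists>a\<in>carrier (GL r). \<exists>u\<in>N_Siegel r. \<exists>k\<in>K. h = m_Siegel r a * u * k"
    and fin: "finite (right_translate r \<xi> ` K)"
    and Kv: "\<And>k. k \<in> K \<Longrightarrow> \<pi> (embed_SO n r k) v = v"
  shows "Psi_integral n r \<mu>\<^sub>X \<mu> \<Lambda>\<^sub>\<pi> \<pi> \<Lambda>\<^sub>\<tau> v \<xi> = 0"
proof -
  let ?V = "V_unip r :: 'f mat set" and ?G = "SO_even r :: 'f mat monoid" and ?\<Xi> = "right_translate r \<xi> ` K"
  define rep where "rep c = (SOME h :: 'f mat. h \<in> c)" for c
  define F where "F c = inner_integral \<xi> (rep c)" for c
  have Psi: "Psi_integral n r \<mu>\<^sub>X \<mu> \<Lambda>\<^sub>\<pi> \<pi> \<Lambda>\<^sub>\<tau> v \<xi> = (LINT c|\<mu>. F c)"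
    by (simp add: Psi_integral_def F_def inner_integral_def rep_def Let_def)
  have rep: "\<exists>u\<in>?V. rep (?V #>\<^bsub>?G\<^esub> g) = u * g" if "g \<in> carrier ?G" for g
  proof -
    have "1\<^sub>m (2 * r) * g \<in> ?V #>\<^bsub>?G\<^esub> g"
      using one_in_V_unip by (auto simp: r_coset_def)
    then have "rep (?V #>\<^bsub>?G\<^esub> g) \<in> ?V #>\<^bsub>?G\<^esub> g"
      unfolding rep_def by (rule someI)
    then show ?thesis
      by (auto simp: r_coset_def)
  qed
  have F_coset: "F (?V #>\<^bsub>?G\<^esub> g) = inner_integral \<xi> g" if g: "g \<in> carrier ?G" for g
    using rep[OF g] inner_integral_V_invariant[OF \<xi> _ g] by (auto simp: F_def)
  have rep_carrier: "rep c \<in> carrier ?G" if "c \<in> space \<mu>" for c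
  proof -
    obtain g where g: "g \<in> carrier ?G" "c = ?V #>\<^bsub>?G\<^esub> g"
      using \<open>c \<in> space \<mu>\<close> unfolding space_\<mu> by (rule rcosetsE)
    then obtain u where "u \<in> ?V" "rep c = u * g"
      using rep by blast
    then show ?thesis
      using SO_even_mult_closed[OF subsetD[OF V_unip_subset] g(1)] by simp
  qed
  \<comment> \<open>The factor \<open>\<Lambda>\<^sub>\<tau> (\<xi> h)\<close> is constant in
    \<open>x\<close>. The remaining factor does not involve the section and is right invariant under
    \<open>K\<close>, so translating the section amounts to translating the coset.\<close>
  define A where "A h = (LINT x|\<mu>\<^sub>X. Whittaker \<Lambda>\<^sub>\<pi> \<pi> v (x * embed_SO n r h))" for h
  have inner: "inner_integral \<xi> h = A h * \<Lambda>\<^sub>\<tau> (\<xi> h)" for h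
    unfolding inner_integral_def A_def by (rule integral_mult_left_zero)
  have A_K: "A (h * k) = A h" if h: "h \<in> carrier ?G" and k: "k \<in> K" for h k
    unfolding A_def
  proof (rule Bochner_Integration.integral_cong[OF refl])
    fix x assume "x \<in> space \<mu>\<^sub>X"
    then obtain y where "y \<in> carrier_mat (n - r) r" "x = X_bar_mat n r y"
      by (rule space_XE)
    then have x: "x \<in> carrier (SO_odd n)"
      using X_bar_mat_in_SO_odd[OF rn(2)] by simp
    have kc: "k \<in> carrier ?G"
      using k K by blast
    have so: "embed_SO n r h \<in> carrier (SO_odd n)" "embed_SO n r k \<in> carrier (SO_odd n)"
      using embed_SO_in_SO_odd[OF rn(2)] h kc by auto
    have "x * embed_SO n r (h * k) = x * embed_SO n r h * embed_SO n r k"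
      using x so h kc by (simp add: embed_SO_mult[OF rn(2)] SO_even_carrier_mat SO_odd_assoc)
    then show "Whittaker \<Lambda>\<^sub>\<pi> \<pi> v (x * embed_SO n r (h * k)) = Whittaker \<Lambda>\<^sub>\<pi> \<pi> v (x * embed_SO n r h)"
      using x so Kv[OF k] by (simp add: Whittaker_def rep_\<pi>_mult SO_odd_mult_closed)
  qed
  have translate: "A (rep c) * \<Lambda>\<^sub>\<tau> (right_translate r \<xi> k (rep c)) = F (c #>\<^bsub>?G\<^esub> k)"
    if c: "c \<in> space \<mu>" and k: "k \<in> K" for c k
  proof -
    obtain g where g: "g \<in> carrier ?G" "c = ?V #>\<^bsub>?G\<^esub> g"
      using c unfolding space_\<mu> by (rule rcosetsE)
    obtain u where u: "u \<in> ?V" "rep c = u * g"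
      using rep[OF g(1)] g(2) by blast
    have kc: "k \<in> carrier ?G"
      using k K by blast
    have uc: "u \<in> carrier ?G"
      using u V_unip_subset by blast
    have "A (rep c) * \<Lambda>\<^sub>\<tau> (right_translate r \<xi> k (rep c)) = inner_integral \<xi> (rep c * k)"
      using rep_carrier[OF c] by (simp add: inner A_K[OF _ k] right_translate_def)
    also have "rep c * k = u * (g * k)"
      unfolding u(2) by (rule SO_even_assoc[OF uc g(1) kc])
    also have "inner_integral \<xi> (u * (g * k)) = inner_integral \<xi> (g * k)"
      by (rule inner_integral_V_invariant[OF \<xi> u(1) SO_even_mult_closed[OF g(1) kc]])
    also have "\<dots> = F (c #>\<^bsub>?G\<^esub> k)"
      unfolding g(2) coset_translate[OF g(1) kc] by (rule F_coset[OF SO_even_mult_closed[OF g(1) kc], symmetric])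
    finally show ?thesis .
  qed
  show ?thesis
  \<comment> \<open>A function that is not integrable has integral 0 by convention. In the other
    case integrability allows the finite sum to be interchanged with the integral.\<close>
  proof (cases "integrable \<mu> F")
    case False
    then show ?thesis
      unfolding Psi by (rule not_integrable_integral_eq)
  next
    case True
    \<comment> \<open>The integrand for the section \<open>\<eta>\<close>, evaluated at the same
      representatives for all translates, so that the sum over the translates vanishes
      pointwise.\<close>
    define G where "G \<eta> c = A (rep c) * \<Lambda>\<^sub>\<tau> (\<eta> (rep c))" for \<eta> :: "'f mat \<Rightarrow> 'w" and c
    have G: "integrable \<mu> (G \<eta>) \<and> (LINT c|\<mu>. G \<eta> c) = (LINT c|\<mu>. F c)" if "\<eta> \<in> ?\<Xi>" for \<eta>
    proof -
      obtain k where k: "k \<in> K" "\<eta> = right_translate r \<xi> k"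
        using \<open>\<eta> \<in> ?\<Xi>\<close> by blast
      have kc: "k \<in> carrier ?G"
        using k K by blast
      note pres = integral_measure_preserving[OF coset_translate_measurable[OF kc] distr_coset_translate[OF kc]
          coset_translate_measurable[OF SO_even_atr(3)[OF kc]] coset_translate_inverse(2)[OF kc], where f = F]
      have eq: "G \<eta> c = F (c #>\<^bsub>?G\<^esub> k)" if "c \<in> space \<mu>" for c
        unfolding G_def k(2) by (rule translate[OF that k(1)])
      have "integrable \<mu> (G \<eta>)"
        using pres(2) True by (subst Bochner_Integration.integrable_cong[OF refl eq]) auto
      moreover have "(LINT c|\<mu>. G \<eta> c) = (LINT c|\<mu>. F (c #>\<^bsub>?G\<^esub> k))"
        by (rule Bochner_Integration.integral_cong[OF refl eq])
      ultimately show ?thesis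
        using pres(1) by simp
    qed
    have lin: "module_hom sc\<^sub>\<tau> (*) \<Lambda>\<^sub>\<tau>"
      using \<Lambda>\<^sub>\<tau> by (simp add: Hom_char_def module_hom_iff_linear)
    have "(\<Sum>\<eta>\<in>?\<Xi>. G \<eta> c) = 0" if "c \<in> space \<mu>" for c
    proof -
      have "(\<Sum>\<eta>\<in>?\<Xi>. G \<eta> c) = A (rep c) * \<Lambda>\<^sub>\<tau> (\<Sum>\<eta>\<in>?\<Xi>. \<eta> (rep c))"
        unfolding G_def module_hom.sum[OF lin] by (rule sum_distrib_left[symmetric])
      also have "(\<Sum>\<eta>\<in>?\<Xi>. \<eta> (rep c)) = 0"
        by (rule sum_right_translates_eq_0[OF \<tau> \<xi> ram K mK iw fin rep_carrier[OF that]])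
      finally show ?thesis
        by (simp add: module_hom.zero[OF lin])
    qed
    then have "0 = (LINT c|\<mu>. (\<Sum>\<eta>\<in>?\<Xi>. G \<eta> c))"
      by (simp cong: Bochner_Integration.integral_cong)
    also have "\<dots> = (\<Sum>\<eta>\<in>?\<Xi>. (LINT c|\<mu>. G \<eta> c))"
      using G by (intro Bochner_Integration.integral_sum) auto
    also have "\<dots> = of_nat (card ?\<Xi>) * (LINT c|\<mu>. F c)"
      using G by simp
    finally have "of_nat (card ?\<Xi>) * (LINT c|\<mu>. F c) = 0"
      by simp
    \<comment> \<open>The number of translates must be positive to conclude that their common
      integral is 0.\<close>
    moreover have "K \<noteq> {}"
      using iw[OF one_in_SO_even] by blast
    ultimately show ?thesis
      unfolding Psi using fin by auto
  qed
qed

section \<open>The group attached to the paramodular vector\<close>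

lemma scale_conj_m_Siegel:
  fixes a :: "'f mat"
  assumes c: "c \<noteq> 0" and a: "a \<in> carrier (GL r)"
  shows "scale_conj c r (m_Siegel r a) = m_Siegel r a"
proof -
  have ac: "a \<in> carrier_mat r r" "inv\<^bsub>GL r\<^esub> a \<in> carrier_mat r r"
    using a inv_GL(1)[OF a] by (auto simp: carrier_GL)
  show ?thesis
    unfolding m_Siegel_eq[OF a] by (rule eq_matI) (use ac c in \<open>auto simp: scale_conj_def mult_2\<close>)
qed

text \<open>
  Taking for \<open>K\<close> the stabilizer of \<open>v\<close> in a conjugate of $\mathrm{SO}_{2r}(\mathfrak o)$ makes it a
  group without any appeal to the multiplicativity of the Dickson invariant.
\<close>

lemma Psi_integral_paramodular:
  assumes w: "uniformizer w" and v: "v \<in> fixed_vectors \<pi> (K_paramodular w n m)"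
    and ram: "fixed_vectors \<tau> (GL_int r) = {0}" and \<xi>: "\<xi> \<in> induced_space r sc\<^sub>\<tau> \<tau> s"
  shows "Psi_integral n r \<mu>\<^sub>X \<mu> \<Lambda>\<^sub>\<pi> \<pi> \<Lambda>\<^sub>\<tau> v \<xi> = 0"
proof -
  interpret p: smooth_representation sc\<^sub>\<pi> "SO_odd n" \<pi>
    by (rule \<pi>)
  have w0: "w \<noteq> 0"
    by (rule absF_uniformizer(1)[OF w])
  define c where "c = w ^ m"
  have c: "c \<noteq> 0"
    using w0 by (simp add: c_def)
  let ?s = "scale_conj c r" and ?E = "embed_SO n r"
  define L where "L = {k \<in> SO_even_int r. \<pi> (?E (?s k)) v = v}"
  have L_int: "L \<subseteq> SO_even_int r" and L_c: "L \<subseteq> carrier (SO_even r)"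
    using SO_even_int_subset by (auto simp: L_def)
  have E_in: "?E (?s k) \<in> carrier (SO_odd n)" if "k \<in> carrier (SO_even r)" for k
    by (rule embed_SO_in_SO_odd[OF rn(2) scale_conj_in_SO_even[OF c that]])
  have E_mult: "?E (?s (k * l)) = ?E (?s k) * ?E (?s l)" if "k \<in> carrier (SO_even r)" "l \<in> carrier (SO_even r)" for k l
    using that by (simp add: scale_conj_mult[OF c] embed_SO_mult[OF rn(2)] SO_even_carrier_mat)
  have L_mult: "k * l \<in> L" if "k \<in> L" "l \<in> L" for k l
    using that subsetD[OF L_c] by (auto simp: L_def SO_even_int_mult E_mult rep_\<pi>_mult E_in)
  have L_atr: "atr k \<in> L" if k: "k \<in> L" for k
  proof -
    have kc: "k \<in> carrier (SO_even r)"
      using k L_c by blast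
    note a = SO_even_atr[OF kc]
    have "\<pi> (?E (?s (atr k))) v = \<pi> (?E (?s (atr k))) (\<pi> (?E (?s k)) v)"
      using k by (simp add: L_def)
    also have "\<dots> = \<pi> (?E (?s (atr k * k))) v"
      unfolding E_mult[OF a(3) kc] by (rule rep_\<pi>_mult[OF E_in[OF a(3)] E_in[OF kc], symmetric])
    also have "\<dots> = v"
      using p.rep_one by (simp add: a scale_conj_one[OF c] embed_SO_one[OF rn(2)])
    finally show ?thesis
      using k SO_even_int_atr[of k r] by (simp add: L_def)
  qed
  \<comment> \<open>Through this the three kinds of generators enter \<open>L\<close>: integral Levi
    elements, integral lower unipotent elements, and exchanges of an even number of pairs.\<close>
  have gen: "k \<in> L" if "k \<in> SO_even_int r" "K_condition n r k" for k
    using v embed_scale_conj_in_K[OF rn(2) w0 that, of m] that by (simp add: L_def fixed_vectors_def c_def)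
  define K where "K = ?s ` L"
  show ?thesis
  proof (rule Psi_integral_eq_0[OF \<xi> ram])
    show "K \<subseteq> carrier (SO_even r)"
      unfolding K_def using L_c scale_conj_in_SO_even[OF c] by blast
    show "k * l \<in> K" if kl: "k \<in> K" "l \<in> K" for k l
    proof -
      obtain k' l' where kl: "k' \<in> L" "l' \<in> L" "k = ?s k'" "l = ?s l'"
        using kl by (auto simp: K_def)
      then have "k * l = ?s (k' * l')"
        using scale_conj_mult[OF c SO_even_carrier_mat SO_even_carrier_mat] L_c by (simp add: subset_iff)
      then show ?thesis
        unfolding K_def using L_mult[OF kl(1,2)] by blast
    qed
    show "atr k \<in> K" if k: "k \<in> K" for k
    proof -
      obtain k' where k': "k' \<in> L" "k = ?s k'"
        using k by (auto simp: K_def)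
      then have "atr k = ?s (atr k')"
        using scale_conj_atr[OF c SO_even_carrier_mat] L_c by (simp add: subset_iff)
      then show ?thesis
        unfolding K_def using L_atr[OF k'(1)] by blast
    qed
    show "m_Siegel r a \<in> K" if "a \<in> GL_int r" for a
      using gen[OF m_Siegel_GL_int(1)[OF that] K_condition_if_ur_zero[OF rn(2) m_Siegel_GL_int(2)[OF that]]]
        scale_conj_m_Siegel[OF c GL_int_carrier[OF that]] unfolding K_def by (metis image_eqI)
    show "finite (right_translate r \<xi> ` K)"
      unfolding K_def by (rule finite_right_translates[OF c L_int]) (use \<xi> in \<open>simp add: induced_space_def\<close>)
    show "\<pi> (embed_SO n r k) v = v" if "k \<in> K" for k
      using that by (auto simp: K_def L_def)
    show "\<exists>a\<in>carrier (GL r). \<exists>u\<in>N_Siegel r. \<exists>k\<in>K. h = m_Siegel r a * u * k"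
      if h: "h \<in> carrier (SO_even r)" for h
    proof -
      \<comment> \<open>The Iwasawa decomposition is applied to the conjugate of \<open>h\<close> by
        the inverse scaling and then carried back; the Levi component \<open>a\<close> is the same
        on both sides.\<close>
      have "inverse c \<noteq> 0"
        using c by simp
      then obtain a u Y Q where d: "a \<in> carrier (GL r)" "u \<in> N_Siegel r"
        "Y \<in> carrier_mat r r" "atr Y = - Y" "\<And>i j. i < r \<Longrightarrow> j < r \<Longrightarrow> absF (Y $$ (i, j)) \<le> 1"
        "Q \<subseteq> {..<r}" "even (card Q)"
        "scale_conj (inverse c) r h = m_Siegel r a * u * (lower_unip r Y * swap_mat r Q)"
        using iwasawa[OF scale_conj_in_SO_even[OF _ h]] by metis
      have Y: "lower_unip r Y \<in> L"
        using d(3) by (intro gen lower_unip_in_SO_even_int d K_condition_if_ur_zero rn)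
          (simp_all add: lower_unip_def quadrant_four_block)
      have Q: "swap_mat r Q \<in> L"
        by (intro gen swap_mat_in_SO_even_int d K_condition_swap_mat rn)
      define k where "k = lower_unip r Y * swap_mat r Q"
      have k: "k \<in> L"
        unfolding k_def by (rule L_mult[OF Y Q])
      obtain u' where u': "u' \<in> N_Siegel r" "?s (m_Siegel r a * u) = m_Siegel r a * u'"
        using scale_conj_parabolic[OF c d(1,2)] by blast
      have "h = ?s (scale_conj (inverse c) r h)"
        by (rule scale_conj_inverse[OF c SO_even_carrier_mat[OF h], symmetric])
      also have "\<dots> = ?s (m_Siegel r a * u * k)"
        by (simp only: d(8) k_def)
      also have "\<dots> = m_Siegel r a * u' * ?s k"
        using scale_conj_mult[OF c SO_even_carrier_mat[OF parabolic_in_SO_even[OF d(1,2)]] SO_even_carrier_mat] k L_c u'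
        by auto
      finally show ?thesis
        unfolding K_def using d(1) u'(1) k by blast
    qed
  qed
qed

end

text \<open>Identity theorem: the zeros accumulate at the point \<sigma> + 1 and the plane is
  connected. This gives uniqueness in the definite description behind \<open>Psi\<close>.\<close>

lemma nicely_meromorphic_zero_half_plane:
  assumes f: "f nicely_meromorphic_on UNIV" and z: "\<And>s. Re s > \<sigma> \<Longrightarrow> f s = 0"
  shows "f = (\<lambda>_. 0)"
proof
  fix s
  have "open {s. Re s > \<sigma>}"
    by (rule open_halfspace_Re_gt)
  moreover have "complex_of_real (\<sigma> + 1) \<in> {s. Re s > \<sigma>}"
    by simp
  ultimately have "eventually (\<lambda>s. s \<in> {s. Re s > \<sigma>}) (at (complex_of_real (\<sigma> + 1)))"
    by (rule eventually_at_in_open')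
  then have "eventually (\<lambda>s. f s = 0) (at (complex_of_real (\<sigma> + 1)))"
    by (rule eventually_mono) (use z in auto)
  then have "frequently (\<lambda>s. f s = 0) (at (complex_of_real (\<sigma> + 1)))"
    by (intro eventually_frequently) auto
  then show "f s = 0"
    by (rule frequently_eq_meromorphic_imp_constant[OF _ f]) auto
qed

theorem lemma4p3:
  fixes \<psi> :: "'f::padic_field \<Rightarrow> complex"
    and w :: 'f
    and n r m :: nat
    and sc\<^sub>\<pi> :: "complex \<Rightarrow> 'v::ab_group_add \<Rightarrow> 'v"
    and \<pi> :: "'f mat \<Rightarrow> 'v \<Rightarrow> 'v"
    and \<Lambda>\<^sub>\<pi> :: "'v \<Rightarrow> complex"
    and v :: 'v
    and sc\<^sub>\<tau> :: "complex \<Rightarrow> 'w::ab_group_add \<Rightarrow> 'w"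
    and \<tau> :: "'f mat \<Rightarrow> 'w \<Rightarrow> 'w"
    and \<Lambda>\<^sub>\<tau> :: "'w \<Rightarrow> complex"
    and \<mu>\<^sub>X :: "'f mat measure"
    and \<mu> :: "'f mat set measure"
  assumes "uniformizer w"
    and "additive_character \<psi>" and "{x. \<psi> x = 1} = integers"
    and "1 \<le> r" and "r \<le> n"
    and "smooth_representation sc\<^sub>\<pi> (SO_odd n) \<pi>"
    and "irreducible_rep sc\<^sub>\<pi> (SO_odd n) \<pi>"
    and "generic_rep sc\<^sub>\<pi> \<psi> n \<pi>"
    and "\<Lambda>\<^sub>\<pi> \<in> Hom_char sc\<^sub>\<pi> \<pi> (U_unip n) (psi_U \<psi> n)" and "\<Lambda>\<^sub>\<pi> \<noteq> (\<lambda>_. 0)"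
    and "v \<in> fixed_vectors \<pi> (K_paramodular w n m)" and "v \<noteq> 0"
    and "smooth_representation sc\<^sub>\<tau> (GL r) \<tau>"
    and "finite_length_rep sc\<^sub>\<tau> (GL r) \<tau>"
    and "functional_dim (Hom_char sc\<^sub>\<tau> \<tau> (Z_unip r) (psi_bar_Z \<psi> r)) = 1"
    and "\<Lambda>\<^sub>\<tau> \<in> Hom_char sc\<^sub>\<tau> \<tau> (Z_unip r) (psi_bar_Z \<psi> r)" and "\<Lambda>\<^sub>\<tau> \<noteq> (\<lambda>_. 0)"
    and "haar_measure (X_bar n r) \<mu>\<^sub>X"
    and "invariant_coset_measure (SO_even r) (V_unip r) \<mu>"
    and "fixed_vectors \<tau> (GL_int r) = {0}"
  shows "\<forall>s. \<forall>\<xi>\<in>induced_space r sc\<^sub>\<tau> \<tau> s.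
    Psi n r \<mu>\<^sub>X \<mu> \<Lambda>\<^sub>\<pi> \<pi> sc\<^sub>\<tau> \<Lambda>\<^sub>\<tau> \<tau> v s \<xi> = 0"
proof (intro allI ballI)
  fix s \<xi> assume \<xi>: "\<xi> \<in> induced_space r sc\<^sub>\<tau> \<tau> s"
  interpret rankin_selberg \<psi> n r sc\<^sub>\<pi> \<pi> \<Lambda>\<^sub>\<pi> v sc\<^sub>\<tau> \<tau> \<Lambda>\<^sub>\<tau> \<mu>\<^sub>X \<mu>
    by (rule rankin_selberg.intro) (fact assms)+
  let ?P = "\<lambda>f. f nicely_meromorphic_on UNIV \<and> (\<exists>\<sigma>. \<forall>s. Re s > \<sigma> \<longrightarrow>
    f s = Psi_integral n r \<mu>\<^sub>X \<mu> \<Lambda>\<^sub>\<pi> \<pi> \<Lambda>\<^sub>\<tau> v (standard_section r sc\<^sub>\<tau> \<tau> \<xi> s))"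
  \<comment> \<open>At every \<open>s\<close> the standard section through \<open>\<xi>\<close> is
    itself a member of the induced space, so the integral vanishes on the whole plane, and any half
    plane determines the continuation.\<close>
  have zero: "Psi_integral n r \<mu>\<^sub>X \<mu> \<Lambda>\<^sub>\<pi> \<pi> \<Lambda>\<^sub>\<tau> v (standard_section r sc\<^sub>\<tau> \<tau> \<xi> s) = 0" for s
    by (rule Psi_integral_paramodular[OF assms(1,11,20) standard_section_in_induced_space[OF assms(13) \<xi>]])
  have "(THE f. ?P f) = (\<lambda>_. 0)"
  proof (rule the_equality)
    show "?P (\<lambda>_. 0)"
      using zero by auto
    show "f = (\<lambda>_. 0)" if "?P f" for f
      using that zero nicely_meromorphic_zero_half_plane by auto
  qed
  then show "Psi n r \<mu>\<^sub>X \<mu> \<Lambda>\<^sub>\<pi> \<pi> sc\<^sub>\<tau> \<Lambda>\<^sub>\<tau> \<tau> v s \<xi> = 0"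
    by (simp add: Psi_def)
qed

end
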